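(* Let $\overline M$ be a Riemannian $7$-manifold with a $G_2$-structure $\varphi$, $\iota:M\to\overline M$ an orientable hypersurface with unit normal vector field $n$, $\theta$ a smooth function on $M$, and equip $M$ with the induced $SU(3)$-structure $(I,\langle\cdot,\cdot\rangle,\Psi)$ determined by $n$ and $\theta$. Let $B$ be the second fundamental form and $h=\langle H,n\rangle$, with $H$ the mean curvature. Then $$r(\omega)=\cos\theta\left(-I_{(2)}\iota^*\overline r(\varphi)+B\right)-\sin\theta\left(\iota^*\overline r(\varphi)+I_{(2)}B\right),$$ $$2I d^*\omega=\iota^*pd^*\varphi-2\,\overline r(\varphi)(n,\iota_*I\cdot)+2\,\overline r(\varphi)(\iota_*I\cdot,n),$$ $$pd^*\varphi(n)=-2\cos\theta\,\mathrm{Tr}(r(\omega))-2\sin\theta\,c_\omega(r(\omega))+12h,$$ $$\mathrm{Tr}(\iota^*\overline r(\varphi))=-\sin\theta\,\mathrm{Tr}(r(\omega))+\cos\theta\,c_\omega(r(\omega)),$$ $$3I\eta=d\theta-\overline r(\varphi)(\iota_*\cdot,n).$$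
   Context: $G_2$-structures: a $G_2$-structure on a Riemannian $7$-manifold $(\overline M,\langle\cdot,\cdot\rangle)$ is given by a global three-form $\varphi$ such that locally there is an orthonormal frame $\{e_0,\dots,e_6\}$ (a Cayley frame, indices in $\mathbb Z_7$) with $\varphi=\sum_{i\in\mathbb Z_7}e_i\wedge e_{i+1}\wedge e_{i+3}$ (vectors are identified with one-forms via the metric). $\langle P(x,y),z\rangle=\varphi(x,y,z)$, and $*\varphi=-\sum_{i\in\mathbb Z_7}e_{i+2}\wedge e_{i+4}\wedge e_{i+5}\wedge e_{i+6}$ (Hodge dual for the orientation $e_0\wedge\dots\wedge e_6$). $\overline\nabla$ is the Levi-Civita connection of $\overline M$, $\overline r(\varphi)(x,y)=\frac14\langle\overline\nabla_x\varphi,y\lrcorner*\varphi\rangle$, and $pd^*\varphi$ is the one-form $pd^*\varphi=*( *d\varphi\wedge\varphi)$. Induced structure on $M$: $Ix=P(n,x)$, the induced metric, and $\Psi=\psi_++i\psi_-$ with $\psi_+=\cos\theta\,\iota^*\varphi-\sin\theta\,\iota^*(n\lrcorner*\varphi)$, $\psi_-=\sin\theta\,\iota^*\varphi+\cos\theta\,\iota^*(n\lrcorner*\varphi)$. $\nabla$ is the Levi-Civita connection of $M$; $B(x,y)=\langle II(x,y),n\rangle=\langle\overline\nabla_xy,n\rangle$; $H=\frac16\mathrm{Tr}\,II$. Conventions on $M$: $\omega(x,y)=\langle x,Iy\rangle$; for a $(0,s)$-tensor $b$, $(I_{(i)}b)(X_1,\dots,X_s)=-b(X_1,\dots,IX_i,\dots,X_s)$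 and $(Ib)(X_1,\dots,X_s)=(-1)^sb(IX_1,\dots,IX_s)$. The inner product of $p$-forms is $\langle a,b\rangle=\frac1{p!}\sum a(e_{i_1},\dots)b(e_{i_1},\dots)$. $d^*\omega=-\sum_ie_i\lrcorner\nabla_{e_i}\omega$; $r(\omega)(x,y)=\frac12\langle\nabla_x\omega,y\lrcorner\psi_+\rangle$; $\mathrm{Tr}$ is the metric trace and $c_\omega(b)=\sum_{i,j}\omega(e_i,e_j)b(e_i,e_j)$ is the contraction of a bilinear form $b$ by $\omega$. The one-form $\eta$ on $M$ is determined by requiring that the metric connection $\nabla+\eta+\xi$, with $\eta_XY=(I\eta)(X)IY$ and $\xi_XY=-\frac12I(\nabla_XI)Y$, makes $\omega,\psi_+,\psi_-$ parallel; equivalently $(I\eta)(X)=-\frac1{12}\langle\nabla_X\psi_+,\psi_-\rangle$. *)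

theory Defs
  imports "HOL-Analysis.Analysis"
begin

section \<open>Smooth manifolds\<close>

primrec Ck_on :: "nat \<Rightarrow> 'a::real_normed_vector set \<Rightarrow> ('a \<Rightarrow> 'b::real_normed_vector) \<Rightarrow> bool" where
  "Ck_on 0 S f \<longleftrightarrow> continuous_on S f"
| "Ck_on (Suc k) S f \<longleftrightarrow> (\<forall>x\<in>S. f differentiable (at x)) \<and>
     (\<forall>v. Ck_on k S (\<lambda>x. frechet_derivative f (at x) v))"

definition smooth_on :: "'a::real_normed_vector set \<Rightarrow> ('a \<Rightarrow> 'b::real_normed_vector) \<Rightarrow> bool" where
  "smooth_on S f \<longleftrightarrow> (\<forall>k. Ck_on k S f)"

text \<open>A manifold is a whole topological space together with a smooth atlas (not necessarily
  maximal). A chart is a pair of its domain and its coordinate map.\<close>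

type_synonym ('m, 'n) atlas = "('m set \<times> ('m \<Rightarrow> real^'n)) set"

definition smooth_atlas :: "('m::topological_space, 'n::finite) atlas \<Rightarrow> bool" where
  "smooth_atlas A \<longleftrightarrow>
     (\<forall>(U, \<kappa>)\<in>A. open U \<and> open (\<kappa> ` U) \<and> homeomorphism U (\<kappa> ` U) \<kappa> (inv_into U \<kappa>)) \<and>
     (\<Union>(U, \<kappa>)\<in>A. U) = UNIV \<and>
     (\<forall>(U, \<kappa>)\<in>A. \<forall>(V, \<mu>)\<in>A. smooth_on (\<kappa> ` (U \<inter> V)) (\<mu> \<circ> inv_into U \<kappa>))"

definition smooth_map ::
    "('m::topological_space, 'n::finite) atlas \<Rightarrow> ('l::topological_space, 'k::finite) atlas \<Rightarrow> ('m \<Rightarrow> 'l) \<Rightarrow> bool" where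
  "smooth_map A B f \<longleftrightarrow> continuous_on UNIV f \<and>
     (\<forall>(U, \<kappa>)\<in>A. \<forall>(V, \<mu>)\<in>B. smooth_on (\<kappa> ` (U \<inter> f -` V)) (\<mu> \<circ> f \<circ> inv_into U \<kappa>))"

text \<open>For every point \<open>p\<close> a chart around \<open>p\<close> is selected, and the tangent space at \<open>p\<close> is
  \<open>real^'n\<close>, a tangent vector being identified with its components in the selected chart.
  Thus a vector field is a map \<open>'m \<Rightarrow> real^'n\<close>, but its values at different points refer to
  different charts, and have to be converted to a common chart before being compared or
  differentiated.\<close>

definition chart_at :: "('m, 'n::finite) atlas \<Rightarrow> 'm \<Rightarrow> 'm set \<times> ('m \<Rightarrow> real^'n)" where
  "chart_at A p = (SOME c. c \<in> A \<and> p \<in> fst c)"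

definition dom_at :: "('m, 'n::finite) atlas \<Rightarrow> 'm \<Rightarrow> 'm set" where
  "dom_at A p = fst (chart_at A p)"

definition coord_at :: "('m, 'n::finite) atlas \<Rightarrow> 'm \<Rightarrow> 'm \<Rightarrow> real^'n" where
  "coord_at A p = snd (chart_at A p)"

definition param_at :: "('m, 'n::finite) atlas \<Rightarrow> 'm \<Rightarrow> real^'n \<Rightarrow> 'm" where
  "param_at A p = inv_into (dom_at A p) (coord_at A p)"

text \<open>\<open>coord_change A p r q\<close> converts the components of a vector at \<open>q\<close> from the chart selected
  at \<open>p\<close> to the one selected at \<open>r\<close>.\<close>

definition coord_change :: "('m, 'n::finite) atlas \<Rightarrow> 'm \<Rightarrow> 'm \<Rightarrow> 'm \<Rightarrow> real^'n \<Rightarrow> real^'n" where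
  "coord_change A p r q =
     frechet_derivative (coord_at A r \<circ> param_at A p) (at (coord_at A p q))"

definition differential ::
    "('m, 'n::finite) atlas \<Rightarrow> ('l, 'k::finite) atlas \<Rightarrow> ('m \<Rightarrow> 'l) \<Rightarrow> 'm \<Rightarrow> real^'n \<Rightarrow> real^'k" where
  "differential A B f p =
     frechet_derivative (coord_at B (f p) \<circ> f \<circ> param_at A p) (at (coord_at A p p))"

definition smooth_immersion ::
    "('m::topological_space, 'n::finite) atlas \<Rightarrow> ('l::topological_space, 'k::finite) atlas \<Rightarrow> ('m \<Rightarrow> 'l) \<Rightarrow> bool" where
  "smooth_immersion A B f \<longleftrightarrow> smooth_map A B f \<and> (\<forall>p. inj (differential A B f p))"

text \<open>A vector field along \<open>f\<close> assigns to \<open>q\<close> a tangent vector at \<open>f q\<close>. Ordinary vector fields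
  are vector fields along the identity.\<close>

definition along_in_chart ::
    "('m, 'n::finite) atlas \<Rightarrow> ('l, 'k::finite) atlas \<Rightarrow> ('m \<Rightarrow> 'l) \<Rightarrow> 'm \<Rightarrow> ('m \<Rightarrow> real^'k) \<Rightarrow> real^'n \<Rightarrow> real^'k" where
  "along_in_chart A B f p V u =
     (let q = param_at A p u in coord_change B (f q) (f p) (f q) (V q))"

definition smooth_along ::
    "('m::topological_space, 'n::finite) atlas \<Rightarrow> ('l, 'k::finite) atlas \<Rightarrow> ('m \<Rightarrow> 'l) \<Rightarrow> 'm set \<Rightarrow> ('m \<Rightarrow> real^'k) \<Rightarrow> bool" where
  "smooth_along A B f W V \<longleftrightarrow>
     (\<forall>p. smooth_on (coord_at A p ` (W \<inter> dom_at A p \<inter> f -` dom_at B (f p))) (along_in_chart A B f p V))"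

text \<open>The extension of a tangent vector \<open>y\<close> at \<open>p\<close> to a vector field near \<open>p\<close> with constant
  components in the chart selected at \<open>p\<close>.\<close>

definition const_ext :: "('m, 'n::finite) atlas \<Rightarrow> 'm \<Rightarrow> real^'n \<Rightarrow> 'm \<Rightarrow> real^'n" where
  "const_ext A p y q = coord_change A p q q y"


section \<open>Tensors and forms\<close>

text \<open>A \<open>(0,k)\<close>-tensor is a function on lists of vectors of which only the values on lists of
  length \<open>k\<close> are relevant. Functions are \<open>(0,0)\<close>-tensor fields.\<close>

type_synonym 'n tensor = "(real^'n) list \<Rightarrow> real"

definition multilinear :: "nat \<Rightarrow> 'n::finite tensor \<Rightarrow> bool" where
  "multilinear k b \<longleftrightarrow> (\<forall>xs i. length xs = k \<longrightarrow> i < k \<longrightarrow> linear (\<lambda>v. b (xs[i := v])))"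

definition tensor_in_chart ::
    "('m, 'n::finite) atlas \<Rightarrow> 'm \<Rightarrow> ('m \<Rightarrow> 'n tensor) \<Rightarrow> real^'n \<Rightarrow> 'n tensor" where
  "tensor_in_chart A p b u xs =
     (let q = param_at A p u in b q (map (coord_change A p q q) xs))"

definition smooth_tensor_field ::
    "('m::topological_space, 'n::finite) atlas \<Rightarrow> nat \<Rightarrow> ('m \<Rightarrow> 'n tensor) \<Rightarrow> bool" where
  "smooth_tensor_field A k b \<longleftrightarrow> (\<forall>p. multilinear k (b p)) \<and>
     (\<forall>p xs. length xs = k \<longrightarrow>
        smooth_on (coord_at A p ` dom_at A p) (\<lambda>u. tensor_in_chart A p b u xs))"

definition pullback ::
    "('m, 'n::finite) atlas \<Rightarrow> ('l, 'k::finite) atlas \<Rightarrow> ('m \<Rightarrow> 'l) \<Rightarrow> ('l \<Rightarrow> 'k tensor) \<Rightarrow> 'm \<Rightarrow> 'n tensor" where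
  "pullback A B f b p xs = b (f p) (map (differential A B f p) xs)"

definition interior_mult :: "real^'n \<Rightarrow> 'n::finite tensor \<Rightarrow> 'n tensor" where
  "interior_mult y a xs = a (y # xs)"

definition wedge1 :: "(real^'n \<Rightarrow> real) list \<Rightarrow> 'n::finite tensor" where
  "wedge1 \<alpha>s xs = (\<Sum>\<sigma> | \<sigma> permutes {..<length \<alpha>s}.
     of_int (sign \<sigma>) * (\<Prod>i<length \<alpha>s. (\<alpha>s ! i) (xs ! \<sigma> i)))"

text \<open>The wedge product of a \<open>k\<close>-form and an \<open>l\<close>-form, normalized so that it is compatible with
  the wedge product of one-forms above.\<close>

definition wedge :: "nat \<Rightarrow> nat \<Rightarrow> 'n::finite tensor \<Rightarrow> 'n tensor \<Rightarrow> 'n tensor" where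
  "wedge k l a b xs = (\<Sum>\<sigma> | \<sigma> permutes {..<k + l}.
     of_int (sign \<sigma>) * a (map (\<lambda>i. xs ! \<sigma> i) [0..<k]) * b (map (\<lambda>i. xs ! \<sigma> i) [k..<k + l]))
     / (fact k * fact l)"

definition ext_deriv :: "('m, 'n::finite) atlas \<Rightarrow> ('m \<Rightarrow> 'n tensor) \<Rightarrow> 'm \<Rightarrow> 'n tensor" where
  "ext_deriv A b p xs = (\<Sum>i<length xs. (-1) ^ i *
     frechet_derivative (\<lambda>u. tensor_in_chart A p b u (take i xs @ drop (Suc i) xs))
       (at (coord_at A p p)) (xs ! i))"

text \<open>Below, \<open>g\<close> is an inner product on a single tangent space.\<close>

definition orthonormal_basis :: "'n::finite tensor \<Rightarrow> ('n \<Rightarrow> real^'n) \<Rightarrow> bool" where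
  "orthonormal_basis g e \<longleftrightarrow> (\<forall>i j. g [e i, e j] = (if i = j then 1 else 0))"

text \<open>The expressions that use this basis do not depend on the choice.\<close>

definition onb :: "'n::finite tensor \<Rightarrow> 'n \<Rightarrow> real^'n" where
  "onb g = (SOME e. orthonormal_basis g e)"

definition metric_trace :: "'n::finite tensor \<Rightarrow> 'n tensor \<Rightarrow> real" where
  "metric_trace g b = (\<Sum>i\<in>UNIV. b [onb g i, onb g i])"

definition contraction :: "'n::finite tensor \<Rightarrow> 'n tensor \<Rightarrow> 'n tensor \<Rightarrow> real" where
  "contraction g \<omega> b = (\<Sum>i\<in>UNIV. \<Sum>j\<in>UNIV. \<omega> [onb g i, onb g j] * b [onb g i, onb g j])"

definition form_inner :: "'n::finite tensor \<Rightarrow> nat \<Rightarrow> 'n tensor \<Rightarrow> 'n tensor \<Rightarrow> real" where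
  "form_inner g k a b =
     (\<Sum>is | length is = k. a (map (onb g) is) * b (map (onb g) is)) / fact k"

text \<open>The Hodge dual of a \<open>k\<close>-form, characterized by \<open>a \<and> *b = \<langle>a, b\<rangle> vol\<close>; it maps
  \<open>e\<^sub>1 \<and> \<dots> \<and> e\<^sub>k\<close> to \<open>e\<^sub>k\<^sub>+\<^sub>1 \<and> \<dots> \<and> e\<^sub>n\<close> for an oriented orthonormal basis.\<close>

definition hodge :: "'n::finite tensor \<Rightarrow> 'n tensor \<Rightarrow> nat \<Rightarrow> 'n tensor \<Rightarrow> 'n tensor" where
  "hodge g vol k a xs =
     (\<Sum>is | length is = k. a (map (onb g) is) * vol (map (onb g) is @ xs)) / fact k"

text \<open>The operators \<open>I\<^sub>(\<^sub>i\<^sub>)\<close> (slots are numbered from \<open>1\<close>) and \<open>I\<close> on tensors.\<close>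

definition act_slot :: "(real^'n \<Rightarrow> real^'n) \<Rightarrow> nat \<Rightarrow> 'n::finite tensor \<Rightarrow> 'n tensor" where
  "act_slot I i b xs = - b (xs[i - 1 := I (xs ! (i - 1))])"

definition act_all :: "(real^'n \<Rightarrow> real^'n) \<Rightarrow> 'n::finite tensor \<Rightarrow> 'n tensor" where
  "act_all I b xs = (-1) ^ length xs * b (map I xs)"


section \<open>Riemannian manifolds\<close>

record ('m, 'n) riem =
  mfd_atlas :: "('m, 'n) atlas"
  mfd_metric :: "'m \<Rightarrow> 'n tensor"

definition riemannian_manifold :: "('m::topological_space, 'n::finite) riem \<Rightarrow> bool" where
  "riemannian_manifold M \<longleftrightarrow> smooth_atlas (mfd_atlas M) \<and>
     smooth_tensor_field (mfd_atlas M) 2 (mfd_metric M) \<and>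
     (\<forall>p x y. mfd_metric M p [x, y] = mfd_metric M p [y, x]) \<and>
     (\<forall>p x. x \<noteq> 0 \<longrightarrow> 0 < mfd_metric M p [x, x])"

text \<open>A connection is given at \<open>p\<close> by its coefficients \<open>\<Gamma>\<close> in the chart selected at \<open>p\<close>, that is,
  \<open>\<nabla>\<^sub>x Y = dY(x) + \<Gamma>(x, Y)\<close>. The next two definitions are the induced derivative of tensor fields,
  \<open>(\<nabla>\<^sub>x b)(y\<^sub>1, \<dots>)\<close>, and of vector fields along a map (the pullback connection, where \<open>\<Gamma>\<close> are the
  coefficients at \<open>f p\<close>).\<close>

definition cov_tensor ::
    "('m, 'n::finite) atlas \<Rightarrow> (real^'n \<Rightarrow> real^'n \<Rightarrow> real^'n) \<Rightarrow> ('m \<Rightarrow> 'n tensor) \<Rightarrow> 'm \<Rightarrow> real^'n \<Rightarrow> 'n tensor" where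
  "cov_tensor A \<Gamma> b p x ys =
     frechet_derivative (\<lambda>u. tensor_in_chart A p b u ys) (at (coord_at A p p)) x
     - (\<Sum>i<length ys. b p (ys[i := \<Gamma> x (ys ! i)]))"

definition cov_along ::
    "('m, 'n::finite) atlas \<Rightarrow> ('l, 'k::finite) atlas \<Rightarrow> (real^'k \<Rightarrow> real^'k \<Rightarrow> real^'k) \<Rightarrow> ('m \<Rightarrow> 'l) \<Rightarrow>
     ('m \<Rightarrow> real^'k) \<Rightarrow> 'm \<Rightarrow> real^'n \<Rightarrow> real^'k" where
  "cov_along A B \<Gamma> f V p x =
     frechet_derivative (along_in_chart A B f p V) (at (coord_at A p p)) x
     + \<Gamma> (differential A B f p x) (V p)"

text \<open>The unique torsion-free metric connection; both conditions are pointwise in terms of the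
  coefficients.\<close>

definition levi_civita :: "('m, 'n::finite) riem \<Rightarrow> 'm \<Rightarrow> real^'n \<Rightarrow> real^'n \<Rightarrow> real^'n" where
  "levi_civita M p = (THE \<Gamma>. bilinear \<Gamma> \<and> (\<forall>x y. \<Gamma> x y = \<Gamma> y x) \<and>
     (\<forall>x y z. cov_tensor (mfd_atlas M) \<Gamma> (mfd_metric M) p x [y, z] = 0))"

definition nabla :: "('m, 'n::finite) riem \<Rightarrow> ('m \<Rightarrow> 'n tensor) \<Rightarrow> 'm \<Rightarrow> real^'n \<Rightarrow> 'n tensor" where
  "nabla M b p = cov_tensor (mfd_atlas M) (levi_civita M p) b p"

text \<open>\<open>(\<nabla>\<^sub>x J) y = \<nabla>\<^sub>x (J Y) - J (\<nabla>\<^sub>x Y)\<close> for a field \<open>J\<close> of endomorphisms and any extension \<open>Y\<close> of \<open>y\<close>.\<close>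

definition nabla_endo ::
    "('m, 'n::finite) riem \<Rightarrow> ('m \<Rightarrow> real^'n \<Rightarrow> real^'n) \<Rightarrow> 'm \<Rightarrow> real^'n \<Rightarrow> real^'n \<Rightarrow> real^'n" where
  "nabla_endo M J p x y =
     (let A = mfd_atlas M;
          D = (\<lambda>Y. cov_along A A (levi_civita M p) (\<lambda>q. q) Y p x)
      in D (\<lambda>q. J q (const_ext A p y q)) - J p (D (const_ext A p y)))"

definition codiff :: "('m, 'n::finite) riem \<Rightarrow> ('m \<Rightarrow> 'n tensor) \<Rightarrow> 'm \<Rightarrow> 'n tensor" where
  "codiff M b p xs = (let e = onb (mfd_metric M p) in
     - (\<Sum>i\<in>UNIV. interior_mult (e i) (nabla M b p (e i)) xs))"

definition induced_metric ::
    "('m, 'n::finite) riem \<Rightarrow> ('l, 'k::finite) riem \<Rightarrow> ('m \<Rightarrow> 'l) \<Rightarrow> bool" where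
  "induced_metric M N f \<longleftrightarrow>
     (\<forall>p x y. mfd_metric M p [x, y] = pullback (mfd_atlas M) (mfd_atlas N) f (mfd_metric N) p [x, y])"

definition unit_normal_field ::
    "('m::topological_space, 'n::finite) riem \<Rightarrow> ('l, 'k::finite) riem \<Rightarrow> ('m \<Rightarrow> 'l) \<Rightarrow> ('m \<Rightarrow> real^'k) \<Rightarrow> bool" where
  "unit_normal_field M N f n \<longleftrightarrow> smooth_along (mfd_atlas M) (mfd_atlas N) f UNIV n \<and>
     (\<forall>p. mfd_metric N (f p) [n p, n p] = 1 \<and>
        (\<forall>x. mfd_metric N (f p) [n p, differential (mfd_atlas M) (mfd_atlas N) f p x] = 0))"

text \<open>\<open>II(x, y)\<close> is the normal component of the ambient derivative in direction \<open>x\<close> of the image of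
  an extension of \<open>y\<close>.\<close>

definition second_ff ::
    "('m, 'n::finite) riem \<Rightarrow> ('l, 'k::finite) riem \<Rightarrow> ('m \<Rightarrow> 'l) \<Rightarrow> ('m \<Rightarrow> real^'k) \<Rightarrow> 'm \<Rightarrow> real^'n \<Rightarrow> real^'n \<Rightarrow> real^'k" where
  "second_ff M N f n p x y =
     (let A = mfd_atlas M; B = mfd_atlas N;
          v = cov_along A B (levi_civita N (f p)) f (\<lambda>q. differential A B f q (const_ext A p y q)) p x
      in mfd_metric N (f p) [v, n p] *\<^sub>R n p)"

definition scalar_second_ff ::
    "('m, 'n::finite) riem \<Rightarrow> ('l, 'k::finite) riem \<Rightarrow> ('m \<Rightarrow> 'l) \<Rightarrow> ('m \<Rightarrow> real^'k) \<Rightarrow> 'm \<Rightarrow> 'n tensor" where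
  "scalar_second_ff M N f n p xs =
     mfd_metric N (f p) [second_ff M N f n p (xs ! 0) (xs ! 1), n p]"

definition mean_curvature ::
    "('m, 'n::finite) riem \<Rightarrow> ('l, 'k::finite) riem \<Rightarrow> ('m \<Rightarrow> 'l) \<Rightarrow> ('m \<Rightarrow> real^'k) \<Rightarrow> 'm \<Rightarrow> real^'k" where
  "mean_curvature M N f n p = (let e = onb (mfd_metric M p) in
     (1 / real CARD('n)) *\<^sub>R (\<Sum>i\<in>UNIV. second_ff M N f n p (e i) (e i)))"


section \<open>\<open>G\<^sub>2\<close>-structures\<close>

text \<open>The index type \<open>7\<close> is \<open>\<int>/7\<close>, with cyclic addition.\<close>

definition cayley_frame :: "7 tensor \<Rightarrow> 7 tensor \<Rightarrow> (7 \<Rightarrow> real^7) \<Rightarrow> bool" where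
  "cayley_frame g \<phi> e \<longleftrightarrow> orthonormal_basis g e \<and>
     (\<forall>x y z. \<phi> [x, y, z] = (\<Sum>i\<in>UNIV.
        wedge1 (map (\<lambda>j v. g [e j, v]) [i, i + 1, i + 3]) [x, y, z]))"

definition g2_structure :: "('l::topological_space, 7) riem \<Rightarrow> ('l \<Rightarrow> 7 tensor) \<Rightarrow> bool" where
  "g2_structure N \<phi> \<longleftrightarrow> smooth_tensor_field (mfd_atlas N) 3 \<phi> \<and>
     (\<forall>p. \<exists>W e. open W \<and> p \<in> W \<and>
        (\<forall>i. smooth_along (mfd_atlas N) (mfd_atlas N) (\<lambda>q. q) W (e i)) \<and>
        (\<forall>q\<in>W. cayley_frame (mfd_metric N q) (\<phi> q) (\<lambda>i. e i q)))"

text \<open>The volume form \<open>e\<^sub>0 \<and> \<dots> \<and> e\<^sub>6\<close>; all Cayley frames at a point induce the same orientation.\<close>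

definition g2_vol :: "('l, 7) riem \<Rightarrow> ('l \<Rightarrow> 7 tensor) \<Rightarrow> 'l \<Rightarrow> 7 tensor" where
  "g2_vol N \<phi> q = (let g = mfd_metric N q; e = (SOME e. cayley_frame g (\<phi> q) e) in
     wedge1 (map (\<lambda>j v. g [e j, v]) [0, 1, 2, 3, 4, 5, 6]))"

definition g2_hodge :: "('l, 7) riem \<Rightarrow> ('l \<Rightarrow> 7 tensor) \<Rightarrow> nat \<Rightarrow> ('l \<Rightarrow> 7 tensor) \<Rightarrow> 'l \<Rightarrow> 7 tensor" where
  "g2_hodge N \<phi> k a q = hodge (mfd_metric N q) (g2_vol N \<phi> q) k (a q)"

definition g2_cross :: "('l, 7) riem \<Rightarrow> ('l \<Rightarrow> 7 tensor) \<Rightarrow> 'l \<Rightarrow> real^7 \<Rightarrow> real^7 \<Rightarrow> real^7" where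
  "g2_cross N \<phi> q x y = (THE v. \<forall>z. mfd_metric N q [v, z] = \<phi> q [x, y, z])"

definition r_phi :: "('l, 7) riem \<Rightarrow> ('l \<Rightarrow> 7 tensor) \<Rightarrow> 'l \<Rightarrow> 7 tensor" where
  "r_phi N \<phi> q xs = 1 / 4 *
     form_inner (mfd_metric N q) 3 (nabla N \<phi> q (xs ! 0)) (interior_mult (xs ! 1) (g2_hodge N \<phi> 3 \<phi> q))"

definition pd_star :: "('l, 7) riem \<Rightarrow> ('l \<Rightarrow> 7 tensor) \<Rightarrow> 'l \<Rightarrow> 7 tensor" where
  "pd_star N \<phi> =
     g2_hodge N \<phi> 6 (\<lambda>q. wedge 3 3 (g2_hodge N \<phi> 4 (ext_deriv (mfd_atlas N) \<phi>) q) (\<phi> q))"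


section \<open>The induced \<open>SU(3)\<close>-structure on a hypersurface\<close>

definition su3_I ::
    "('m, 6) riem \<Rightarrow> ('l, 7) riem \<Rightarrow> ('l \<Rightarrow> 7 tensor) \<Rightarrow> ('m \<Rightarrow> 'l) \<Rightarrow> ('m \<Rightarrow> real^7) \<Rightarrow> 'm \<Rightarrow> real^6 \<Rightarrow> real^6" where
  "su3_I M N \<phi> f n p x = (let df = differential (mfd_atlas M) (mfd_atlas N) f p in
     THE y. df y = g2_cross N \<phi> (f p) (n p) (df x))"

definition su3_omega ::
    "('m, 6) riem \<Rightarrow> ('l, 7) riem \<Rightarrow> ('l \<Rightarrow> 7 tensor) \<Rightarrow> ('m \<Rightarrow> 'l) \<Rightarrow> ('m \<Rightarrow> real^7) \<Rightarrow> 'm \<Rightarrow> 6 tensor" where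
  "su3_omega M N \<phi> f n p xs = mfd_metric M p [xs ! 0, su3_I M N \<phi> f n p (xs ! 1)]"

definition pull_phi ::
    "('m, 6) riem \<Rightarrow> ('l, 7) riem \<Rightarrow> ('l \<Rightarrow> 7 tensor) \<Rightarrow> ('m \<Rightarrow> 'l) \<Rightarrow> 'm \<Rightarrow> 6 tensor" where
  "pull_phi M N \<phi> f = pullback (mfd_atlas M) (mfd_atlas N) f \<phi>"

definition pull_n_star_phi ::
    "('m, 6) riem \<Rightarrow> ('l, 7) riem \<Rightarrow> ('l \<Rightarrow> 7 tensor) \<Rightarrow> ('m \<Rightarrow> 'l) \<Rightarrow> ('m \<Rightarrow> real^7) \<Rightarrow> 'm \<Rightarrow> 6 tensor" where
  "pull_n_star_phi M N \<phi> f n p xs =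
     interior_mult (n p) (g2_hodge N \<phi> 3 \<phi> (f p)) (map (differential (mfd_atlas M) (mfd_atlas N) f p) xs)"

definition su3_psi_plus ::
    "('m, 6) riem \<Rightarrow> ('l, 7) riem \<Rightarrow> ('l \<Rightarrow> 7 tensor) \<Rightarrow> ('m \<Rightarrow> 'l) \<Rightarrow> ('m \<Rightarrow> real^7) \<Rightarrow> ('m \<Rightarrow> real) \<Rightarrow> 'm \<Rightarrow> 6 tensor" where
  "su3_psi_plus M N \<phi> f n \<theta> p xs =
     cos (\<theta> p) * pull_phi M N \<phi> f p xs - sin (\<theta> p) * pull_n_star_phi M N \<phi> f n p xs"

definition su3_psi_minus ::
    "('m, 6) riem \<Rightarrow> ('l, 7) riem \<Rightarrow> ('l \<Rightarrow> 7 tensor) \<Rightarrow> ('m \<Rightarrow> 'l) \<Rightarrow> ('m \<Rightarrow> real^7) \<Rightarrow> ('m \<Rightarrow> real) \<Rightarrow> 'm \<Rightarrow> 6 tensor" where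
  "su3_psi_minus M N \<phi> f n \<theta> p xs =
     sin (\<theta> p) * pull_phi M N \<phi> f p xs + cos (\<theta> p) * pull_n_star_phi M N \<phi> f n p xs"

definition r_omega ::
    "('m, 6) riem \<Rightarrow> ('m \<Rightarrow> 6 tensor) \<Rightarrow> ('m \<Rightarrow> 6 tensor) \<Rightarrow> 'm \<Rightarrow> 6 tensor" where
  "r_omega M \<omega> \<psi>p p xs = 1 / 2 *
     form_inner (mfd_metric M p) 2 (nabla M \<omega> p (xs ! 0)) (interior_mult (xs ! 1) (\<psi>p p))"

definition parallel_at ::
    "('m, 'n::finite) atlas \<Rightarrow> (real^'n \<Rightarrow> real^'n \<Rightarrow> real^'n) \<Rightarrow> nat \<Rightarrow> ('m \<Rightarrow> 'n tensor) \<Rightarrow> 'm \<Rightarrow> bool" where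
  "parallel_at A \<Gamma> k b p \<longleftrightarrow> (\<forall>x ys. length ys = k \<longrightarrow> cov_tensor A \<Gamma> b p x ys = 0)"

text \<open>Coefficients at \<open>p\<close> of the connection \<open>\<nabla> + \<eta> + \<xi>\<close>, where \<open>\<eta>\<^sub>X Y = (I \<eta>)(X) I Y\<close> and
  \<open>\<xi>\<^sub>X Y = - 1/2 I (\<nabla>\<^sub>X I) Y\<close>.\<close>

definition su3_connection ::
    "('m, 6) riem \<Rightarrow> ('m \<Rightarrow> real^6 \<Rightarrow> real^6) \<Rightarrow> 6 tensor \<Rightarrow> 'm \<Rightarrow> real^6 \<Rightarrow> real^6 \<Rightarrow> real^6" where
  "su3_connection M I \<eta> p x y = levi_civita M p x y + act_all (I p) \<eta> [x] *\<^sub>R I p y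
     + (- 1 / 2) *\<^sub>R I p (nabla_endo M I p x y)"

text \<open>The unique one-form for which that connection makes \<open>\<omega>\<close>, \<open>\<psi>\<^sub>+\<close> and \<open>\<psi>\<^sub>-\<close> parallel. The
  requirement is pointwise in \<open>\<eta>\<close>.\<close>

definition eta_form ::
    "('m, 6) riem \<Rightarrow> ('m \<Rightarrow> real^6 \<Rightarrow> real^6) \<Rightarrow> ('m \<Rightarrow> 6 tensor) \<Rightarrow> ('m \<Rightarrow> 6 tensor) \<Rightarrow> ('m \<Rightarrow> 6 tensor) \<Rightarrow>
     'm \<Rightarrow> 6 tensor" where
  "eta_form M I \<omega> \<psi>p \<psi>m p xs = (THE \<eta>. linear \<eta> \<and>
     (let A = mfd_atlas M; \<Gamma> = su3_connection M I (\<lambda>zs. \<eta> (zs ! 0)) p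
      in parallel_at A \<Gamma> 2 \<omega> p \<and> parallel_at A \<Gamma> 3 \<psi>p p \<and> parallel_at A \<Gamma> 3 \<psi>m p)) (xs ! 0)"

end

theory Submission
  imports Defs
begin

text \<open>Differentiating a smooth local Cayley frame gives the action of a skew endomorphism on \<open>\<phi>\<close>
  and \<open>*\<phi>\<close>, of which only the component in \<open>so(7)/g\<^sub>2 = \<real>\<^sup>7\<close> matters; hence the one-form
  \<open>r(x, \<cdot>)\<close> with \<open>r = r(\<phi>)\<close> determines both derivatives: \<open>\<nabla>\<^sub>x\<phi> = r(x, \<cdot>) \<lrcorner> *\<phi>\<close> and
  \<open>\<nabla>\<^sub>x *\<phi> = - r(x, \<cdot>) \<and> \<phi>\<close>. The tensors \<open>\<omega>\<close>, \<open>\<iota>*\<phi>\<close> and \<open>\<iota>*(n \<lrcorner> *\<phi>)\<close> are pulled back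
  from \<open>\<phi>\<close>, \<open>*\<phi>\<close> and \<open>n\<close>, so the formulas of Gauss and Weingarten express their covariant
  derivatives by \<open>r\<close> and the second fundamental form. In a Cayley frame with \<open>e\<^sub>0 = n\<close> the first four
  identities are then identities between the structure constants of \<open>\<phi>\<close> and \<open>*\<phi>\<close>. For the last
  one, \<open>\<nabla> + \<eta> + \<xi>\<close> always makes \<open>\<omega>\<close> parallel and rotates \<open>\<iota>*\<phi>\<close> and \<open>\<iota>*(n \<lrcorner> *\<phi>)\<close> into each
  other with speed \<open>3 (I\<eta>)(x) + r(x, n)\<close>, so \<open>\<psi>\<^sub>+\<close> and \<open>\<psi>\<^sub>-\<close> are parallel precisely if this speed
  is \<open>d\<theta>(x)\<close>.\<close>


section \<open>Multilinear and alternating tensors\<close>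

text \<open>The definitions hide choices: traces and Hodge duals use a basis picked at each point,
  the orientation uses a frame picked at each point, and a tangent vector is a list of components in
  a chart picked at its base point. Such choices need not vary continuously. Hence contractions are
  proved independent of the orthonormal basis, the dual of \<phi> is rewritten as a contraction of
  \<phi> with itself plus metric terms, which can be differentiated, and all fields near p are read
  in the charts at p and \<iota> p. Constants: contracting the dual of \<phi> with y gives a form of
  squared norm 4 |y|^2, hence the 1/4 in r(\<phi>); 12 h is twice the trace of the second
  fundamental form; the 3 in 3 I \<eta> is the degree of \<psi>_+ + i \<psi>_-, a form of pure type
  on which I acts as a derivation by three times a quarter turn. The third and fourth identities
  come from the trace and the \<omega>-contraction of the first one, which together are a vector
  rotated by \<theta>.\<close>

lemma exhaust_7: "x = 0 \<or> x = 1 \<or> x = 2 \<or> x = 3 \<or> x = 4 \<or> x = 5 \<or> x = (6::7)"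
proof (induct x)
  case (of_int z)
  then have "0 \<le> z" and "z < 7" by simp_all
  then have "z = 0 \<or> z = 1 \<or> z = 2 \<or> z = 3 \<or> z = 4 \<or> z = 5 \<or> z = 6" by arith
  then show ?case by auto
qed

lemma UNIV_7: "(UNIV :: 7 set) = {0, 1, 2, 3, 4, 5, 6}"
  using exhaust_7 by auto

lemma exhaust_6: "x = 0 \<or> x = 1 \<or> x = 2 \<or> x = 3 \<or> x = 4 \<or> x = (5::6)"
proof (induct x)
  case (of_int z)
  then have "0 \<le> z" and "z < 6" by simp_all
  then have "z = 0 \<or> z = 1 \<or> z = 2 \<or> z = 3 \<or> z = 4 \<or> z = 5" by arith
  then show ?case by auto
qed

section \<open>Multilinear functions on lists of vectors\<close>

lemma multilinear_Cons:
  assumes "multilinear (Suc k) F" shows "multilinear k (\<lambda>xs. F (y # xs))"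
  unfolding multilinear_def
proof (intro allI impI)
  fix xs :: "(real^'a) list" and i assume "length xs = k" "i < k"
  then show "linear (\<lambda>v. F (y # xs[i := v]))"
    using assms unfolding multilinear_def by (elim allE[of _ "y # xs"] allE[of _ "Suc i"]) simp
qed

lemma multilinear_linear_Cons:
  assumes "multilinear (Suc k) F" "length xs = k" shows "linear (\<lambda>v. F (v # xs))"
  using assms unfolding multilinear_def by (elim allE[of _ "undefined # xs"] allE[of _ 0]) simp

lemma multilinear_linear_update:
  assumes "multilinear k F" "length xs = k" "i < k" shows "linear (\<lambda>v. F (xs[i := v]))"
  using assms unfolding multilinear_def by blast

lemma multilinear_update_sum:
  assumes "multilinear k F" "length xs = k" "i < k" "finite S"
  shows "F (xs[i := \<Sum>j\<in>S. c j *\<^sub>R v j]) = (\<Sum>j\<in>S. c j * F (xs[i := v j]))"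
  using linear_sum[OF multilinear_linear_update[OF assms(1-3)], of "\<lambda>j. c j *\<^sub>R v j" S]
    linear_scale[OF multilinear_linear_update[OF assms(1-3)]] by simp

lemma multilinear_2:
  assumes "multilinear 2 F" shows "linear (\<lambda>v. F [v, y])" "linear (\<lambda>v. F [x, v])"
  using multilinear_linear_update[OF assms, of "[undefined, y]" 0]
    multilinear_linear_update[OF assms, of "[x, undefined]" 1] by simp_all

lemma multilinear_3:
  assumes "multilinear 3 F"
  shows "linear (\<lambda>v. F [v, y, z])" "linear (\<lambda>v. F [x, v, z])" "linear (\<lambda>v. F [x, y, v])"
  using multilinear_linear_update[OF assms, of "[undefined, y, z]" 0]
    multilinear_linear_update[OF assms, of "[x, undefined, z]" 1]
    multilinear_linear_update[OF assms, of "[x, y, undefined]" 2] by simp_all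

lemma multilinear_4:
  assumes "multilinear 4 F"
  shows "linear (\<lambda>v. F [v, y, z, w])" "linear (\<lambda>v. F [x, v, z, w])" "linear (\<lambda>v. F [x, y, v, w])"
    "linear (\<lambda>v. F [x, y, z, v])"
  using multilinear_linear_update[OF assms, of "[undefined, y, z, w]" 0]
    multilinear_linear_update[OF assms, of "[x, undefined, z, w]" 1]
    multilinear_linear_update[OF assms, of "[x, y, undefined, w]" 2]
    multilinear_linear_update[OF assms, of "[x, y, z, undefined]" 3] by simp_all

text \<open>Only neighbours are exchanged. These exchanges generate all permutations, and they fit
  list patterns, so no index arithmetic is needed.\<close>

definition alternating :: "nat \<Rightarrow> ('a list \<Rightarrow> real) \<Rightarrow> bool" where
  "alternating k F \<longleftrightarrow> (\<forall>xs x y ys. length xs + length ys + 2 = k \<longrightarrow>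
     F (xs @ x # y # ys) = - F (xs @ y # x # ys))"

lemma alternatingD:
  "alternating k F \<Longrightarrow> length xs + length ys + 2 = k \<Longrightarrow> F (xs @ x # y # ys) = - F (xs @ y # x # ys)"
  unfolding alternating_def by blast

text \<open>Bubble sort: the head of the first list is located in the second, moved to the front by
  exchanges of neighbours, and then the tails are compared.\<close>

lemma swap_invariant_mset:
  assumes "\<And>xs x y ys. length xs + length ys + 2 = k \<Longrightarrow> P (xs @ x # y # ys) = P (xs @ y # x # ys)"
    and "mset is = mset js" and "length is = k"
  shows "P is = P js"
  using assms
proof (induction "is" arbitrary: P js k)
  case (Cons x is')
  obtain us vs where js: "js = us @ x # vs"
    using Cons.prems(2) by (metis list.set_intros(1) set_mset_mset split_list)
  have len: "length us + length vs = length is'"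
    using mset_eq_length[OF Cons.prems(2)] js by simp
  have *: "P (us @ x # vs) = P (x # us @ vs)" if "length us + length vs = length is'" for us vs
    using that
  proof (induction us arbitrary: vs rule: rev_induct)
    case (snoc a us)
    then show ?case
      using Cons.prems(1)[of us vs a x] Cons.prems(3) snoc.IH[of "a # vs"] by simp
  qed simp
  have "P (x # is') = P (x # us @ vs)"
  proof (rule Cons.IH[where P = "\<lambda>l. P (x # l)" and k = "length is'"])
    show "mset is' = mset (us @ vs)" using Cons.prems(2) js by simp
    show "P (x # xs @ a # b # ys) = P (x # xs @ b # a # ys)"
      if "length xs + length ys + 2 = length is'" for xs a b ys
      using Cons.prems(1)[of "x # xs" ys a b] Cons.prems(3) that by simp
  qed simp
  then show ?case using * len js by simp
qed simp

lemma alternating_map_abs_mset: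
  assumes "alternating k F" "mset is = mset js" "length is = k"
  shows "\<bar>F (map e (is :: 'b list))\<bar> = \<bar>F (map e js)\<bar>"
proof (rule swap_invariant_mset[OF _ assms(2,3)])
  fix xs ys :: "'b list" and x y assume "length xs + length ys + 2 = k"
  then show "\<bar>F (map e (xs @ x # y # ys))\<bar> = \<bar>F (map e (xs @ y # x # ys))\<bar>"
    using alternatingD[OF assms(1), of "map e xs" "map e ys" "e x" "e y"] by simp
qed

text \<open>Up to sign the two equal entries can be moved to the front, where exchanging them shows
  that the value is its own negative.\<close>

lemma alternating_repeat:
  assumes "alternating k F" "\<not> distinct is" "length is = k" shows "F (map e is) = 0"
proof -
  obtain xs ys zs x where "is": "is = xs @ [x] @ ys @ [x] @ zs"
    using assms(2) not_distinct_decomp by blast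
  let ?js = "[] @ x # x # xs @ ys @ zs"
  have "\<bar>F (map e is)\<bar> = \<bar>F (map e ?js)\<bar>"
    by (rule alternating_map_abs_mset[OF assms(1) _ assms(3)]) (simp add: "is")
  moreover have "F (map e ?js) = - F (map e ?js)"
    using alternatingD[OF assms(1), of "[]" "map e (xs @ ys @ zs)" "e x" "e x"] assms(3)
    by (simp add: "is")
  ultimately show ?thesis by simp
qed

text \<open>This makes identities between forms in dimension 7 a finite check: 35 triples or 35
  quadruples of indices remain.\<close>

lemma alternating_zero_if_sorted:
  fixes e :: "'i::linorder \<Rightarrow> 'a"
  assumes "alternating k F" "\<And>is. length is = k \<Longrightarrow> sorted_wrt (<) is \<Longrightarrow> F (map e is) = 0" "length is = k"
  shows "F (map e is) = 0"
proof (cases "distinct is")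
  case True
  have "\<bar>F (map e is)\<bar> = \<bar>F (map e (sort is))\<bar>"
    by (rule alternating_map_abs_mset[OF assms(1) _ assms(3)]) simp
  also have "\<dots> = 0" using assms(2)[of "sort is"] assms(3) True by (simp add: strict_sorted_iff)
  finally show ?thesis by simp
qed (use assms alternating_repeat in blast)

text \<open>\<open>orthonormal_basis\<close> only prescribes inner products. That the vectors span
  follows because they are indexed by the coordinate type itself: the map from coefficients to
  vectors is injective, hence surjective.\<close>

lemma orthonormal_expansion:
  assumes "orthonormal_basis g e" "multilinear 2 g"
  shows "x = (\<Sum>i\<in>UNIV. g [x, e i] *\<^sub>R e i)"
proof -
  let ?L = "\<lambda>c::real^'a. \<Sum>i\<in>UNIV. c $ i *\<^sub>R e i"
  have c: "g [?L c, e j] = c $ j" for c j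
    using assms(1) by (simp add: linear_sum[OF multilinear_2(1)[OF assms(2)]]
      linear_scale[OF multilinear_2(1)[OF assms(2)]] orthonormal_basis_def if_distrib[of "\<lambda>x. _ * x"] cong: if_cong)
  have "linear ?L" by (intro linearI) (simp_all add: algebra_simps sum.distrib scaleR_sum_right)
  moreover have "inj ?L" by (rule injI) (metis c vec_eq_iff)
  ultimately have "surj ?L" by (rule linear_inj_imp_surj)
  then obtain c0 where c0: "x = ?L c0" by (rule surjE)
  show ?thesis unfolding c0 c ..
qed

lemma sum_lists_0: "(\<Sum>is | length is = 0. f is) = f []"
  by simp

lemma sum_lists_Suc:
  "(\<Sum>is | length (is::'i::finite list) = Suc k. f is) = (\<Sum>i\<in>UNIV. \<Sum>is | length is = k. f (i # is))"
proof -
  have fin: "finite {is::'i list. length is = k}"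
    using finite_lists_length_eq[OF finite, of UNIV k] by simp
  have "{is::'i list. length is = Suc k} = (\<lambda>(i, is). i # is) ` (UNIV \<times> {is. length is = k})"
    by (auto simp: length_Suc_conv image_iff)
  then have "(\<Sum>is | length (is::'i list) = Suc k. f is) = (\<Sum>(i, is)\<in>UNIV \<times> {is. length is = k}. f (i # is))"
    by (simp add: sum.reindex inj_on_def case_prod_unfold)
  then show ?thesis using fin by (simp add: sum.cartesian_product)
qed

lemma sum_lists:
  "(\<Sum>is | length (is::'i::finite list) = 1. f is) = (\<Sum>i\<in>UNIV. f [i])"
  "(\<Sum>is | length (is::'i::finite list) = 2. f is) = (\<Sum>i\<in>UNIV. \<Sum>j\<in>UNIV. f [i, j])"
  "(\<Sum>is | length (is::'i::finite list) = 3. f is) = (\<Sum>i\<in>UNIV. \<Sum>j\<in>UNIV. \<Sum>k\<in>UNIV. f [i, j, k])"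
  "(\<Sum>is | length (is::'i::finite list) = 4. f is) =
     (\<Sum>i\<in>UNIV. \<Sum>j\<in>UNIV. \<Sum>k\<in>UNIV. \<Sum>l\<in>UNIV. f [i, j, k, l])"
  by (simp_all add: eval_nat_numeral sum_lists_Suc del: length_Suc_conv length_0_conv)
     (simp_all add: sum_lists_0 del: length_0_conv)

lemma sum_lists_append:
  "(\<Sum>is | length (is::'i::finite list) = k + l. f is) =
     (\<Sum>is | length is = k. \<Sum>js | length js = l. f (is @ js))"
  by (induction k arbitrary: f) (simp_all add: sum_lists_Suc)

lemma multilinear_extensionality:
  assumes "orthonormal_basis g e" "multilinear 2 g" "multilinear k F"
    and "\<And>is. length is = k \<Longrightarrow> F (map e is) = 0" and "length xs = k"
  shows "F xs = 0"
  using assms(3-5)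
proof (induction k arbitrary: F xs)
  case 0
  then show ?case using "0.prems"(2)[of "[]"] by simp
next
  case (Suc k)
  obtain y ys where xs: "xs = y # ys" "length ys = k"
    using Suc.prems(3) by (auto simp: length_Suc_conv)
  have "F (e i # ys) = 0" for i
    by (rule Suc.IH[OF multilinear_Cons[OF Suc.prems(1)] _ xs(2)])
       (use Suc.prems(2)[of "i # _"] in simp)
  moreover have "F (y # ys) = (\<Sum>i\<in>UNIV. g [y, e i] * F (e i # ys))"
    using multilinear_update_sum[OF Suc.prems(1), of "y # ys" 0 UNIV "\<lambda>i. g [y, e i]" e]
      orthonormal_expansion[OF assms(1,2), of y] xs(2) by simp
  ultimately show ?case using xs by simp
qed

text \<open>Basis independence of the trace of a bilinear form, by expanding one basis in the other.
  It replaces the arbitrary basis \<open>onb g\<close> of the definitions by a convenient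
  one.\<close>

lemma orthonormal_sum_invariant:
  fixes b :: "real^'n::finite \<Rightarrow> real^'n \<Rightarrow> real"
  assumes "orthonormal_basis g e" "orthonormal_basis g e'" "multilinear 2 g"
    and sym: "\<And>x y. g [x, y] = g [y, x]"
    and b: "\<And>y. linear (\<lambda>x. b x y)" "\<And>x. linear (b x)"
  shows "(\<Sum>i\<in>UNIV. b (e i) (e i)) = (\<Sum>i\<in>UNIV. b (e' i) (e' i))"
proof -
  have exp: "b x y = (\<Sum>j\<in>UNIV. \<Sum>k\<in>UNIV. g [x, e' j] * g [y, e' k] * b (e' j) (e' k))" for x y
  proof -
    have "b x y = b (\<Sum>j\<in>UNIV. g [x, e' j] *\<^sub>R e' j) (\<Sum>k\<in>UNIV. g [y, e' k] *\<^sub>R e' k)"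
      using orthonormal_expansion[OF assms(2,3)] by simp
    then show ?thesis
      by (simp add: linear_sum[OF b(1)] linear_sum[OF b(2)] linear_scale[OF b(1)] linear_scale[OF b(2)]
          sum_distrib_left mult.assoc)
         (subst sum.swap, simp add: mult.left_commute)
  qed
  have c: "(\<Sum>i\<in>UNIV. g [e i, x] * g [e i, y]) = g [x, y]" for x y
  proof -
    have "g [x, y] = g [\<Sum>i\<in>UNIV. g [x, e i] *\<^sub>R e i, y]"
      using orthonormal_expansion[OF assms(1,3), of x] by simp
    also have "\<dots> = (\<Sum>i\<in>UNIV. g [x, e i] * g [e i, y])"
      by (simp add: linear_sum[OF multilinear_2(1)[OF assms(3)]]
        linear_scale[OF multilinear_2(1)[OF assms(3)]])
    finally show ?thesis by (simp add: sym[of x])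
  qed
  have "(\<Sum>i\<in>UNIV. b (e i) (e i)) =
      (\<Sum>i\<in>UNIV. \<Sum>j\<in>UNIV. \<Sum>k\<in>UNIV. g [e i, e' j] * g [e i, e' k] * b (e' j) (e' k))"
    by (rule sum.cong[OF refl], rule exp)
  also have "\<dots> = (\<Sum>j\<in>UNIV. \<Sum>i\<in>UNIV. \<Sum>k\<in>UNIV. g [e i, e' j] * g [e i, e' k] * b (e' j) (e' k))"
    by (rule sum.swap)
  also have "\<dots> = (\<Sum>j\<in>UNIV. \<Sum>k\<in>UNIV. \<Sum>i\<in>UNIV. g [e i, e' j] * g [e i, e' k] * b (e' j) (e' k))"
    by (rule sum.cong[OF refl], rule sum.swap)
  also have "\<dots> = (\<Sum>j\<in>UNIV. \<Sum>k\<in>UNIV. g [e' j, e' k] * b (e' j) (e' k))"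
    by (simp add: sum_distrib_right[symmetric] c)
  also have "\<dots> = (\<Sum>j\<in>UNIV. b (e' j) (e' j))"
    using assms(2) by (simp add: orthonormal_basis_def if_distrib[of "\<lambda>x. x * _"] sum.delta cong: if_cong)
  finally show ?thesis .
qed

text \<open>The basis is changed one slot at a time: in the tail by induction, then in the first
  slot as a trace.\<close>

lemma orthonormal_sum_lists_invariant:
  fixes a b :: "'n::finite tensor"
  assumes "orthonormal_basis g e" "orthonormal_basis g e'" "multilinear 2 g"
    and "\<And>x y. g [x, y] = g [y, x]"
    and "multilinear k a" "multilinear k b"
  shows "(\<Sum>is | length is = k. a (map e is) * b (map e is)) =
    (\<Sum>is | length is = k. a (map e' is) * b (map e' is))"
  using assms(5,6)
proof (induction k arbitrary: a b)
  case (Suc k)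
  have "(\<Sum>is | length is = Suc k. a (map e is) * b (map e is)) =
      (\<Sum>i\<in>UNIV. \<Sum>is | length is = k. a (e i # map e' is) * b (e i # map e' is))"
    unfolding sum_lists_Suc list.map
    by (rule sum.cong[OF refl], rule Suc.IH) (rule multilinear_Cons, rule Suc.prems)+
  also have "\<dots> = (\<Sum>is | length is = k. \<Sum>i\<in>UNIV. a (e i # map e' is) * b (e i # map e' is))"
    by (rule sum.swap)
  also have "\<dots> = (\<Sum>is | length is = k. \<Sum>i\<in>UNIV. a (e' i # map e' is) * b (e' i # map e' is))"
  proof (rule sum.cong[OF refl])
    fix "is" :: "'n list" assume "is \<in> {is. length is = k}"
    then have lin: "linear (\<lambda>v. a (v # map e' is))" "linear (\<lambda>v. b (v # map e' is))"
      using Suc.prems by (auto intro: multilinear_linear_Cons)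
    have "linear (\<lambda>x. a (x # map e' is) * b (y # map e' is))" for y
      by (intro linearI) (simp_all add: linear_add[OF lin(1)] linear_scale[OF lin(1)] algebra_simps)
    moreover have "linear (\<lambda>y. a (x # map e' is) * b (y # map e' is))" for x
      by (intro linearI) (simp_all add: linear_add[OF lin(2)] linear_scale[OF lin(2)] algebra_simps)
    ultimately show "(\<Sum>i\<in>UNIV. a (e i # map e' is) * b (e i # map e' is)) =
        (\<Sum>i\<in>UNIV. a (e' i # map e' is) * b (e' i # map e' is))"
      by (rule orthonormal_sum_invariant[OF assms(1-4)])
  qed
  also have "\<dots> = (\<Sum>is | length is = Suc k. a (map e' is) * b (map e' is))"
    unfolding sum_lists_Suc list.map by (rule sum.swap)
  finally show ?case .
qed simp

lemma orthonormal_onb: "orthonormal_basis g e \<Longrightarrow> orthonormal_basis g (onb g)"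
  unfolding onb_def by (rule someI[of "orthonormal_basis g"])

text \<open>The parity of the number of inversions, that is, the sign of the permutation sorting a
  list without repetitions. The recursion lets the simplifier evaluate it on explicit lists.\<close>

primrec list_sign :: "'a::linorder list \<Rightarrow> real" where
  "list_sign [] = 1"
| "list_sign (x # xs) = (-1) ^ length (filter (\<lambda>y. y < x) xs) * list_sign xs"

lemma alternating_Cons:
  assumes "alternating (Suc k) F" shows "alternating k (\<lambda>xs::'a list. F (x # xs))"
  unfolding alternating_def
proof (intro allI impI)
  fix xs ys :: "'a list" and y z assume "length xs + length ys + 2 = k"
  then show "F (x # xs @ y # z # ys) = - F (x # xs @ z # y # ys)"
    using alternatingD[OF assms, of "x # xs" ys y z] by simp
qed

lemma alternating_append:
  assumes "alternating (k + length ys) F" shows "alternating k (\<lambda>xs::'a list. F (xs @ ys))"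
  unfolding alternating_def
proof (intro allI impI)
  fix us vs :: "'a list" and x y assume "length us + length vs + 2 = k"
  then show "F ((us @ x # y # vs) @ ys) = - F ((us @ y # x # vs) @ ys)"
    using alternatingD[OF assms, of us "vs @ ys" x y] by simp
qed

lemma alternating_append_left:
  assumes "alternating (length xs + k) F" shows "alternating k (\<lambda>ys. F (xs @ ys))"
  using assms by (induction xs arbitrary: F) (auto dest: alternating_Cons)

lemma alternating_add:
  "alternating k F \<Longrightarrow> alternating k G \<Longrightarrow> alternating k (\<lambda>xs. F xs + G xs)"
  unfolding alternating_def by (metis minus_add_distrib)

lemma alternating_scale: "alternating k F \<Longrightarrow> alternating k (\<lambda>xs. c * F xs)"
  unfolding alternating_def by (metis mult_minus_right)

lemma alternating_diff:
  "alternating k F \<Longrightarrow> alternating k G \<Longrightarrow> alternating k (\<lambda>xs. F xs - G xs)"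
  using alternating_add[of k F "\<lambda>xs. (-1) * G xs"] alternating_scale[of k G "-1"] by simp

lemma alternating_sum:
  assumes "\<And>i. i \<in> S \<Longrightarrow> alternating k (F i)" shows "alternating k (\<lambda>xs::'a list. \<Sum>i\<in>S. F i xs)"
  unfolding alternating_def
proof (intro allI impI)
  fix xs ys :: "'a list" and x y assume "length xs + length ys + 2 = k"
  then show "(\<Sum>i\<in>S. F i (xs @ x # y # ys)) = - (\<Sum>i\<in>S. F i (xs @ y # x # ys))"
    unfolding sum_negf[symmetric] by (intro sum.cong[OF refl] alternatingD[OF assms])
qed

text \<open>On its way to its sorted position \<open>x\<close> passes exactly the smaller entries,
  each at the cost of a sign.\<close>

lemma alternating_insort:
  assumes "alternating k F" "length is + 1 = k" "sorted is"
  shows "F (map e (x # is)) = (-1) ^ length (filter (\<lambda>y. y < x) is) * F (map e (insort x is))"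
  using assms
proof (induction "is" arbitrary: k F)
  case (Cons y ys)
  show ?case
  proof (cases "x \<le> y")
    case True
    then have "filter (\<lambda>z. z < x) (y # ys) = []"
      using Cons.prems(3) by (auto simp: filter_empty_conv)
    then show ?thesis using True by simp
  next
    case False
    obtain k' where k: "k = Suc k'" using Cons.prems(2) by auto
    have "F (map e (x # y # ys)) = - F (map e (y # x # ys))"
      using alternatingD[OF Cons.prems(1), of "[]" "map e ys" "e x" "e y"] Cons.prems(2) by simp
    also have "F (map e (y # x # ys)) =
        (-1) ^ length (filter (\<lambda>z. z < x) ys) * F (e y # map e (insort x ys))"
      using Cons.IH[of k' "\<lambda>l. F (e y # l)"] alternating_Cons[of k' F "e y"] Cons.prems k by simp
    finally show ?thesis using False by simp
  qed
qed simp

lemma alternating_sort: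
  assumes "alternating k F" "length is = k"
  shows "F (map e is) = list_sign is * F (map e (sort is))"
  using assms
proof (induction "is" arbitrary: k F)
  case (Cons x xs)
  then obtain k' where k: "k = Suc k'" by (cases k) auto
  have "mset (filter (\<lambda>y. y < x) (sort xs)) = mset (filter (\<lambda>y. y < x) xs)"
    by (simp add: mset_filter)
  then have len: "length (filter (\<lambda>y. y < x) (sort xs)) = length (filter (\<lambda>y. y < x) xs)"
    by (rule mset_eq_length)
  have "F (map e (x # xs)) = list_sign xs * F (map e (x # sort xs))"
    using Cons.IH[of k' "\<lambda>l. F (e x # l)"] alternating_Cons[of k' F "e x"] Cons.prems k by simp
  also have "F (map e (x # sort xs)) = (-1) ^ length (filter (\<lambda>y. y < x) xs) * F (map e (insort x (sort xs)))"
    using alternating_insort[OF Cons.prems(1), of "sort xs" e x] Cons.prems(2) len by simp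
  finally show ?case by simp
qed simp

text \<open>The two signs cancel in the product, so all k! orderings of \<open>cs\<close> contribute
  equally, and all other lists contribute nothing. The resulting k! cancels the factorial in the
  Hodge dual.\<close>

lemma sum_alternating_product:
  fixes cs :: "'n::finite list"
  assumes "alternating k a" "alternating k b" "distinct cs" "length cs = k"
    and "\<And>js. length js = k \<Longrightarrow> distinct js \<Longrightarrow> set js \<noteq> set cs \<Longrightarrow> b (map e js) = 0"
  shows "(\<Sum>js | length js = k. a (map e js) * b (map e js)) = fact k * (a (map e cs) * b (map e cs))"
proof -
  let ?S = "{js. length js = k \<and> distinct js \<and> set js \<subseteq> set cs}"
  have eq: "set js = set cs" if "js \<in> ?S" for js
    using that assms(3,4) distinct_card[of js] distinct_card[of cs] card_subset_eq[of "set cs" "set js"] by auto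
  have "(\<Sum>js | length js = k. a (map e js) * b (map e js)) = (\<Sum>js\<in>?S. a (map e js) * b (map e js))"
  proof (rule sum.mono_neutral_right)
    show "finite {js::'n list. length js = k}"
      using finite_lists_length_eq[OF finite, of UNIV k] by simp
    show "\<forall>js\<in>{js. length js = k} - ?S. a (map e js) * b (map e js) = 0"
      using assms(5) alternating_repeat[OF assms(2)] by auto
  qed auto
  also have "\<dots> = (\<Sum>js\<in>?S. a (map e cs) * b (map e cs))"
  proof (rule sum.cong[OF refl])
    fix js assume js: "js \<in> ?S"
    then have "mset js = mset cs" using eq[OF js] assms(3) set_eq_iff_mset_eq_distinct by blast
    then show "a (map e js) * b (map e js) = a (map e cs) * b (map e cs)"
    proof (rule swap_invariant_mset[where k = k, rotated])
      fix xs ys :: "'n list" and x y assume "length xs + length ys + 2 = k"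
      then show "a (map e (xs @ x # y # ys)) * b (map e (xs @ x # y # ys)) =
          a (map e (xs @ y # x # ys)) * b (map e (xs @ y # x # ys))"
        using alternatingD[OF assms(1), of "map e xs" "map e ys" "e x" "e y"]
          alternatingD[OF assms(2), of "map e xs" "map e ys" "e x" "e y"] by simp
    qed (use js in auto)
  qed
  also have "\<dots> = card ?S * (a (map e cs) * b (map e cs))" by simp
  also have "card ?S = fact k"
    using card_lists_distinct_length_eq[of "set cs" k] assms(3,4) distinct_card[of cs]
    by (simp add: fact_prod)
  finally show ?thesis by simp
qed

text \<open>The sum over permutations is reindexed by composition with \<tau>; the sign can be moved
  to the other side since it squares to 1.\<close>

lemma wedge1_permute:
  assumes "\<tau> permutes {..<length \<alpha>s}"
  shows "wedge1 \<alpha>s (map (\<lambda>i. xs ! \<tau> i) [0..<length \<alpha>s]) = of_int (sign \<tau>) * wedge1 \<alpha>s xs"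
proof -
  let ?n = "length \<alpha>s"
  have perm: "permutation \<sigma>" if "\<sigma> permutes {..<?n}" for \<sigma>
    using that permutation_permutes by blast
  have "wedge1 \<alpha>s xs = (\<Sum>\<sigma> | \<sigma> permutes {..<?n}. of_int (sign (\<tau> \<circ> \<sigma>)) * (\<Prod>i<?n. (\<alpha>s ! i) (xs ! (\<tau> \<circ> \<sigma>) i)))"
    unfolding wedge1_def by (rule setum_permutations_compose_left[OF assms])
  also have "\<dots> = (\<Sum>\<sigma> | \<sigma> permutes {..<?n}. of_int (sign \<tau>) * (of_int (sign \<sigma>) * (\<Prod>i<?n. (\<alpha>s ! i) (xs ! \<tau> (\<sigma> i)))))"
    by (rule sum.cong) (auto simp: sign_compose perm assms)
  also have "\<dots> = of_int (sign \<tau>) * wedge1 \<alpha>s (map (\<lambda>i. xs ! \<tau> i) [0..<?n])"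
    unfolding wedge1_def sum_distrib_left[symmetric]
  proof (intro arg_cong2[where f = "(*)"] sum.cong refl prod.cong)
    fix \<sigma> i assume "\<sigma> \<in> {\<sigma>. \<sigma> permutes {..<?n}}" "i \<in> {..<?n}"
    then have "\<sigma> i < ?n" by (metis lessThan_iff mem_Collect_eq permutes_in_image)
    then show "(\<alpha>s ! i) (xs ! \<tau> (\<sigma> i)) = (\<alpha>s ! i) (map (\<lambda>i. xs ! \<tau> i) [0..<?n] ! \<sigma> i)" by simp
  qed
  finally show ?thesis by (simp add: mult.assoc[symmetric] of_int_mult[symmetric] sign_idempotent del: of_int_mult)
qed

lemma wedge1_alternating: "alternating (length \<alpha>s) (wedge1 \<alpha>s)"
  unfolding alternating_def
proof (intro allI impI)
  fix xs ys :: "(real^'a) list" and x y assume len: "length xs + length ys + 2 = length \<alpha>s"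
  let ?i = "length xs" and ?l = "xs @ x # y # ys"
  have p: "Transposition.transpose ?i (Suc ?i) permutes {..<length \<alpha>s}"
    using len by (intro permutes_swap_id) auto
  have "map (\<lambda>i. ?l ! Transposition.transpose ?i (Suc ?i) i) [0..<length \<alpha>s] = xs @ y # x # ys"
    using len by (intro nth_equalityI)
      (auto simp: nth_append Transposition.transpose_def nth_Cons split: nat.splits)
  with wedge1_permute[OF p, of ?l] show "wedge1 \<alpha>s ?l = - wedge1 \<alpha>s (xs @ y # x # ys)"
    by (simp add: sign_swap_id)
qed

lemma linear_times:
  fixes f :: "'a::real_vector \<Rightarrow> real"
  assumes "linear f" shows "linear (\<lambda>x. c * f x)"
  using assms by (intro linearI) (simp_all add: linear_add linear_scale algebra_simps)

lemma wedge1_multilinear: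
  assumes "\<And>i. i < length \<alpha>s \<Longrightarrow> linear (\<alpha>s ! i)"
  shows "multilinear (length \<alpha>s) (wedge1 \<alpha>s)"
  unfolding multilinear_def
proof (intro allI impI)
  let ?n = "length \<alpha>s"
  fix xs :: "(real^'a) list" and j assume len: "length xs = ?n" "j < ?n"
  have "linear (\<lambda>v. \<Prod>i<?n. (\<alpha>s ! i) (xs[j := v] ! \<sigma> i))" if s: "\<sigma> permutes {..<?n}" for \<sigma>
  proof -
    \<comment> \<open>The argument in slot \<open>j\<close> occurs in exactly one factor of the
      product, the one with this index.\<close>
    let ?m = "inv \<sigma> j"
    have m: "\<sigma> ?m = j" using permutes_inverses[OF s] by simp
    moreover have m': "?m < ?n" using permutes_in_image[OF s, of ?m] m len(2) by simp
    have *: "(\<Prod>i<?n. (\<alpha>s ! i) (xs[j := v] ! \<sigma> i)) = (\<alpha>s ! ?m) v * (\<Prod>i\<in>{..<?n} - {?m}. (\<alpha>s ! i) (xs ! \<sigma> i))" for v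
    proof -
      have "(\<Prod>i<?n. (\<alpha>s ! i) (xs[j := v] ! \<sigma> i)) =
          (\<alpha>s ! ?m) (xs[j := v] ! \<sigma> ?m) * (\<Prod>i\<in>{..<?n} - {?m}. (\<alpha>s ! i) (xs[j := v] ! \<sigma> i))"
        using m' by (intro prod.remove) auto
      also have "(\<Prod>i\<in>{..<?n} - {?m}. (\<alpha>s ! i) (xs[j := v] ! \<sigma> i)) = (\<Prod>i\<in>{..<?n} - {?m}. (\<alpha>s ! i) (xs ! \<sigma> i))"
      proof (rule prod.cong[OF refl])
        fix i assume "i \<in> {..<?n} - {?m}"
        then have "\<sigma> i \<noteq> j" using permutes_inverses[OF s] by auto
        then show "(\<alpha>s ! i) (xs[j := v] ! \<sigma> i) = (\<alpha>s ! i) (xs ! \<sigma> i)" by simp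
      qed
      finally show ?thesis using m m' len by simp
    qed
    show ?thesis unfolding *
      using assms[OF m'] by (intro linearI) (simp_all add: linear_add linear_scale algebra_simps)
  qed
  then show "linear (\<lambda>v. wedge1 \<alpha>s (xs[j := v]))"
    unfolding wedge1_def by (intro linear_compose_sum ballI linear_times) auto
qed

lemma wedge1_3:
  "wedge1 [\<alpha>, \<beta>, \<gamma>] [x, y, z] = \<alpha> x * \<beta> y * \<gamma> z - \<alpha> x * \<beta> z * \<gamma> y - \<alpha> y * \<beta> x * \<gamma> z
     + \<alpha> y * \<beta> z * \<gamma> x + \<alpha> z * \<beta> x * \<gamma> y - \<alpha> z * \<beta> y * \<gamma> x"
proof -
  have s: "{..<3::nat} = {0, 1, 2}" by auto
  have f012: "finite {1::nat, 2}" "0 \<notin> {1::nat, 2}" and f12: "finite {2::nat}" "1 \<notin> {2::nat}" by auto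
  have l: "length [\<alpha>, \<beta>, \<gamma>] = 3" by simp
  show ?thesis
    unfolding wedge1_def l s sum_over_permutations_insert[OF f012] sum_over_permutations_insert[OF f12]
    unfolding permutes_sing
    by (simp add: sign_swap_id permutation_swap_id sign_compose sign_id Transposition.transpose_def)
qed


section \<open>Cayley frames\<close>

lemma sum_UNIV_7: "(\<Sum>i\<in>UNIV. f (i::7)) = f 0 + f 1 + f 2 + f 3 + f 4 + f 5 + f 6"
  unfolding UNIV_7 by (simp add: add.assoc)

lemma diff_numeral_7:
  "(1::7) - 1 = 0" "(1::7) - 2 = 6" "(1::7) - 3 = 5" "(1::7) - 4 = 4" "(1::7) - 5 = 3" "(1::7) - 6 = 2"
    "(2::7) - 1 = 1" "(2::7) - 2 = 0" "(2::7) - 3 = 6" "(2::7) - 4 = 5" "(2::7) - 5 = 4" "(2::7) - 6 = 3"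
    "(3::7) - 1 = 2" "(3::7) - 2 = 1" "(3::7) - 3 = 0" "(3::7) - 4 = 6" "(3::7) - 5 = 5" "(3::7) - 6 = 4"
    "(4::7) - 1 = 3" "(4::7) - 2 = 2" "(4::7) - 3 = 1" "(4::7) - 4 = 0" "(4::7) - 5 = 6" "(4::7) - 6 = 5"
    "(5::7) - 1 = 4" "(5::7) - 2 = 3" "(5::7) - 3 = 2" "(5::7) - 4 = 1" "(5::7) - 5 = 0" "(5::7) - 6 = 6"
    "(6::7) - 1 = 5" "(6::7) - 2 = 4" "(6::7) - 3 = 3" "(6::7) - 4 = 2" "(6::7) - 5 = 1" "(6::7) - 6 = 0"
    "- (1::7) = 6" "- (2::7) = 5" "- (3::7) = 4" "- (4::7) = 3" "- (5::7) = 2" "- (6::7) = 1"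
  by simp_all

lemma neq_numeral_7:
  "(0::7) \<noteq> 1" "(0::7) \<noteq> 2" "(0::7) \<noteq> 3" "(0::7) \<noteq> 4" "(0::7) \<noteq> 5"
    "(0::7) \<noteq> 6" "(1::7) \<noteq> 0" "(1::7) \<noteq> 2" "(1::7) \<noteq> 3" "(1::7) \<noteq> 4"
    "(1::7) \<noteq> 5" "(1::7) \<noteq> 6" "(2::7) \<noteq> 0" "(2::7) \<noteq> 1" "(2::7) \<noteq> 3"
    "(2::7) \<noteq> 4" "(2::7) \<noteq> 5" "(2::7) \<noteq> 6" "(3::7) \<noteq> 0" "(3::7) \<noteq> 1"
    "(3::7) \<noteq> 2" "(3::7) \<noteq> 4" "(3::7) \<noteq> 5" "(3::7) \<noteq> 6" "(4::7) \<noteq> 0"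
    "(4::7) \<noteq> 1" "(4::7) \<noteq> 2" "(4::7) \<noteq> 3" "(4::7) \<noteq> 5" "(4::7) \<noteq> 6"
    "(5::7) \<noteq> 0" "(5::7) \<noteq> 1" "(5::7) \<noteq> 2" "(5::7) \<noteq> 3" "(5::7) \<noteq> 4"
    "(5::7) \<noteq> 6" "(6::7) \<noteq> 0" "(6::7) \<noteq> 1" "(6::7) \<noteq> 2" "(6::7) \<noteq> 3"
    "(6::7) \<noteq> 4" "(6::7) \<noteq> 5"
  by simp_all

lemma numeral_7_mod: "(7::7) = 0" "(8::7) = 1" "(9::7) = 2" "(10::7) = 3" "(11::7) = 4" "(12::7) = 5"
  by simp_all

lemma UNIV_6: "(UNIV :: 6 set) = {0, 1, 2, 3, 4, 5}"
  using exhaust_6 by auto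

lemma sum_UNIV_6: "(\<Sum>i\<in>UNIV. f (i::6)) = f 0 + f 1 + f 2 + f 3 + f 4 + f 5"
  unfolding UNIV_6 by (simp add: add.assoc)

text \<open>Components of \<open>\<phi>\<close> and \<open>*\<phi>\<close> in a Cayley frame. They are invariant under translations of
  \<open>\<int>/7\<close>, so they only depend on the differences of the indices.\<close>

definition phi0 :: "7 \<Rightarrow> 7 \<Rightarrow> 7 \<Rightarrow> real" where
  "phi0 i j k = (let a = j - i; b = k - i in
     if a = 1 then (if b = 3 then 1 else 0) else
     if a = 2 then (if b = 6 then 1 else 0) else
     if a = 3 then (if b = 1 then - 1 else 0) else
     if a = 4 then (if b = 5 then 1 else 0) else
     if a = 5 then (if b = 4 then - 1 else 0) else
     if a = 6 then (if b = 2 then - 1 else 0) else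
     0)"

definition star0 :: "7 \<Rightarrow> 7 \<Rightarrow> 7 \<Rightarrow> 7 \<Rightarrow> real" where
  "star0 i j k l = (let a = j - i; b = k - i; c = l - i in
     if a = 1 then
       if b = 2 then (if c = 5 then 1 else 0) else if b = 4 then (if c = 6 then - 1 else 0) else if b = 5 then (if c = 2 then - 1 else 0) else if b = 6 then (if c = 4 then 1 else 0) else 0
     else
     if a = 2 then
       if b = 1 then (if c = 5 then - 1 else 0) else if b = 3 then (if c = 4 then - 1 else 0) else if b = 4 then (if c = 3 then 1 else 0) else if b = 5 then (if c = 1 then 1 else 0) else 0
     else
     if a = 3 then
       if b = 2 then (if c = 4 then 1 else 0) else if b = 4 then (if c = 2 then - 1 else 0) else if b = 5 then (if c = 6 then 1 else 0) else if b = 6 then (if c = 5 then - 1 else 0) else 0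
     else
     if a = 4 then
       if b = 1 then (if c = 6 then 1 else 0) else if b = 2 then (if c = 3 then - 1 else 0) else if b = 3 then (if c = 2 then 1 else 0) else if b = 6 then (if c = 1 then - 1 else 0) else 0
     else
     if a = 5 then
       if b = 1 then (if c = 2 then 1 else 0) else if b = 2 then (if c = 1 then - 1 else 0) else if b = 3 then (if c = 6 then - 1 else 0) else if b = 6 then (if c = 3 then 1 else 0) else 0
     else
     if a = 6 then
       if b = 1 then (if c = 4 then - 1 else 0) else if b = 3 then (if c = 5 then 1 else 0) else if b = 4 then (if c = 1 then 1 else 0) else if b = 5 then (if c = 3 then - 1 else 0) else 0
     else
     0)"

lemmas eval_phi0 = phi0_def Let_def diff_self diff_zero diff_0 minus_zero diff_numeral_7 neq_numeral_7
  if_True if_False simp_thms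

lemmas eval_star0 = star0_def eval_phi0

text \<open>A formula for \<open>*\<phi>\<close> without reference to the orientation.\<close>

definition star3 :: "7 tensor \<Rightarrow> 7 tensor \<Rightarrow> 7 tensor" where
  "star3 g \<phi> xs = g [xs ! 0, xs ! 2] * g [xs ! 1, xs ! 3] - g [xs ! 0, xs ! 3] * g [xs ! 1, xs ! 2]
     - (\<Sum>m\<in>UNIV. \<phi> [onb g m, xs ! 0, xs ! 1] * \<phi> [onb g m, xs ! 2, xs ! 3])"

text \<open>Coordinate form of \<open>\<langle>P(x, y), P(x, z)\<rangle> = \<langle>x, x\<rangle>\<langle>y, z\<rangle> - \<langle>x, y\<rangle>\<langle>x, z\<rangle>\<close>.\<close>

lemma cross_product_square_polynomial:
  fixes x0 x1 x2 x3 x4 x5 x6 y0 y1 y2 y3 y4 y5 y6 z0 z1 z2 z3 z4 z5 z6 :: real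
  shows "(x1 * y3 - x3 * y1 + (x4 * y5 - x5 * y4) + (x2 * y6 - x6 * y2))
       * (x1 * z3 - x3 * z1 + (x4 * z5 - x5 * z4) + (x2 * z6 - x6 * z2))
     + (x2 * y4 - x4 * y2 + (x5 * y6 - x6 * y5) + (x3 * y0 - x0 * y3))
       * (x2 * z4 - x4 * z2 + (x5 * z6 - x6 * z5) + (x3 * z0 - x0 * z3))
     + (x3 * y5 - x5 * y3 + (x6 * y0 - x0 * y6) + (x4 * y1 - x1 * y4))
       * (x3 * z5 - x5 * z3 + (x6 * z0 - x0 * z6) + (x4 * z1 - x1 * z4))
     + (x4 * y6 - x6 * y4 + (x0 * y1 - x1 * y0) + (x5 * y2 - x2 * y5))
       * (x4 * z6 - x6 * z4 + (x0 * z1 - x1 * z0) + (x5 * z2 - x2 * z5))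
     + (x5 * y0 - x0 * y5 + (x1 * y2 - x2 * y1) + (x6 * y3 - x3 * y6))
       * (x5 * z0 - x0 * z5 + (x1 * z2 - x2 * z1) + (x6 * z3 - x3 * z6))
     + (x6 * y1 - x1 * y6 + (x2 * y3 - x3 * y2) + (x0 * y4 - x4 * y0))
       * (x6 * z1 - x1 * z6 + (x2 * z3 - x3 * z2) + (x0 * z4 - x4 * z0))
     + (x0 * y2 - x2 * y0 + (x3 * y4 - x4 * y3) + (x1 * y5 - x5 * y1))
       * (x0 * z2 - x2 * z0 + (x3 * z4 - x4 * z3) + (x1 * z5 - x5 * z1)) =
     (x0 * x0 + x1 * x1 + x2 * x2 + x3 * x3 + x4 * x4 + x5 * x5 + x6 * x6)
       * (y0 * z0 + y1 * z1 + y2 * z2 + y3 * z3 + y4 * z4 + y5 * z5 + y6 * z6)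
     - (x0 * y0 + x1 * y1 + x2 * y2 + x3 * y3 + x4 * y4 + x5 * y5 + x6 * y6)
       * (x0 * z0 + x1 * z1 + x2 * z2 + x3 * z3 + x4 * z4 + x5 * z5 + x6 * z6)"
  by algebra

lemma phi0_translate: "phi0 (i + a) (i + b) (i + c) = phi0 a b c"
proof -
  have "i + b - (i + a) = b - a" for a b :: 7 by simp
  then show ?thesis unfolding phi0_def by simp
qed

lemma sum_wedge1_frame:
  assumes "orthonormal_basis g e"
  shows "(\<Sum>l\<in>UNIV. wedge1 (map (\<lambda>j v. g [e j, v]) [l, l + 1, l + 3]) [e i, e j, e k]) = phi0 i j k"
proof -
  have g_frame: "g [e i, e j] = (if i = j then 1 else 0)" for i j
    using assms unfolding orthonormal_basis_def by blast
  define a b where "a = j - i" and "b = k - i"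
  then have jk: "j = i + a" "k = i + b" by simp_all
  let ?d = "\<lambda>m n::7. if m = n then 1 else 0 :: real"
  \<comment> \<open>Translating the summation index by \<open>i\<close> uses the cyclic symmetry of
    \<phi>, so that only the two index differences have to be split into cases.\<close>
  have "(\<Sum>l\<in>UNIV. wedge1 (map (\<lambda>j v. g [e j, v]) [l, l + 1, l + 3]) [e i, e j, e k]) =
      (\<Sum>l\<in>UNIV. wedge1 (map (\<lambda>j v. g [e j, v]) [i + l, i + l + 1, i + l + 3]) [e i, e j, e k])"
    by (rule sum.reindex_bij_witness[of _ "\<lambda>l. i + l" "\<lambda>l. l - i"]) auto
  also have "\<dots> = (\<Sum>l\<in>UNIV. ?d l 0 * ?d (l + 1) a * ?d (l + 3) b - ?d l 0 * ?d (l + 1) b * ?d (l + 3) a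
     - ?d l a * ?d (l + 1) 0 * ?d (l + 3) b + ?d l a * ?d (l + 1) b * ?d (l + 3) 0
     + ?d l b * ?d (l + 1) 0 * ?d (l + 3) a - ?d l b * ?d (l + 1) a * ?d (l + 3) 0)"
    by (rule sum.cong[OF refl]) (simp add: wedge1_3 g_frame jk add.assoc del: if_cancel)
  also have "\<dots> = phi0 0 a b"
    unfolding sum_UNIV_7
    using exhaust_7[of a] exhaust_7[of b] by (elim disjE; hypsubst; simp add: eval_phi0)
  also have "\<dots> = phi0 i j k" using phi0_translate[of i 0 a b] by (simp add: jk)
  finally show ?thesis .
qed

locale cayley =
  fixes g \<phi> :: "7 tensor" and e :: "7 \<Rightarrow> real^7"
  assumes g_multilinear: "multilinear 2 g" and g_sym: "\<And>x y. g [x, y] = g [y, x]"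
    and \<phi>_multilinear: "multilinear 3 \<phi>"
    and frame: "cayley_frame g \<phi> e"
begin

lemma orthonormal: "orthonormal_basis g e"
  using frame unfolding cayley_frame_def by blast

lemma g_frame: "g [e i, e j] = (if i = j then 1 else 0)"
  using orthonormal unfolding orthonormal_basis_def by blast

lemmas onb_orthonormal = orthonormal_onb[OF orthonormal]

lemmas lin_g = multilinear_2[OF g_multilinear]
lemmas lin_\<phi> = multilinear_3[OF \<phi>_multilinear]
lemmas g_simps = linear_add[OF lin_g(1)] linear_add[OF lin_g(2)] linear_scale[OF lin_g(1)] linear_scale[OF lin_g(2)]
  linear_neg[OF lin_g(1)] linear_neg[OF lin_g(2)] linear_diff[OF lin_g(1)] linear_diff[OF lin_g(2)]
  linear_sum[OF lin_g(1)] linear_sum[OF lin_g(2)]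
lemmas \<phi>_simps = linear_add[OF lin_\<phi>(1)] linear_add[OF lin_\<phi>(2)] linear_add[OF lin_\<phi>(3)]
  linear_scale[OF lin_\<phi>(1)] linear_scale[OF lin_\<phi>(2)] linear_scale[OF lin_\<phi>(3)]
  linear_neg[OF lin_\<phi>(1)] linear_neg[OF lin_\<phi>(2)] linear_neg[OF lin_\<phi>(3)]
  linear_diff[OF lin_\<phi>(1)] linear_diff[OF lin_\<phi>(2)] linear_diff[OF lin_\<phi>(3)]
  linear_sum[OF lin_\<phi>(1)] linear_sum[OF lin_\<phi>(2)] linear_sum[OF lin_\<phi>(3)]

lemma expansion: "x = (\<Sum>i\<in>UNIV. g [x, e i] *\<^sub>R e i)"
  by (rule orthonormal_expansion[OF orthonormal g_multilinear])

lemma g_parseval: "g [x, y] = (\<Sum>i\<in>UNIV. g [x, e i] * g [y, e i])"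
proof -
  have "g [x, y] = g [\<Sum>i\<in>UNIV. g [x, e i] *\<^sub>R e i, y]" using expansion[of x] by simp
  then show ?thesis by (simp add: g_simps g_sym[of y])
qed

lemma \<phi>_coordinates:
  "\<phi> [x, y, z] = (\<Sum>i\<in>UNIV. wedge1 (map (\<lambda>j v. g [e j, v]) [i, i + 1, i + 3]) [x, y, z])"
  using frame unfolding cayley_frame_def by blast

lemma \<phi>_frame: "\<phi> [e i, e j, e k] = phi0 i j k"
  unfolding \<phi>_coordinates by (rule sum_wedge1_frame[OF orthonormal])

lemma \<phi>_alt: "\<phi> [y, x, z] = - \<phi> [x, y, z]" "\<phi> [x, z, y] = - \<phi> [x, y, z]"
  unfolding \<phi>_coordinates sum_negf[symmetric] by (rule sum.cong; simp add: wedge1_3)+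

lemma \<phi>_cyclic: "\<phi> [y, z, x] = \<phi> [x, y, z]"
  using \<phi>_alt(1)[of x y z] \<phi>_alt(2)[of y x z] by simp

lemma \<phi>_repeat: "\<phi> [x, x, y] = 0" "\<phi> [x, y, x] = 0" "\<phi> [y, x, x] = 0"
  using \<phi>_alt(1)[of x x y] \<phi>_alt(2)[of y x x] \<phi>_alt(2)[of x x y] by simp_all

lemma \<phi>_alternating: "alternating 3 \<phi>"
  unfolding alternating_def
proof (intro allI impI)
  fix xs ys :: "(real^7) list" and x y assume "length xs + length ys + 2 = 3"
  then consider z where "xs = []" "ys = [z]" | z where "xs = [z]" "ys = []"
    by (cases xs; cases ys) auto
  then show "\<phi> (xs @ x # y # ys) = - \<phi> (xs @ y # x # ys)"
    by cases (simp_all add: \<phi>_alt(1)[of y x] \<phi>_alt(2)[of _ y x])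
qed

text \<open>The index triples {l, l + 1, l + 3} are the lines of a Fano plane. The three terms
  belong to the three lines through \<open>k\<close>.\<close>

lemma \<phi>_frame_3:
  "\<phi> [x, y, e k] = g [x, e (k + 1)] * g [y, e (k + 3)] - g [x, e (k + 3)] * g [y, e (k + 1)]
     + (g [x, e (k + 4)] * g [y, e (k + 5)] - g [x, e (k + 5)] * g [y, e (k + 4)])
     + (g [x, e (k + 2)] * g [y, e (k + 6)] - g [x, e (k + 6)] * g [y, e (k + 2)])"
proof -
  have *: "\<phi> [x, y, e k] = (\<Sum>i\<in>UNIV. \<Sum>j\<in>UNIV. g [x, e (k + i)] * (g [y, e (k + j)] * phi0 (k + i) (k + j) k))"
  proof -
    have "\<phi> [x, y, e k] = \<phi> [\<Sum>i\<in>UNIV. g [x, e i] *\<^sub>R e i, \<Sum>j\<in>UNIV. g [y, e j] *\<^sub>R e j, e k]"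
      using expansion[of x] expansion[of y] by simp
    also have "\<dots> = (\<Sum>i\<in>UNIV. \<Sum>j\<in>UNIV. g [x, e i] * (g [y, e j] * phi0 i j k))"
      by (simp add: \<phi>_simps \<phi>_frame sum_distrib_left mult.left_commute) (rule sum.swap)
    also have "\<dots> = (\<Sum>i\<in>UNIV. \<Sum>j\<in>UNIV. g [x, e (k + i)] * (g [y, e (k + j)] * phi0 (k + i) (k + j) k))"
    proof -
      have s: "(\<Sum>i\<in>UNIV. f i) = (\<Sum>i\<in>UNIV. f (k + i))" for f :: "7 \<Rightarrow> real"
        by (rule sum.reindex_bij_witness[of _ "\<lambda>i. k + i" "\<lambda>i. i - k"]) auto
      show ?thesis by (subst s, rule sum.cong[OF refl], rule s)
    qed
    finally show ?thesis .
  qed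
  have p: "phi0 (k + i) (k + j) k = phi0 i j 0" for i j using phi0_translate[of k i j 0] by simp
  show ?thesis unfolding * p sum_UNIV_7 by (simp add: eval_phi0)
qed

text \<open>The polarised norm identity of the cross product. The alternation of
  \<open>star3\<close>, the contraction identities and \<open>cross_cross\<close> all rest on
  it.\<close>

lemma \<phi>_square: "(\<Sum>k\<in>UNIV. \<phi> [x, y, e k] * \<phi> [x, z, e k]) = g [x, x] * g [y, z] - g [x, y] * g [x, z]"
  unfolding \<phi>_frame_3 sum_UNIV_7 g_parseval[of x x] g_parseval[of y z] g_parseval[of x y] g_parseval[of x z]
  by (simp add: cross_product_square_polynomial numeral_7_mod)

end


section \<open>The Hodge dual of \<open>\<phi>\<close>\<close>

lemma less_numeral_7:
  "(0::7) < 1" "(0::7) < 2" "(0::7) < 3" "(0::7) < 4" "(0::7) < 5" "(0::7) < 6" "\<not> (1::7) < 0"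
    "(1::7) < 2" "(1::7) < 3" "(1::7) < 4" "(1::7) < 5" "(1::7) < 6" "\<not> (2::7) < 0" "\<not> (2::7) < 1"
    "(2::7) < 3" "(2::7) < 4" "(2::7) < 5" "(2::7) < 6" "\<not> (3::7) < 0" "\<not> (3::7) < 1"
    "\<not> (3::7) < 2" "(3::7) < 4" "(3::7) < 5" "(3::7) < 6" "\<not> (4::7) < 0" "\<not> (4::7) < 1"
    "\<not> (4::7) < 2" "\<not> (4::7) < 3" "(4::7) < 5" "(4::7) < 6" "\<not> (5::7) < 0"
    "\<not> (5::7) < 1" "\<not> (5::7) < 2" "\<not> (5::7) < 3" "\<not> (5::7) < 4" "(5::7) < 6"
    "\<not> (6::7) < 0" "\<not> (6::7) < 1" "\<not> (6::7) < 2" "\<not> (6::7) < 3" "\<not> (6::7) < 4"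
    "\<not> (6::7) < 5"
  by (simp_all add: less_bit1_def bit1.Rep_numeral bit1.Rep_0 bit1.Rep_1)

lemma multilinear_3I:
  fixes F :: "'n::finite tensor"
  assumes "\<And>y z. linear (\<lambda>v. F [v, y, z])" "\<And>x z. linear (\<lambda>v. F [x, v, z])" "\<And>x y. linear (\<lambda>v. F [x, y, v])"
  shows "multilinear 3 F"
  unfolding multilinear_def
proof (intro allI impI)
  fix xs :: "(real^'n) list" and i :: nat assume "length xs = 3" "i < 3"
  then obtain x y z where "xs = [x, y, z]" "i = 0 \<or> i = 1 \<or> i = 2"
    by (auto simp: numeral_3_eq_3 length_Suc_conv less_Suc_eq)
  then show "linear (\<lambda>v. F (xs[i := v]))" using assms by auto
qed

lemma multilinear_4I:
  fixes F :: "'n::finite tensor"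
  assumes "\<And>y z w. linear (\<lambda>v. F [v, y, z, w])" "\<And>x z w. linear (\<lambda>v. F [x, v, z, w])"
    "\<And>x y w. linear (\<lambda>v. F [x, y, v, w])" "\<And>x y z. linear (\<lambda>v. F [x, y, z, v])"
  shows "multilinear 4 F"
  unfolding multilinear_def
proof (intro allI impI)
  fix xs :: "(real^'n) list" and i :: nat assume "length xs = 4" "i < 4"
  then obtain x y z w where "xs = [x, y, z, w]" "i = 0 \<or> i = 1 \<or> i = 2 \<or> i = 3"
    by (auto simp: eval_nat_numeral length_Suc_conv less_Suc_eq)
  then show "linear (\<lambda>v. F (xs[i := v]))" using assms by auto
qed

lemma alternating_3I:
  fixes F :: "'a list \<Rightarrow> real"
  assumes "\<And>x y z. F [y, x, z] = - F [x, y, z]" "\<And>x y z. F [x, z, y] = - F [x, y, z]"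
  shows "alternating 3 F"
  unfolding alternating_def
proof (intro allI impI)
  fix xs ys :: "'a list" and x y assume "length xs + length ys + 2 = 3"
  then consider z where "xs = []" "ys = [z]" | z where "xs = [z]" "ys = []"
    by (cases xs; cases ys) auto
  then show "F (xs @ x # y # ys) = - F (xs @ y # x # ys)"
    by cases (simp_all add: assms(1)[of y x] assms(2)[of _ x y])
qed

lemma alternating_4I:
  fixes F :: "'a list \<Rightarrow> real"
  assumes "\<And>x y z w. F [y, x, z, w] = - F [x, y, z, w]" "\<And>x y z w. F [x, z, y, w] = - F [x, y, z, w]"
    "\<And>x y z w. F [x, y, w, z] = - F [x, y, z, w]"
  shows "alternating 4 F"
  unfolding alternating_def
proof (intro allI impI)
  fix xs ys :: "'a list" and x y assume "length xs + length ys + 2 = 4"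
  then consider z w where "xs = []" "ys = [z, w]" | z w where "xs = [z]" "ys = [w]" | z w where "xs = [z, w]" "ys = []"
    by (cases xs; cases ys; cases "tl xs"; cases "tl ys") auto
  then show "F (xs @ x # y # ys) = - F (xs @ y # x # ys)"
    by cases (simp_all add: assms(1)[of y x] assms(2)[of _ y x] assms(3)[of _ _ x y])
qed

lemma alternating_4D:
  assumes "alternating 4 F"
  shows "F [y, x, z, w] = - F [x, y, z, w]" "F [x, z, y, w] = - F [x, y, z, w]" "F [x, y, w, z] = - F [x, y, z, w]"
  using alternatingD[OF assms, of "[]" "[z, w]" y x] alternatingD[OF assms, of "[x]" "[w]" z y]
    alternatingD[OF assms, of "[x, y]" "[]" w z] by simp_all

text \<open>Multilinearity reduces the comparison to frame vectors, alternation reduces it further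
  to increasing index lists.\<close>

lemma alternating_eq_sorted:
  fixes e :: "'n::{finite,linorder} \<Rightarrow> (real, 'n) vec"
  assumes "orthonormal_basis g e" "multilinear 2 g"
    and "alternating k F" "alternating k G" "multilinear k F" "multilinear k G" "length xs = k"
    and "\<And>is. length is = k \<Longrightarrow> sorted_wrt (<) is \<Longrightarrow> F (map e is) = G (map e is)"
  shows "F xs = G xs"
proof -
  have ml: "multilinear k (\<lambda>xs. F xs - G xs)"
    using assms(5,6) unfolding multilinear_def by (auto intro: linear_compose_sub)
  have "F (map e is) - G (map e is) = 0" if "length is = k" for "is"
    by (rule alternating_zero_if_sorted[OF alternating_diff[OF assms(3,4)] _ that]) (use assms(8) in simp)
  then have "F xs - G xs = 0" by (rule multilinear_extensionality[OF assms(1,2) ml _ assms(7)])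
  then show ?thesis by simp
qed

text \<open>Two points of the Fano plane lie on exactly one line, so at most one summand
  survives.\<close>

lemma sum_phi0: "(\<Sum>m\<in>UNIV. phi0 m 0 a * f m) = (if a = 1 then f 3 else if a = 2 then f 6 else
    if a = 3 then - f 1 else if a = 4 then f 5 else if a = 5 then - f 4 else if a = 6 then - f 2 else 0)"
  unfolding sum_UNIV_7 using exhaust_7[of a] by (elim disjE; hypsubst; simp add: eval_phi0)

context cayley
begin

lemma star_eq:
  "star3 g \<phi> [a, b, c, d] = g [a, c] * g [b, d] - g [a, d] * g [b, c]
     - (\<Sum>m\<in>UNIV. \<phi> [e m, a, b] * \<phi> [e m, c, d])"
proof -
  have "(\<Sum>m\<in>UNIV. \<phi> [onb g m, a, b] * \<phi> [onb g m, c, d]) = (\<Sum>m\<in>UNIV. \<phi> [e m, a, b] * \<phi> [e m, c, d])"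
    by (rule orthonormal_sum_invariant[OF onb_orthonormal orthonormal g_multilinear g_sym,
          where b = "\<lambda>x y. \<phi> [x, a, b] * \<phi> [y, c, d]"])
       (auto intro!: linearI simp: \<phi>_simps algebra_simps)
  then show ?thesis by (simp add: star3_def)
qed

lemma star_multilinear: "multilinear 4 (star3 g \<phi>)"
  by (rule multilinear_4I; rule linearI)
     (simp_all add: star_eq g_simps \<phi>_simps algebra_simps sum.distrib sum_distrib_left)

lemmas lin_star = multilinear_4[OF star_multilinear]
lemmas star_simps = linear_add[OF lin_star(1)] linear_add[OF lin_star(2)] linear_add[OF lin_star(3)] linear_add[OF lin_star(4)]
  linear_scale[OF lin_star(1)] linear_scale[OF lin_star(2)] linear_scale[OF lin_star(3)] linear_scale[OF lin_star(4)]
  linear_neg[OF lin_star(1)] linear_neg[OF lin_star(2)] linear_neg[OF lin_star(3)] linear_neg[OF lin_star(4)]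
  linear_sum[OF lin_star(1)] linear_sum[OF lin_star(2)] linear_sum[OF lin_star(3)] linear_sum[OF lin_star(4)]

lemma star_alternating: "alternating 4 (star3 g \<phi>)"
proof (rule alternating_4I)
  show "star3 g \<phi> [y, x, z, w] = - star3 g \<phi> [x, y, z, w]" for x y z w
    using \<phi>_alt(2)[of _ x y] by (simp add: star_eq sum_negf)
  show "star3 g \<phi> [x, y, w, z] = - star3 g \<phi> [x, y, z, w]" for x y z w
    using \<phi>_alt(2)[of _ z w] by (simp add: star_eq sum_negf)
  \<comment> \<open>Antisymmetry across the two middle slots is not visible in the formula. It is
    obtained by polarising this vanishing, which amounts to \<open>\<phi>_square\<close>.\<close>
  have rep: "star3 g \<phi> [x, y, y, w] = 0" for x y w
  proof -
    have "\<phi> [e m, x, y] * \<phi> [e m, y, w] = - (\<phi> [y, x, e m] * \<phi> [y, w, e m])" for m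
      using \<phi>_cyclic[of x y "e m"] \<phi>_cyclic[of y w "e m"] \<phi>_alt(1)[of y x "e m"]
      by simp
    then show ?thesis
      using \<phi>_square[of y x w] by (simp add: star_eq sum_negf g_sym)
  qed
  show "star3 g \<phi> [x, z, y, w] = - star3 g \<phi> [x, y, z, w]" for x y z w
    using rep[of x "y + z" w] rep[of x y w] rep[of x z w] by (simp add: star_simps)
qed

lemma star_frame: "star3 g \<phi> [e i, e j, e k, e l] = star0 i j k l"
proof -
  define a b c where "a = j - i" and "b = k - i" and "c = l - i"
  then have jkl: "j = i + a" "k = i + b" "l = i + c" by simp_all
  let ?d = "\<lambda>m n::7. if m = n then 1 else 0 :: real"
  have "(\<Sum>m\<in>UNIV. phi0 m i j * phi0 m k l) = (\<Sum>m\<in>UNIV. phi0 (i + m) i j * phi0 (i + m) k l)"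
    by (rule sum.reindex_bij_witness[of _ "\<lambda>l. i + l" "\<lambda>l. l - i"]) auto
  also have "\<dots> = (\<Sum>m\<in>UNIV. phi0 m 0 a * phi0 m b c)"
    using phi0_translate[of i _ 0] by (simp add: jkl phi0_translate)
  finally have "star3 g \<phi> [e i, e j, e k, e l] = ?d 0 b * ?d a c - ?d 0 c * ?d a b
      - (\<Sum>m\<in>UNIV. phi0 m 0 a * phi0 m b c)"
    by (simp add: star_eq g_frame \<phi>_frame jkl)
  also have "\<dots> = star0 0 a b c"
    unfolding sum_phi0
    using exhaust_7[of a] exhaust_7[of b] exhaust_7[of c]
    by (elim disjE; simp only: eval_star0; simp)
  finally show ?thesis by (simp add: jkl star0_def)
qed

section \<open>The volume form of a Cayley frame and the Hodge dual\<close>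

definition vol :: "7 tensor" where
  "vol = wedge1 (map (\<lambda>j v. g [e j, v]) [0, 1, 2, 3, 4, 5, 6])"

lemma vol_alternating: "alternating 7 vol"
  using wedge1_alternating[of "map (\<lambda>j v. g [e j, v]) [0, 1, 2, 3, 4, 5, 6]"] by (simp add: vol_def eval_nat_numeral)

lemma vol_multilinear: "multilinear 7 vol"
proof -
  let ?A = "map (\<lambda>j v. g [e j, v]) [0, 1, 2, 3, 4, 5, 6]"
  have "linear (?A ! i)" if "i < length ?A" for i
    using that by (simp only: nth_map length_map lin_g(2))
  then have "multilinear (length ?A) (wedge1 ?A)" by (rule wedge1_multilinear)
  then show ?thesis by (simp add: vol_def eval_nat_numeral)
qed

lemma vol_frame: "vol (map e [0, 1, 2, 3, 4, 5, 6]) = 1"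
proof -
  define L where "L = [0, 1, 2, 3, 4, 5, 6::7]"
  then have len: "length L = 7" and d: "distinct L" by simp_all
  \<comment> \<open>Any permutation other than the identity moves some index and so produces a
    vanishing inner product.\<close>
  have "vol (map e L) = (\<Sum>\<sigma> | \<sigma> permutes {..<7::nat}. if \<sigma> = id then 1 else 0)"
    unfolding vol_def wedge1_def L_def[symmetric] length_map len
  proof (rule sum.cong[OF refl])
    fix \<sigma> assume s: "\<sigma> \<in> {\<sigma>. \<sigma> permutes {..<7::nat}}"
    have lt: "\<sigma> i < 7" if "i < 7" for i
      using s that permutes_in_image[of \<sigma> "{..<7}" i] by auto
    have "(\<Prod>i<7. (map (\<lambda>j v. g [e j, v]) L ! i) (map e L ! \<sigma> i)) = (\<Prod>i<7. if i = \<sigma> i then 1 else 0)"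
      using lt by (intro prod.cong) (auto simp: len g_frame nth_eq_iff_index_eq[OF d])
    also have "\<dots> = (if \<sigma> = id then 1 else 0)"
    proof (cases "\<sigma> = id")
      case False
      then obtain i where i: "\<sigma> i \<noteq> i" by (metis eq_id_iff)
      then have "i < 7" using s permutes_not_in[of \<sigma> "{..<7}" i] by auto
      then show ?thesis using i False by (auto intro!: prod_zero)
    qed simp
    finally show "of_int (sign \<sigma>) * (\<Prod>i<7. (map (\<lambda>j v. g [e j, v]) L ! i) (map e L ! \<sigma> i)) =
        (if \<sigma> = id then 1 else 0)" by simp
  qed
  also have "\<dots> = 1" by (simp add: sum.delta finite_permutations permutes_id)
  finally show ?thesis by (simp add: L_def)
qed

lemma vol_frame_list:
  assumes "length is = 7" "distinct is" shows "vol (map e is) = list_sign is"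
proof -
  have "card (set is) = card (UNIV :: 7 set)" using assms distinct_card[of "is"] by simp
  then have "set is = UNIV" by (intro card_subset_eq) auto
  then have set_eq: "set (sort is) = set [0, 1, 2, 3, 4, 5, 6]" by (simp only: set_sort UNIV_7 list.set)
  have "sorted_wrt (<) [0, 1, 2, 3, 4, 5, 6 :: 7]" by (simp add: less_numeral_7)
  then have L: "sorted [0, 1, 2, 3, 4, 5, 6 :: 7]" "distinct [0, 1, 2, 3, 4, 5, 6 :: 7]"
    unfolding strict_sorted_iff by blast+
  have "sort is = [0, 1, 2, 3, 4, 5, 6]"
    by (rule sorted_distinct_set_unique[OF sorted_sort _ L set_eq]) (simp only: distinct_sort assms(2))
  then show ?thesis using alternating_sort[OF vol_alternating assms(1), of e] vol_frame by simp
qed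

end

lemma sorted_7_length_3:
  assumes "length is = 3" "sorted_wrt (<) (is :: 7 list)"
  shows "is \<in> {[0,1,2],[0,1,3],[0,1,4],[0,1,5],[0,1,6],[0,2,3],[0,2,4],[0,2,5],[0,2,6],[0,3,4],[0,3,5],[0,3,6],
    [0,4,5],[0,4,6],[0,5,6],[1,2,3],[1,2,4],[1,2,5],[1,2,6],[1,3,4],[1,3,5],[1,3,6],[1,4,5],[1,4,6],[1,5,6],
    [2,3,4],[2,3,5],[2,3,6],[2,4,5],[2,4,6],[2,5,6],[3,4,5],[3,4,6],[3,5,6],[4,5,6]}"
proof -
  obtain i j k where "is": "is = [i, j, k]" using assms(1) by (auto simp: eval_nat_numeral length_Suc_conv)
  then have lt: "i < j" "j < k" using assms(2) by simp_all
  from lt(1) have "(i, j) \<in> {(0,1),(0,2),(0,3),(0,4),(0,5),(0,6),(1,2),(1,3),(1,4),(1,5),(1,6),(2,3),(2,4),(2,5),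
      (2,6),(3,4),(3,5),(3,6),(4,5),(4,6),(5,6)}"
    using exhaust_7[of i] exhaust_7[of j] by (elim disjE; simp add: less_numeral_7)
  then show ?thesis unfolding "is" using lt(2) exhaust_7[of k]
    by (simp only: insert_iff empty_iff prod.inject) (elim disjE conjE FalseE; simp add: less_numeral_7)
qed

lemma sorted_7_length_4:
  assumes "length is = 4" "sorted_wrt (<) (is :: 7 list)"
  shows "is \<in> {[0,1,2,3],[0,1,2,4],[0,1,2,5],[0,1,2,6],[0,1,3,4],[0,1,3,5],[0,1,3,6],[0,1,4,5],[0,1,4,6],[0,1,5,6],
    [0,2,3,4],[0,2,3,5],[0,2,3,6],[0,2,4,5],[0,2,4,6],[0,2,5,6],[0,3,4,5],[0,3,4,6],[0,3,5,6],[0,4,5,6],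
    [1,2,3,4],[1,2,3,5],[1,2,3,6],[1,2,4,5],[1,2,4,6],[1,2,5,6],[1,3,4,5],[1,3,4,6],[1,3,5,6],[1,4,5,6],
    [2,3,4,5],[2,3,4,6],[2,3,5,6],[2,4,5,6],[3,4,5,6]}"
proof -
  obtain i j k l where "is": "is = [i, j, k, l]" using assms(1) by (auto simp: eval_nat_numeral length_Suc_conv)
  then have lt: "k < l" "sorted_wrt (<) [i, j, k]" using assms(2) by simp_all
  have "[i, j, k] \<in> {[0,1,2],[0,1,3],[0,1,4],[0,1,5],[0,1,6],[0,2,3],[0,2,4],[0,2,5],[0,2,6],[0,3,4],[0,3,5],[0,3,6],
    [0,4,5],[0,4,6],[0,5,6],[1,2,3],[1,2,4],[1,2,5],[1,2,6],[1,3,4],[1,3,5],[1,3,6],[1,4,5],[1,4,6],[1,5,6],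
    [2,3,4],[2,3,5],[2,3,6],[2,4,5],[2,4,6],[2,5,6],[3,4,5],[3,4,6],[3,5,6],[4,5,6]}"
    by (rule sorted_7_length_3[OF _ lt(2)]) simp
  then show ?thesis unfolding "is" using lt(1) exhaust_7[of l]
    by (simp only: insert_iff empty_iff list.inject) (elim disjE conjE FalseE; simp add: less_numeral_7)
qed

text \<open>The Hodge dual of a basis form is, up to sign, the basis form on the complementary
  indices; listing them in increasing order makes that sign computable.\<close>

definition complement :: "7 list \<Rightarrow> 7 list" where
  "complement js = filter (\<lambda>i. i \<notin> set js) [0, 1, 2, 3, 4, 5, 6]"

lemma complement_props:
  shows "set (complement js) = - set js" "distinct (complement js)"
    "distinct js \<Longrightarrow> length (complement js) + length js = 7"
proof -
  have L: "set [0, 1, 2, 3, 4, 5, 6 :: 7] = UNIV" unfolding UNIV_7 by simp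
  show s: "set (complement js) = - set js" unfolding complement_def set_filter L by auto
  have "distinct [0, 1, 2, 3, 4, 5, 6 :: 7]" by (simp add: neq_numeral_7)
  then show d: "distinct (complement js)" unfolding complement_def by (rule distinct_filter)
  assume "distinct js"
  then have "length (complement js) + length js = card (- set js) + card (set js)"
    using d s distinct_card by metis
  also have "\<dots> = 7" by (subst card_Un_disjoint[symmetric]) (auto simp: Compl_partition2)
  finally show "length (complement js) + length js = 7" .
qed

lemma multilinear_append:
  assumes "multilinear (k + length ys) F" shows "multilinear k (\<lambda>xs. F (xs @ ys))"
  unfolding multilinear_def
proof (intro allI impI)
  fix xs :: "(real^'a) list" and i :: nat assume "length xs = k" "i < k"
  then show "linear (\<lambda>v. F (xs[i := v] @ ys))"
    using multilinear_linear_update[OF assms, of "xs @ ys" i] by (simp add: list_update_append)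
qed

lemma multilinear_append_left:
  assumes "multilinear (length xs + k) F" shows "multilinear k (\<lambda>ys. F (xs @ ys))"
  using assms by (induction xs arbitrary: F) (auto dest: multilinear_Cons)

lemma multilinear_sum:
  assumes "\<And>i. i \<in> S \<Longrightarrow> multilinear k (F i)" shows "multilinear k (\<lambda>xs. \<Sum>i\<in>S. F i xs)"
  using assms unfolding multilinear_def by (auto intro: linear_compose_sum)

lemma multilinear_scale: "multilinear k F \<Longrightarrow> multilinear k (\<lambda>xs. c * F xs)"
  unfolding multilinear_def by (auto intro: linear_times)

context cayley
begin

text \<open>Only orderings of the complementary indices survive in the volume form. Both positions
  of the summed block are needed, since the Hodge dual sums over the leading arguments and the
  iterated dual later also over the trailing ones.\<close>

lemma sum_vol:
  assumes "alternating k a" "distinct js" "length js + k = 7"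
  shows "(\<Sum>is | length is = k. a (map e is) * vol (map e is @ map e js)) =
      fact k * (a (map e (complement js)) * list_sign (complement js @ js))"
    and "(\<Sum>is | length is = k. a (map e is) * vol (map e js @ map e is)) =
      fact k * (a (map e (complement js)) * list_sign (js @ complement js))"
proof -
  note c = complement_props[of js]
  have len: "length (complement js) = k" using c(3) assms(2,3) by simp
  have eq: "set is = set (complement js)" if "length is = k" "distinct is" "set is \<inter> set js = {}" for "is"
  proof (rule card_subset_eq)
    show "set is \<subseteq> set (complement js)" using that(3) c(1) by auto
    show "card (set is) = card (set (complement js))" using that(1,2) len c(2) distinct_card by metis
  qed simp
  have v: "vol (map e is @ map e js) = 0" "vol (map e js @ map e is) = 0"
    if "length is = k" "distinct is" "set is \<noteq> set (complement js)" for "is"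
  proof -
    have nd: "\<not> distinct (is @ js)" "\<not> distinct (js @ is)" using eq[OF that(1,2)] that(3) by auto
    show "vol (map e is @ map e js) = 0" "vol (map e js @ map e is) = 0"
      using alternating_repeat[OF vol_alternating nd(1), of e] alternating_repeat[OF vol_alternating nd(2), of e]
        that(1) assms(3) by simp_all
  qed
  have alt1: "alternating k (\<lambda>xs. vol (xs @ map e js))"
    by (rule alternating_append) (use vol_alternating assms(3) in \<open>simp add: add.commute\<close>)
  have "(\<Sum>is | length is = k. a (map e is) * vol (map e is @ map e js)) =
      fact k * (a (map e (complement js)) * vol (map e (complement js) @ map e js))"
    using sum_alternating_product[where e = e, OF assms(1) alt1 c(2) len] v(1) by simp
  moreover have "vol (map e (complement js @ js)) = list_sign (complement js @ js)"
    by (rule vol_frame_list) (use assms(2,3) c len in auto)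
  ultimately show "(\<Sum>is | length is = k. a (map e is) * vol (map e is @ map e js)) =
      fact k * (a (map e (complement js)) * list_sign (complement js @ js))" by simp
  have alt2: "alternating k (\<lambda>xs. vol (map e js @ xs))"
    by (rule alternating_append_left) (use vol_alternating assms(3) in simp)
  have "(\<Sum>is | length is = k. a (map e is) * vol (map e js @ map e is)) =
      fact k * (a (map e (complement js)) * vol (map e js @ map e (complement js)))"
    using sum_alternating_product[where e = e, OF assms(1) alt2 c(2) len] v(2) by simp
  moreover have "vol (map e (js @ complement js)) = list_sign (js @ complement js)"
    by (rule vol_frame_list) (use assms(2,3) c len in auto)
  ultimately show "(\<Sum>is | length is = k. a (map e is) * vol (map e js @ map e is)) =
      fact k * (a (map e (complement js)) * list_sign (js @ complement js))" by simp
qed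

lemma hodge_frame:
  assumes "multilinear k a" "length xs + k = 7"
  shows "hodge g vol k a xs = (\<Sum>is | length is = k. a (map e is) * vol (map e is @ xs)) / fact k"
proof -
  have "multilinear k (\<lambda>ys. vol (ys @ xs))"
    by (rule multilinear_append) (use vol_multilinear assms(2) in \<open>simp add: add.commute\<close>)
  then show ?thesis unfolding hodge_def
    using orthonormal_sum_lists_invariant[OF onb_orthonormal orthonormal g_multilinear g_sym assms(1)] by simp
qed

text \<open>Removes the orientation: on each increasing quadruple of frame vectors the dual is
  \<phi> on the complementary triple with a sign, and this matches \<open>star3\<close>.\<close>

lemma hodge_\<phi>:
  assumes "length xs = 4" shows "hodge g vol 3 \<phi> xs = star3 g \<phi> xs"
proof (rule alternating_eq_sorted[OF orthonormal g_multilinear _ star_alternating _ star_multilinear assms])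
  show "alternating 4 (hodge g vol 3 \<phi>)"
    unfolding hodge_def divide_inverse mult.commute[of _ "inverse _"]
    by (intro alternating_scale alternating_sum alternating_append_left) (use vol_alternating in auto)
  show "multilinear 4 (hodge g vol 3 \<phi>)"
    unfolding hodge_def divide_inverse mult.commute[of _ "inverse _"]
    by (intro multilinear_scale multilinear_sum multilinear_append_left) (use vol_multilinear in auto)
next
  fix js :: "7 list" assume js: "length js = 4" "sorted_wrt (<) js"
  then have "distinct js" by (simp add: strict_sorted_iff)
  then have "hodge g vol 3 \<phi> (map e js) = \<phi> (map e (complement js)) * list_sign (complement js @ js)"
    using js(1) hodge_frame[OF \<phi>_multilinear, of "map e js"] sum_vol(1)[OF \<phi>_alternating, of js] by simp
  also have "\<dots> = star3 g \<phi> (map e js)"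
    using sorted_7_length_4[OF js]
    by (simp only: insert_iff empty_iff)
       (elim disjE FalseE; simp add: complement_def less_numeral_7 neq_numeral_7 \<phi>_frame star_frame eval_star0)
  finally show "hodge g vol 3 \<phi> (map e js) = star3 g \<phi> (map e js)" .
qed

end


section \<open>Contraction identities\<close>

text \<open>Renaming two neighbouring indices moves \<open>G\<close> by one slot and changes the
  sign of \<open>b\<close>, so the four terms of the alternating sum contribute equally.\<close>

lemma sum_alternating_contraction:
  fixes b :: "'i::finite \<Rightarrow> 'i \<Rightarrow> 'i \<Rightarrow> 'i \<Rightarrow> real"
  assumes b: "\<And>i j k l. b j i k l = - b i j k l" "\<And>i j k l. b i k j l = - b i j k l"
    "\<And>i j k l. b i j l k = - b i j k l"
  shows "(\<Sum>i\<in>UNIV. \<Sum>j\<in>UNIV. \<Sum>k\<in>UNIV. \<Sum>l\<in>UNIV.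
      b i j k l * (G i * p j k l - G j * p i k l + G k * p i j l - G l * p i j k)) =
    4 * (\<Sum>i\<in>UNIV. \<Sum>j\<in>UNIV. \<Sum>k\<in>UNIV. \<Sum>l\<in>UNIV. b i j k l * (G i * p j k l))"
proof -
  let ?s = "\<lambda>f. \<Sum>i\<in>UNIV. \<Sum>j\<in>UNIV. \<Sum>k\<in>UNIV. \<Sum>l\<in>UNIV. (f i j k l :: real)"
  have 2: "?s (\<lambda>i j k l. b i j k l * (G j * p i k l)) = - ?s (\<lambda>i j k l. b i j k l * (G i * p j k l))"
    unfolding sum_negf[symmetric] by (subst sum.swap, intro sum.cong refl) (subst b(1), simp)
  have 3: "?s (\<lambda>i j k l. b i j k l * (G k * p i j l)) = - ?s (\<lambda>i j k l. b i j k l * (G j * p i k l))"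
    unfolding sum_negf[symmetric]
    by (rule sum.cong[OF refl], subst sum.swap, intro sum.cong refl) (subst b(2), simp)
  have 4: "?s (\<lambda>i j k l. b i j k l * (G l * p i j k)) = - ?s (\<lambda>i j k l. b i j k l * (G k * p i j l))"
    unfolding sum_negf[symmetric]
    by (rule sum.cong[OF refl], rule sum.cong[OF refl], subst sum.swap, intro sum.cong refl) (subst b(3), simp)
  show ?thesis
    using 2 3 4 by (simp add: distrib_left right_diff_distrib sum.distrib sum_subtractf)
qed

context cayley
begin

lemma star_frame_3: "star3 g \<phi> [e i, e j, e k, x] = (\<Sum>m\<in>UNIV. g [x, e m] * star0 i j k m)"
proof -
  have "star3 g \<phi> [e i, e j, e k, x] = star3 g \<phi> [e i, e j, e k, \<Sum>m\<in>UNIV. g [x, e m] *\<^sub>R e m]"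
    using expansion[of x] by simp
  then show ?thesis by (simp add: star_simps star_frame)
qed

lemma linear_frame_sum:
  assumes "linear f" shows "(\<Sum>i\<in>UNIV. g [x, e i] * f (e i)) = f x"
proof -
  have "f x = f (\<Sum>i\<in>UNIV. g [x, e i] *\<^sub>R e i)" using expansion[of x] by simp
  then show ?thesis by (simp add: linear_sum[OF assms] linear_scale[OF assms])
qed

text \<open>Up to the factor 6 = 3! this is the duality between contracting the dual of \<phi> with
  \<open>x\<close> and wedging \<phi> with the one-form of \<open>x\<close>. Both sides alternate in
  \<open>ys\<close>, so the frame quadruples decide, with \<open>x\<close> arbitrary.\<close>

lemma sum_vol_star:
  assumes "length ys = 4"
  shows "(\<Sum>js | length js = 3. star3 g \<phi> (map e js @ [x]) * vol (ys @ map e js)) =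
    6 * (g [ys ! 0, x] * \<phi> [ys ! 1, ys ! 2, ys ! 3] - g [ys ! 1, x] * \<phi> [ys ! 0, ys ! 2, ys ! 3]
      + g [ys ! 2, x] * \<phi> [ys ! 0, ys ! 1, ys ! 3] - g [ys ! 3, x] * \<phi> [ys ! 0, ys ! 1, ys ! 2])"
    (is "?F ys = ?G ys")
proof (rule alternating_eq_sorted[OF orthonormal g_multilinear _ _ _ _ assms])
  show "alternating 4 ?F"
    by (intro alternating_scale alternating_sum alternating_append) (use vol_alternating in auto)
  show "multilinear 4 ?F"
    by (intro multilinear_scale multilinear_sum multilinear_append) (use vol_multilinear in auto)
  show "alternating 4 ?G"
  proof (rule alternating_4I)
    fix p q r s
    show "?G [q, p, r, s] = - ?G [p, q, r, s]"
      by (simp add: \<phi>_alt(1)[where x = p and y = q])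
    show "?G [p, r, q, s] = - ?G [p, q, r, s]"
      by (simp add: \<phi>_alt(1)[where x = q and y = r] \<phi>_alt(2)[where y = q and z = r])
    show "?G [p, q, s, r] = - ?G [p, q, r, s]"
      by (simp add: \<phi>_alt(2)[where y = r and z = s])
  qed
  show "multilinear 4 ?G"
    by (rule multilinear_4I; rule linearI) (simp_all add: g_simps \<phi>_simps algebra_simps)
next
  fix ks :: "7 list" assume ks: "length ks = 4" "sorted_wrt (<) ks"
  have "distinct ks" using ks(2) by (simp add: strict_sorted_iff)
  moreover have "alternating 3 (\<lambda>zs. star3 g \<phi> (zs @ [x]))"
    by (rule alternating_append) (use star_alternating in simp)
  ultimately have "?F (map e ks) =
      6 * (star3 g \<phi> (map e (complement ks) @ [x]) * list_sign (ks @ complement ks))"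
    using sum_vol(2)[of 3 "\<lambda>zs. star3 g \<phi> (zs @ [x])" ks] ks(1) by (simp add: fact_numeral)
  also have "\<dots> = ?G (map e ks)"
    using sorted_7_length_4[OF ks]
    by (simp only: insert_iff empty_iff)
       (elim disjE FalseE; simp add: complement_def less_numeral_7 neq_numeral_7 \<phi>_frame star_frame_3
          sum_UNIV_7 eval_star0 g_sym[of "e _" x])
  finally show "?F (map e ks) = ?G (map e ks)" .
qed

text \<open>Exchanging two blocks of three takes nine transpositions, an odd number.\<close>

lemma vol_swap:
  assumes "length xs = 3" "length ys = 3" shows "vol (xs @ ys @ [x]) = - vol (ys @ xs @ [x])"
proof -
  obtain a b c p q r where xs: "xs = [a, b, c]" "ys = [p, q, r]"
    using assms by (auto simp: eval_nat_numeral length_Suc_conv)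
  let ?L = "[p, q, r, a, b, c, x]"
  have "vol (map ((!) ?L) [3, 4, 5, 0, 1, 2, 6]) = list_sign [3, 4, 5, 0, 1, 2, 6 :: nat] * vol (map ((!) ?L) (sort [3, 4, 5, 0, 1, 2, 6]))"
    by (rule alternating_sort[OF vol_alternating]) simp
  then show ?thesis by (simp add: xs)
qed

text \<open>Each permutation in \<open>wedge\<close> contributes the same amount, because
  renumbering the summation indices moves its sign into the volume form. The 6! equal terms cancel
  the factorial of \<open>hodge\<close>, and 36 = 3! 3! remains.\<close>

lemma hodge_wedge:
  "hodge g vol 6 (wedge 3 3 a b) [x] =
    (\<Sum>is | length is = 3. \<Sum>js | length js = 3.
       a (map (onb g) is) * b (map (onb g) js) * vol (map (onb g) is @ map (onb g) js @ [x])) / 36"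
proof -
  let ?E = "onb g" and ?S = "{is::7 list. length is = 6}" and ?P = "{\<sigma>. \<sigma> permutes {..<6::nat}}"
  define f where "f is = a (map ?E (take 3 is)) * b (map ?E (drop 3 is)) * vol (map ?E is @ [x])" for "is"
  have f: "(\<Sum>is\<in>?S. of_int (sign \<sigma>) * a (map (\<lambda>i. map ?E is ! \<sigma> i) [0..<3]) *
      b (map (\<lambda>i. map ?E is ! \<sigma> i) [3..<6]) * vol (map ?E is @ [x])) = (\<Sum>is\<in>?S. f is)"
    if s: "\<sigma> permutes {..<6}" for \<sigma>
  proof (rule sum.reindex_bij_witness[where j = "\<lambda>is. map (\<lambda>i. is ! \<sigma> i) [0..<6]" and
        i = "\<lambda>is. map (\<lambda>i. is ! inv \<sigma> i) [0..<6]"])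
    have lt: "\<sigma> i < 6" "inv \<sigma> i < 6" if "i < 6" for i
      using that permutes_in_image[OF s, of i] permutes_in_image[OF permutes_inv[OF s], of i] by auto
    have inv: "\<sigma> (inv \<sigma> i) = i" "inv \<sigma> (\<sigma> i) = i" for i using permutes_inverses[OF s] by auto
    fix "is" :: "7 list" assume il: "is \<in> ?S"
    then show "map (\<lambda>i. map (\<lambda>i. is ! \<sigma> i) [0..<6] ! inv \<sigma> i) [0..<6] = is"
      "map (\<lambda>i. map (\<lambda>i. is ! inv \<sigma> i) [0..<6] ! \<sigma> i) [0..<6] = is"
      using lt inv by (auto intro!: nth_equalityI)
    show "map (\<lambda>i. is ! \<sigma> i) [0..<6] \<in> ?S" "map (\<lambda>i. is ! inv \<sigma> i) [0..<6] \<in> ?S" by auto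
    let ?js = "map (\<lambda>i. is ! \<sigma> i) [0..<6]"
    \<comment> \<open>The permutation is extended to seven letters, fixing the last one, so that it
      acts on the volume form while \<open>x\<close> stays in place.\<close>
    have s7: "\<sigma> permutes {..<7}" by (rule permutes_subset[OF s]) auto
    have s6: "\<sigma> 6 = 6" by (rule permutes_not_in[OF s]) simp
    have "map (\<lambda>i. (map ?E is @ [x]) ! \<sigma> i) [0..<7] = map ?E ?js @ [x]"
      using il lt s6 by (intro nth_equalityI) (auto simp: nth_append less_Suc_eq eval_nat_numeral)
    then have v: "vol (map ?E ?js @ [x]) = of_int (sign \<sigma>) * vol (map ?E is @ [x])"
      using wedge1_permute[of \<sigma> "map (\<lambda>j v. g [e j, v]) [0, 1, 2, 3, 4, 5, 6]" "map ?E is @ [x]"] s7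
      by (simp add: vol_def eval_nat_numeral)
    have t: "map ?E (take 3 ?js) = map (\<lambda>i. map ?E is ! \<sigma> i) [0..<3]"
      "map ?E (drop 3 ?js) = map (\<lambda>i. map ?E is ! \<sigma> i) [3..<6]"
      subgoal using il lt by (auto intro!: nth_equalityI)
      subgoal unfolding drop_map drop_upt map_map add_0 by (rule map_cong) (use il lt in auto)
      done
    show "f ?js = of_int (sign \<sigma>) * a (map (\<lambda>i. map ?E is ! \<sigma> i) [0..<3]) *
      b (map (\<lambda>i. map ?E is ! \<sigma> i) [3..<6]) * vol (map ?E is @ [x])"
      unfolding f_def t v by simp
  qed
  have "hodge g vol 6 (wedge 3 3 a b) [x] = (\<Sum>is\<in>?S. \<Sum>\<sigma>\<in>?P. of_int (sign \<sigma>) *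
      a (map (\<lambda>i. map ?E is ! \<sigma> i) [0..<3]) * b (map (\<lambda>i. map ?E is ! \<sigma> i) [3..<6]) *
      vol (map ?E is @ [x])) / (36 * fact 6)"
    unfolding hodge_def wedge_def by (simp add: sum_distrib_right sum_divide_distrib fact_numeral)
  also have "\<dots> = (\<Sum>\<sigma>\<in>?P. \<Sum>is\<in>?S. of_int (sign \<sigma>) *
      a (map (\<lambda>i. map ?E is ! \<sigma> i) [0..<3]) * b (map (\<lambda>i. map ?E is ! \<sigma> i) [3..<6]) *
      vol (map ?E is @ [x])) / (36 * fact 6)"
    by (subst sum.swap) simp
  also have "\<dots> = (\<Sum>\<sigma>\<in>?P. \<Sum>is\<in>?S. f is) / (36 * fact 6)"
    using f by simp
  also have "\<dots> = (\<Sum>is\<in>?S. f is) / 36"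
    by (simp add: card_permutations[OF refl])
  also have "(\<Sum>is\<in>?S. f is) = (\<Sum>is | length is = 3. \<Sum>js | length js = 3. f (is @ js))"
    using sum_lists_append[where k = 3 and l = 3 and f = f] by simp
  finally show ?thesis by (simp add: f_def)
qed

text \<open>An adjunction: integrating \<phi> against the volume form produces \<open>star3\<close>,
  and integrating that produces the wedge of the one-form of \<open>x\<close> with \<phi>. Pairing
  \<beta> with this wedge is pairing the contraction of \<beta> by \<open>x\<close> with \<phi>. So
  the right side is minus an inner product of 3-forms.\<close>

lemma hodge_hodge_wedge:
  assumes \<beta>: "multilinear 4 \<beta>" "alternating 4 \<beta>"
  shows "hodge g vol 6 (wedge 3 3 (hodge g vol 4 \<beta>) \<phi>) [x] =
    - (\<Sum>i\<in>UNIV. \<Sum>j\<in>UNIV. \<Sum>k\<in>UNIV. \<beta> [x, e i, e j, e k] * \<phi> [e i, e j, e k]) / 6"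
proof -
  let ?E = "onb g"
  let ?\<Theta> = "\<lambda>ys. g [ys ! 0, x] * \<phi> [ys ! 1, ys ! 2, ys ! 3] - g [ys ! 1, x] * \<phi> [ys ! 0, ys ! 2, ys ! 3]
      + g [ys ! 2, x] * \<phi> [ys ! 0, ys ! 1, ys ! 3] - g [ys ! 3, x] * \<phi> [ys ! 0, ys ! 1, ys ! 2]"
  have "hodge g vol 6 (wedge 3 3 (hodge g vol 4 \<beta>) \<phi>) [x] =
    (\<Sum>is | length is = 3. hodge g vol 4 \<beta> (map ?E is) *
      (\<Sum>js | length js = 3. \<phi> (map ?E js) * vol (map ?E is @ map ?E js @ [x]))) / 36"
    unfolding hodge_wedge by (simp add: sum_distrib_left mult.assoc)
  \<comment> \<open>The factor -6 consists of the 3! in the definition of \<open>hodge\<close> and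
    the sign from exchanging two blocks of three vectors.\<close>
  also have "\<dots> = (\<Sum>is | length is = 3. hodge g vol 4 \<beta> (map ?E is) * - (6 * star3 g \<phi> (map ?E is @ [x]))) / 36"
  proof (intro arg_cong[where f = "\<lambda>x. x / 36"] sum.cong refl arg_cong2[where f = "(*)"])
    fix "is" :: "7 list" assume il: "is \<in> {is. length is = 3}"
    have "(\<Sum>js | length js = 3. \<phi> (map ?E js) * vol (map ?E is @ map ?E js @ [x])) =
        - (\<Sum>js | length js = 3. \<phi> (map ?E js) * vol (map ?E js @ map ?E is @ [x]))"
      unfolding sum_negf[symmetric]
    proof (intro sum.cong refl)
      fix js :: "7 list" assume "js \<in> {js. length js = 3}"
      with il show "\<phi> (map ?E js) * vol (map ?E is @ map ?E js @ [x]) =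
          - (\<phi> (map ?E js) * vol (map ?E js @ map ?E is @ [x]))"
        using vol_swap[of "map ?E is" "map ?E js" x] by simp
    qed
    also have "\<dots> = - (6 * hodge g vol 3 \<phi> (map ?E is @ [x]))"
      by (simp add: hodge_def fact_numeral)
    finally show "(\<Sum>js | length js = 3. \<phi> (map ?E js) * vol (map ?E is @ map ?E js @ [x])) =
        - (6 * star3 g \<phi> (map ?E is @ [x]))"
      using il hodge_\<phi>[of "map ?E is @ [x]"] by simp
  qed
  \<comment> \<open>Unfolding the inner dual brings in 1/4!, and 36 * 24 / 6 = 144.\<close>
  also have "\<dots> = - (\<Sum>is | length is = 3. \<Sum>ks | length ks = 4.
      \<beta> (map ?E ks) * (star3 g \<phi> (map ?E is @ [x]) * vol (map ?E ks @ map ?E is))) / 144"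
    unfolding hodge_def
    by (simp add: fact_numeral sum_divide_distrib sum_distrib_left sum_distrib_right sum_negf mult_ac)
  also have "\<dots> = - (\<Sum>ks | length ks = 4. \<beta> (map ?E ks) *
      (\<Sum>is | length is = 3. star3 g \<phi> (map ?E is @ [x]) * vol (map ?E ks @ map ?E is))) / 144"
    by (subst sum.swap) (simp add: sum_distrib_left)
  also have "\<dots> = - (\<Sum>ks | length ks = 4. \<beta> (map ?E ks) * (6 * ?\<Theta> (map ?E ks))) / 144"
  proof (intro arg_cong[where f = "\<lambda>x. - x / 144"] sum.cong refl arg_cong2[where f = "(*)"])
    fix ks :: "7 list" assume ks: "ks \<in> {ks. length ks = 4}"
    have m: "multilinear 3 (\<lambda>zs. star3 g \<phi> (zs @ [x]))" "multilinear 3 (\<lambda>zs. vol (map ?E ks @ zs))"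
      using star_multilinear vol_multilinear ks
      by (auto intro!: multilinear_append multilinear_append_left)
    show "(\<Sum>is | length is = 3. star3 g \<phi> (map ?E is @ [x]) * vol (map ?E ks @ map ?E is)) = 6 * ?\<Theta> (map ?E ks)"
      using orthonormal_sum_lists_invariant[OF onb_orthonormal orthonormal g_multilinear g_sym m]
        sum_vol_star[of "map ?E ks"] ks by simp
  qed
  also have "\<dots> = - (\<Sum>ks | length ks = 4. \<beta> (map ?E ks) * ?\<Theta> (map ?E ks)) / 24"
    by (simp only: mult.left_commute[of _ 6] sum_distrib_left[symmetric])
  also have "(\<Sum>ks | length ks = 4. \<beta> (map ?E ks) * ?\<Theta> (map ?E ks)) =
     4 * (\<Sum>i\<in>UNIV. \<Sum>j\<in>UNIV. \<Sum>k\<in>UNIV. \<Sum>l\<in>UNIV.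
       \<beta> [?E i, ?E j, ?E k, ?E l] * (g [?E i, x] * \<phi> [?E j, ?E k, ?E l]))"
    (is "_ = 4 * ?S")
    unfolding sum_lists
    by (subst sum_alternating_contraction[symmetric], (rule alternating_4D[OF \<beta>(2)])+)
      (simp add: numeral_2_eq_2 numeral_3_eq_3)
  also have "?S = (\<Sum>i\<in>UNIV. g [x, ?E i] * (\<Sum>is | length is = 3. \<beta> (?E i # map ?E is) * \<phi> (map ?E is)))"
    by (simp add: sum_lists sum_distrib_left g_sym[of x] mult_ac)
  also have "\<dots> = (\<Sum>is | length is = 3. \<Sum>i\<in>UNIV. g [x, ?E i] * (\<beta> (?E i # map ?E is) * \<phi> (map ?E is)))"
    unfolding sum_distrib_left by (rule sum.swap)
  also have "\<dots> = (\<Sum>is | length is = 3. \<beta> (x # map ?E is) * \<phi> (map ?E is))"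
  proof (intro sum.cong refl)
    fix "is" :: "7 list" assume "is \<in> {is. length is = 3}"
    then have lin: "linear (\<lambda>v. \<beta> (v # map ?E is))"
      using multilinear_linear_Cons[of 3 \<beta> "map ?E is"] \<beta>(1) by simp
    have "\<beta> (x # map ?E is) = \<beta> ((\<Sum>i\<in>UNIV. g [x, ?E i] *\<^sub>R ?E i) # map ?E is)"
      using orthonormal_expansion[OF onb_orthonormal g_multilinear, of x] by simp
    then show "(\<Sum>i\<in>UNIV. g [x, ?E i] * (\<beta> (?E i # map ?E is) * \<phi> (map ?E is))) = \<beta> (x # map ?E is) * \<phi> (map ?E is)"
      by (simp add: linear_sum[OF lin] linear_scale[OF lin] sum_distrib_right mult.assoc)
  qed
  also have "\<dots> = (\<Sum>is | length is = 3. \<beta> (x # map e is) * \<phi> (map e is))"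
    by (rule orthonormal_sum_lists_invariant[OF onb_orthonormal orthonormal g_multilinear g_sym _ \<phi>_multilinear])
       (rule multilinear_Cons, use \<beta>(1) in simp)
  finally show ?thesis by (simp add: sum_lists)
qed

lemma \<phi>_\<phi>_contraction:
  "(\<Sum>j\<in>UNIV. \<Sum>k\<in>UNIV. \<phi> [x, e j, e k] * \<phi> [y, e j, e k]) = 6 * g [x, y]"
proof -
  have "(\<Sum>k\<in>UNIV. \<phi> [x, e j, e k] * \<phi> [y, e j, e k]) = g [x, y] - g [x, e j] * g [y, e j]" for j
    using \<phi>_square[of "e j" x y] by (simp add: \<phi>_alt(1)[of "e j"] g_frame g_sym[of "e j"])
  then show ?thesis by (simp add: sum_subtractf g_parseval[symmetric])
qed

text \<open>By \<open>star_eq\<close> the two metric terms contribute 1 each and the quadratic term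
  contributes -6 by \<open>\<phi>_\<phi>_contraction\<close>, in total -4.\<close>

lemma star_\<phi>_contraction:
  "(\<Sum>j\<in>UNIV. \<Sum>k\<in>UNIV. star3 g \<phi> [x, y, e j, e k] * \<phi> [z, e j, e k]) = - 4 * \<phi> [z, x, y]"
proof -
  have "(\<Sum>j\<in>UNIV. \<Sum>k\<in>UNIV. (g [x, e j] * g [y, e k]) * \<phi> [z, e j, e k]) = \<phi> [z, x, y]" for x y
  proof -
    have "(\<Sum>j\<in>UNIV. \<Sum>k\<in>UNIV. (g [x, e j] * g [y, e k]) * \<phi> [z, e j, e k]) =
        (\<Sum>j\<in>UNIV. g [x, e j] * (\<Sum>k\<in>UNIV. g [y, e k] * \<phi> [z, e j, e k]))"
      by (simp add: sum_distrib_left mult.assoc)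
    then show ?thesis
      using linear_frame_sum[OF lin_\<phi>(3)] linear_frame_sum[OF lin_\<phi>(2)] by simp
  qed
  note 1 = this
  have "(\<Sum>j\<in>UNIV. \<Sum>k\<in>UNIV. (\<Sum>m\<in>UNIV. \<phi> [e m, x, y] * \<phi> [e m, e j, e k]) * \<phi> [z, e j, e k]) =
      (\<Sum>j\<in>UNIV. \<Sum>m\<in>UNIV. \<Sum>k\<in>UNIV. \<phi> [e m, x, y] * (\<phi> [e m, e j, e k] * \<phi> [z, e j, e k]))"
    unfolding sum_distrib_right mult.assoc by (rule sum.cong[OF refl], rule sum.swap)
  also have "\<dots> = (\<Sum>m\<in>UNIV. \<phi> [e m, x, y] * (\<Sum>j\<in>UNIV. \<Sum>k\<in>UNIV. \<phi> [e m, e j, e k] * \<phi> [z, e j, e k]))"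
    unfolding sum_distrib_left by (rule sum.swap)
  also have "\<dots> = 6 * (\<Sum>m\<in>UNIV. g [z, e m] * \<phi> [e m, x, y])"
    unfolding \<phi>_\<phi>_contraction sum_distrib_left by (simp add: g_sym[of z] mult_ac)
  also have "\<dots> = 6 * \<phi> [z, x, y]"
    using linear_frame_sum[OF lin_\<phi>(1)] by simp
  finally have 2: "(\<Sum>j\<in>UNIV. \<Sum>k\<in>UNIV. (\<Sum>m\<in>UNIV. \<phi> [e m, x, y] * \<phi> [e m, e j, e k]) * \<phi> [z, e j, e k]) = 6 * \<phi> [z, x, y]" .
  have "star3 g \<phi> [x, y, e j, e k] * \<phi> [z, e j, e k] = g [x, e j] * g [y, e k] * \<phi> [z, e j, e k]
      + g [y, e j] * g [x, e k] * \<phi> [z, e k, e j] - (\<Sum>m\<in>UNIV. \<phi> [e m, x, y] * \<phi> [e m, e j, e k]) * \<phi> [z, e j, e k]" for j k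
    using \<phi>_alt(2)[of z "e k" "e j"] by (simp add: star_eq algebra_simps)
  moreover have "(\<Sum>j\<in>UNIV. \<Sum>k\<in>UNIV. g [y, e j] * g [x, e k] * \<phi> [z, e k, e j]) = \<phi> [z, x, y]"
    using 1[of x y] by (subst sum.swap) (simp add: mult.commute)
  ultimately show ?thesis
    using 1[of x y] 2 by (simp add: sum.distrib sum_subtractf)
qed

lemma star_\<phi>_full_contraction:
  "(\<Sum>i\<in>UNIV. \<Sum>j\<in>UNIV. \<Sum>k\<in>UNIV. star3 g \<phi> [x, e i, e j, e k] * \<phi> [e i, e j, e k]) = 0"
  unfolding star_\<phi>_contraction by (simp add: \<phi>_repeat)

text \<open>Expanding one factor by \<open>star_eq\<close> leaves twice a trace of
  \<open>star3\<close>, which sums to zero, and 4 times the contraction of \<phi> with itself: 4 * 6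
  = 24. Since 24 = 4 * 3!, the factor 1/4 in \<open>r_phi\<close> is the right
  normalisation.\<close>

lemma star_star_contraction:
  "(\<Sum>i\<in>UNIV. \<Sum>j\<in>UNIV. \<Sum>k\<in>UNIV. star3 g \<phi> [x, e i, e j, e k] * star3 g \<phi> [y, e i, e j, e k]) = 24 * g [x, y]"
proof -
  have "star3 g \<phi> [y, z, e j, e k] = g [y, e j] * g [z, e k] - g [z, e j] * g [y, e k]
     - (\<Sum>m\<in>UNIV. \<phi> [e m, y, z] * \<phi> [e m, e j, e k])" for z j k
    by (simp add: star_eq mult.commute)
  have 1: "(\<Sum>j\<in>UNIV. \<Sum>k\<in>UNIV. star3 g \<phi> [x, z, e j, e k] * (g [v, e j] * g [w, e k])) = star3 g \<phi> [x, z, v, w]" for z v w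
  proof -
    have "(\<Sum>j\<in>UNIV. \<Sum>k\<in>UNIV. star3 g \<phi> [x, z, e j, e k] * (g [v, e j] * g [w, e k])) =
        (\<Sum>j\<in>UNIV. g [v, e j] * (\<Sum>k\<in>UNIV. g [w, e k] * star3 g \<phi> [x, z, e j, e k]))"
      by (simp add: sum_distrib_left mult_ac)
    then show ?thesis
      using linear_frame_sum[OF lin_star(4)] linear_frame_sum[OF lin_star(3)] by simp
  qed
  have 2: "(\<Sum>j\<in>UNIV. \<Sum>k\<in>UNIV. star3 g \<phi> [x, z, e j, e k] * (\<Sum>m\<in>UNIV. \<phi> [e m, y, z] * \<phi> [e m, e j, e k])) =
      - 4 * (\<Sum>m\<in>UNIV. \<phi> [x, z, e m] * \<phi> [y, z, e m])" for z
  proof -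
    have "(\<Sum>j\<in>UNIV. \<Sum>k\<in>UNIV. star3 g \<phi> [x, z, e j, e k] * (\<Sum>m\<in>UNIV. \<phi> [e m, y, z] * \<phi> [e m, e j, e k])) =
      (\<Sum>j\<in>UNIV. \<Sum>m\<in>UNIV. \<Sum>k\<in>UNIV. \<phi> [e m, y, z] * (star3 g \<phi> [x, z, e j, e k] * \<phi> [e m, e j, e k]))"
      unfolding sum_distrib_left by (rule sum.cong[OF refl], subst sum.swap) (simp add: mult_ac)
    also have "\<dots> = (\<Sum>m\<in>UNIV. \<phi> [e m, y, z] * (\<Sum>j\<in>UNIV. \<Sum>k\<in>UNIV. star3 g \<phi> [x, z, e j, e k] * \<phi> [e m, e j, e k]))"
      unfolding sum_distrib_left by (rule sum.swap)
    also have "\<dots> = - 4 * (\<Sum>m\<in>UNIV. \<phi> [x, z, e m] * \<phi> [y, z, e m])"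
      unfolding star_\<phi>_contraction sum_distrib_left
      by (rule sum.cong[OF refl]) (simp add: \<phi>_cyclic[symmetric, of _ "e _"] \<phi>_cyclic)
    finally show ?thesis .
  qed
  have "(\<Sum>j\<in>UNIV. \<Sum>k\<in>UNIV. star3 g \<phi> [x, z, e j, e k] * star3 g \<phi> [y, z, e j, e k]) =
      2 * star3 g \<phi> [x, z, y, z] + 4 * (\<Sum>m\<in>UNIV. \<phi> [x, z, e m] * \<phi> [y, z, e m])" for z
  proof -
    have "star3 g \<phi> [x, z, e j, e k] * star3 g \<phi> [y, z, e j, e k] =
        star3 g \<phi> [x, z, e j, e k] * (g [y, e j] * g [z, e k]) - star3 g \<phi> [x, z, e j, e k] * (g [z, e j] * g [y, e k])
        - star3 g \<phi> [x, z, e j, e k] * (\<Sum>m\<in>UNIV. \<phi> [e m, y, z] * \<phi> [e m, e j, e k])" for j k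
      by (simp add: star_eq[of y z "e j" "e k"] algebra_simps)
    then show ?thesis
      using 1[of z y z] 1[of z z y] 2[of z] alternating_4D(3)[OF star_alternating, of x z z y]
      by (simp add: sum_subtractf)
  qed
  moreover have "(\<Sum>i\<in>UNIV. star3 g \<phi> [x, e i, y, e i]) = 0"
  proof -
    have "star3 g \<phi> [x, z, y, z] = g [x, y] * g [z, z] - g [x, z] * g [y, z] - (\<Sum>m\<in>UNIV. \<phi> [z, x, e m] * \<phi> [z, y, e m])" for z
    proof -
      have "\<phi> [e m, v, z] = - \<phi> [z, v, e m]" for m v
        using \<phi>_cyclic[of v z "e m"] \<phi>_alt(1)[of z v "e m"] by simp
      then show ?thesis by (simp add: star_eq g_sym[of z y])
    qed
    then show ?thesis by (simp add: \<phi>_square g_frame g_sym[of "e _"])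
  qed
  ultimately show ?thesis
    using \<phi>_\<phi>_contraction[of x y] by (simp add: sum.distrib sum_distrib_left[symmetric])
qed

end


section \<open>Derivatives of \<open>\<phi>\<close> and \<open>*\<phi>\<close> at a point\<close>

text \<open>\<open>Q l\<close> sums the entries of \<open>M\<close> over the three lines through
  \<open>l\<close>, which is half its pairing with the contraction of \<phi> by the l-th frame
  vector. It vanishes precisely for \<open>M\<close> in g_2, so it captures the component that acts
  nontrivially on \<phi>.\<close>

lemma derivation_phi0:
  fixes M :: "7 \<Rightarrow> 7 \<Rightarrow> real"
  assumes skew: "\<And>i j. M j i = - M i j"
    and Q: "\<And>l. Q l = M (l + 1) (l + 3) + M (l + 4) (l + 5) + M (l + 2) (l + 6)"
    and "sorted_wrt (<) [i, j, k]"
  shows "(\<Sum>m\<in>UNIV. M i m * phi0 m j k) + (\<Sum>m\<in>UNIV. M j m * phi0 i m k) + (\<Sum>m\<in>UNIV. M k m * phi0 i j m) =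
    - (\<Sum>l\<in>UNIV. Q l * star0 l i j k)"
proof -
  have d: "M i i = 0" for i using skew[of i i] by simp
  have s: "M 1 0 = - M 0 1" "M 2 0 = - M 0 2" "M 3 0 = - M 0 3" "M 4 0 = - M 0 4" "M 5 0 = - M 0 5" "M 6 0 = - M 0 6"
    "M 2 1 = - M 1 2" "M 3 1 = - M 1 3" "M 4 1 = - M 1 4" "M 5 1 = - M 1 5" "M 6 1 = - M 1 6"
    "M 3 2 = - M 2 3" "M 4 2 = - M 2 4" "M 5 2 = - M 2 5" "M 6 2 = - M 2 6"
    "M 4 3 = - M 3 4" "M 5 3 = - M 3 5" "M 6 3 = - M 3 6" "M 5 4 = - M 4 5" "M 6 4 = - M 4 6" "M 6 5 = - M 5 6"
    by (rule skew)+
  have "length [i, j, k] = 3" by simp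
  from sorted_7_length_3[OF this assms(3)] show ?thesis
    by (simp only: insert_iff empty_iff list.inject simp_thms)
       (elim disjE conjE FalseE; simp add: sum_UNIV_7 eval_star0 Q numeral_7_mod d s)
qed

text \<open>The same component \<open>Q\<close> governs the action on the dual; the result is minus
  the wedge of \<phi> with \<open>Q\<close>, once the sign of the derivation is included.\<close>

lemma derivation_star0:
  fixes M :: "7 \<Rightarrow> 7 \<Rightarrow> real"
  assumes skew: "\<And>i j. M j i = - M i j"
    and Q: "\<And>l. Q l = M (l + 1) (l + 3) + M (l + 4) (l + 5) + M (l + 2) (l + 6)"
    and "sorted_wrt (<) [i, j, k, l]"
  shows "(\<Sum>m\<in>UNIV. M i m * star0 m j k l) + (\<Sum>m\<in>UNIV. M j m * star0 i m k l)
      + (\<Sum>m\<in>UNIV. M k m * star0 i j m l) + (\<Sum>m\<in>UNIV. M l m * star0 i j k m) =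
    Q i * phi0 j k l - Q j * phi0 i k l + Q k * phi0 i j l - Q l * phi0 i j k"
proof -
  have d: "M i i = 0" for i using skew[of i i] by simp
  have s: "M 1 0 = - M 0 1" "M 2 0 = - M 0 2" "M 3 0 = - M 0 3" "M 4 0 = - M 0 4" "M 5 0 = - M 0 5" "M 6 0 = - M 0 6"
    "M 2 1 = - M 1 2" "M 3 1 = - M 1 3" "M 4 1 = - M 1 4" "M 5 1 = - M 1 5" "M 6 1 = - M 1 6"
    "M 3 2 = - M 2 3" "M 4 2 = - M 2 4" "M 5 2 = - M 2 5" "M 6 2 = - M 2 6"
    "M 4 3 = - M 3 4" "M 5 3 = - M 3 5" "M 6 3 = - M 3 6" "M 5 4 = - M 4 5" "M 6 4 = - M 4 6" "M 6 5 = - M 5 6"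
    by (rule skew)+
  have "length [i, j, k, l] = 4" by simp
  from sorted_7_length_4[OF this assms(3)] show ?thesis
    by (simp only: insert_iff empty_iff list.inject simp_thms)
       (elim disjE conjE FalseE; simp add: sum_UNIV_7 eval_star0 Q numeral_7_mod d s)
qed

lemma alternating_map:
  assumes "alternating k F" shows "alternating k (\<lambda>is. F (map e (is :: 'b list)))"
  unfolding alternating_def
proof (intro allI impI)
  fix xs ys :: "'b list" and x y assume "length xs + length ys + 2 = k"
  then show "F (map e (xs @ x # y # ys)) = - F (map e (xs @ y # x # ys))"
    using alternatingD[OF assms, of "map e xs" "map e ys" "e x" "e y"] by simp
qed

context cayley
begin

text \<open>If a connection maps the Cayley frame \<open>e\<close> to \<open>w\<close>, then \<open>T\<close> and \<open>S\<close> are the resulting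
  derivatives of \<open>\<phi>\<close> and \<open>*\<phi>\<close>; both are determined by the one-form \<open>q\<close>, since
  \<open>so(7) = g\<^sub>2 \<oplus> \<real>\<^sup>7\<close>.\<close>

lemma skew_derivative:
  assumes skew: "\<And>i j. g [w i, e j] = - g [e i, w j]"
    and T: "multilinear 3 T" "\<And>i j k. T [e i, e j, e k] =
      - (\<phi> [w i, e j, e k] + \<phi> [e i, w j, e k] + \<phi> [e i, e j, w k])"
    and S: "multilinear 4 S" "\<And>i j k l. S [e i, e j, e k, e l] =
      - (star3 g \<phi> [w i, e j, e k, e l] + star3 g \<phi> [e i, w j, e k, e l]
         + star3 g \<phi> [e i, e j, w k, e l] + star3 g \<phi> [e i, e j, e k, w l])"
  obtains q where "linear q"
    and "\<And>a b c. T [a, b, c] = (\<Sum>l\<in>UNIV. q (e l) * star3 g \<phi> [e l, a, b, c])"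
    and "\<And>a b c d. S [a, b, c, d] = - (q a * \<phi> [b, c, d] - q b * \<phi> [a, c, d] + q c * \<phi> [a, b, d] - q d * \<phi> [a, b, c])"
proof -
  define M where "M i j = g [w i, e j]" for i j
  define Q where "Q l = M (l + 1) (l + 3) + M (l + 4) (l + 5) + M (l + 2) (l + 6)" for l
  define q where "q z = (\<Sum>l\<in>UNIV. g [z, e l] * Q l)" for z
  have M: "M j i = - M i j" for i j unfolding M_def using skew[of j i] g_sym[of "e j" "w i"] by simp
  have w: "w i = (\<Sum>m\<in>UNIV. M i m *\<^sub>R e m)" for i unfolding M_def by (rule expansion)
  have q_frame: "q (e l) = Q l" for l
    by (simp add: q_def g_frame if_distrib[of "\<lambda>x. x * _"] cong: if_cong)
  have q: "linear q" unfolding q_def by (intro linearI) (simp_all add: g_simps algebra_simps sum.distrib sum_distrib_left)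
  have T_frame: "T [e i, e j, e k] = - ((\<Sum>m\<in>UNIV. M i m * phi0 m j k) + (\<Sum>m\<in>UNIV. M j m * phi0 i m k)
      + (\<Sum>m\<in>UNIV. M k m * phi0 i j m))" for i j k
    unfolding T(2) w by (simp add: \<phi>_simps \<phi>_frame)
  have S_frame: "S [e i, e j, e k, e l] = - ((\<Sum>m\<in>UNIV. M i m * star0 m j k l) + (\<Sum>m\<in>UNIV. M j m * star0 i m k l)
      + (\<Sum>m\<in>UNIV. M k m * star0 i j m l) + (\<Sum>m\<in>UNIV. M l m * star0 i j k m))" for i j k l
    unfolding S(2) w by (simp add: star_simps star_frame)
  let ?T = "\<lambda>xs. \<Sum>l\<in>UNIV. Q l * star3 g \<phi> (e l # xs)"
  let ?S = "\<lambda>xs. - (q (xs ! 0) * \<phi> [xs ! 1, xs ! 2, xs ! 3] - q (xs ! 1) * \<phi> [xs ! 0, xs ! 2, xs ! 3]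
      + q (xs ! 2) * \<phi> [xs ! 0, xs ! 1, xs ! 3] - q (xs ! 3) * \<phi> [xs ! 0, xs ! 1, xs ! 2])"
  have star_Cons: "alternating 3 (\<lambda>xs. star3 g \<phi> (x # xs))" "multilinear 3 (\<lambda>xs. star3 g \<phi> (x # xs))" for x
    using alternating_Cons[of 3 "star3 g \<phi>"] multilinear_Cons[of 3 "star3 g \<phi>"] star_alternating star_multilinear
    by simp_all
  have T_ml: "multilinear 3 (\<lambda>xs. T xs - ?T xs)"
  proof -
    have "multilinear 3 ?T" by (intro multilinear_sum multilinear_scale star_Cons)
    then show ?thesis using T(1) unfolding multilinear_def by (auto intro: linear_compose_sub)
  qed
  have S_ml: "multilinear 4 (\<lambda>xs. S xs - ?S xs)"
  proof -
    have "multilinear 4 ?S"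
      by (rule multilinear_4I; rule linearI)
        (simp_all add: linear_add[OF q] linear_scale[OF q] \<phi>_simps algebra_simps)
    then show ?thesis using S(1) unfolding multilinear_def by (auto intro: linear_compose_sub)
  qed
  \<comment> \<open>\<open>T\<close> is specified only on frame vectors, so alternation is shown for
    lists of indices. Accordingly \<open>alternating_zero_if_sorted\<close> is later used with
    \<open>id\<close> in place of a frame.\<close>
  have T_alt: "alternating 3 (\<lambda>is. T (map e is))"
  proof (rule alternating_3I)
    fix i j k
    show "T (map e [j, i, k]) = - T (map e [i, j, k])"
      using \<phi>_alt(1)[of "w j" "e i" "e k"] \<phi>_alt(1)[of "e j" "w i" "e k"] \<phi>_alt(1)[of "e j" "e i" "w k"] by (simp add: T(2))
    show "T (map e [i, k, j]) = - T (map e [i, j, k])"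
      using \<phi>_alt(2)[of "w i" "e k" "e j"] \<phi>_alt(2)[of "e i" "w k" "e j"] \<phi>_alt(2)[of "e i" "e k" "w j"] by (simp add: T(2))
  qed
  have S_alt: "alternating 4 (\<lambda>is. S (map e is))"
  proof (rule alternating_4I)
    fix i j k l
    note a = alternating_4D[OF star_alternating]
    show "S (map e [j, i, k, l]) = - S (map e [i, j, k, l])"
      using a(1)[of "w j" "e i" "e k" "e l"] a(1)[of "e j" "w i" "e k" "e l"] a(1)[of "e j" "e i" "w k" "e l"]
        a(1)[of "e j" "e i" "e k" "w l"] by (simp add: S(2))
    show "S (map e [i, k, j, l]) = - S (map e [i, j, k, l])"
      using a(2)[of "w i" "e k" "e j" "e l"] a(2)[of "e i" "w k" "e j" "e l"] a(2)[of "e i" "e k" "w j" "e l"]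
        a(2)[of "e i" "e k" "e j" "w l"] by (simp add: S(2))
    show "S (map e [i, j, l, k]) = - S (map e [i, j, k, l])"
      using a(3)[of "w i" "e j" "e l" "e k"] a(3)[of "e i" "w j" "e l" "e k"] a(3)[of "e i" "e j" "w l" "e k"]
        a(3)[of "e i" "e j" "e l" "w k"] by (simp add: S(2))
  qed
  have "alternating 3 ?T" by (intro alternating_sum alternating_scale star_Cons)
  then have T_diff_alt: "alternating 3 (\<lambda>is. T (map e is) - ?T (map e is))"
    by (intro alternating_diff[OF T_alt] alternating_map)
  have "alternating 4 ?S"
  proof (rule alternating_4I)
    fix x y z v
    show "?S [y, x, z, v] = - ?S [x, y, z, v]"
      by (simp add: \<phi>_alt(1)[of y x])
    show "?S [x, z, y, v] = - ?S [x, y, z, v]"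
      by (simp add: \<phi>_alt(1)[of z y] \<phi>_alt(2)[of _ z y])
    show "?S [x, y, v, z] = - ?S [x, y, z, v]"
      by (simp add: \<phi>_alt(2)[of _ v z])
  qed
  then have S_diff_alt: "alternating 4 (\<lambda>is. S (map e is) - ?S (map e is))"
    by (intro alternating_diff[OF S_alt] alternating_map)
  have T_zero: "T (map e is) - ?T (map e is) = 0" if "length is = 3" for "is"
  proof -
    have "T (map e js) - ?T (map e js) = 0" if js: "length js = 3" "sorted_wrt (<) js" for js
    proof -
      obtain i j k where "js = [i, j, k]" using js(1) by (auto simp: eval_nat_numeral length_Suc_conv)
      then show ?thesis
        using derivation_phi0[OF M Q_def, of i j k] js(2) by (simp add: T_frame star_frame)
    qed
    then show ?thesis using alternating_zero_if_sorted[OF T_diff_alt, of id "is"] that by simp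
  qed
  have S_zero: "S (map e is) - ?S (map e is) = 0" if "length is = 4" for "is"
  proof -
    have "S (map e js) - ?S (map e js) = 0" if js: "length js = 4" "sorted_wrt (<) js" for js
    proof -
      obtain i j k l where "js = [i, j, k, l]" using js(1) by (auto simp: eval_nat_numeral length_Suc_conv)
      then show ?thesis
        using derivation_star0[OF M Q_def, of i j k l] js(2) by (simp add: S_frame q_frame \<phi>_frame)
    qed
    then show ?thesis using alternating_zero_if_sorted[OF S_diff_alt, of id "is"] that by simp
  qed
  show thesis
  proof (rule that[OF q])
    show "T [a, b, c] = (\<Sum>l\<in>UNIV. q (e l) * star3 g \<phi> [e l, a, b, c])" for a b c
      using multilinear_extensionality[OF orthonormal g_multilinear T_ml T_zero, of "[a, b, c]"] by (simp add: q_frame)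
    show "S [a, b, c, d] = - (q a * \<phi> [b, c, d] - q b * \<phi> [a, c, d] + q c * \<phi> [a, b, d] - q d * \<phi> [a, b, c])" for a b c d
      using multilinear_extensionality[OF orthonormal g_multilinear S_ml S_zero, of "[a, b, c, d]"]
      by (simp add: numeral_2_eq_2 numeral_3_eq_3)
  qed
qed

end


section \<open>Adapted Cayley frames\<close>

context cayley
begin

lemma g_pos: "x \<noteq> 0 \<Longrightarrow> 0 < g [x, x]"
proof -
  assume "x \<noteq> 0"
  have "\<exists>i. g [x, e i] \<noteq> 0"
  proof (rule ccontr)
    assume "\<not> ?thesis"
    then have "(\<Sum>i\<in>UNIV. g [x, e i] *\<^sub>R e i) = 0" by simp
    then show False using expansion[of x] \<open>x \<noteq> 0\<close> by simp
  qed
  then obtain i where "g [x, e i] \<noteq> 0" by blast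
  then have "0 < (\<Sum>i\<in>UNIV. g [x, e i] * g [x, e i])"
    by (intro sum_pos2[of UNIV i]) (auto simp: zero_less_mult_iff linorder_neq_iff)
  then show ?thesis using g_parseval[of x x] by simp
qed

lemma g_eqI: "(\<And>z. g [x, z] = g [y, z]) \<Longrightarrow> x = y"
  using expansion[of x] expansion[of y] by simp

text \<open>Three linear conditions leave a nonzero solution in dimension seven. \<open>h\<close>
  represents \<open>g\<close> by the Euclidean inner product, in which orthogonality is then
  sought.\<close>

lemma exists_unit_orthogonal: "\<exists>x. g [x, x] = 1 \<and> g [a, x] = 0 \<and> g [b, x] = 0 \<and> g [c, x] = 0"
proof -
  define h where "h a = (\<chi> i. g [a, axis i 1])" for a
  have h: "h a \<bullet> x = g [a, x]" for a x
  proof -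
    have "g [a, x] = g [a, \<Sum>i\<in>UNIV. x $ i *\<^sub>R axis i 1]" using basis_expansion[of x] by (simp add: scalar_mult_eq_scaleR)
    then show ?thesis by (simp add: g_simps h_def inner_vec_def mult.commute)
  qed
  have h': "x \<bullet> h a = g [a, x]" for a x by (subst inner_commute) (rule h)
  have "dim {h a, h b, h c} \<le> card {h a, h b, h c}" by (rule dim_le_card') simp
  also have "\<dots> \<le> 3" by (simp add: card_insert_if)
  finally have "dim {h a, h b, h c} < DIM(real^7)" by simp
  then obtain x where x: "x \<noteq> 0" "\<And>y. y \<in> span {h a, h b, h c} \<Longrightarrow> orthogonal x y"
    using orthogonal_to_subspace_exists[of "{h a, h b, h c}"] by blast
  have "g [a, x] = 0" "g [b, x] = 0" "g [c, x] = 0"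
    using x(2)[OF span_base, of "h a"] x(2)[OF span_base, of "h b"] x(2)[OF span_base, of "h c"]
    by (simp_all add: orthogonal_def h')
  then show ?thesis using g_pos[OF x(1)]
    by (intro exI[of _ "(1 / sqrt (g [x, x])) *\<^sub>R x"]) (simp add: g_simps real_div_sqrt)
qed

section \<open>The cross product and Cayley frames through a given unit vector\<close>

definition cross :: "real^7 \<Rightarrow> real^7 \<Rightarrow> real^7" where
  "cross x y = (\<Sum>k\<in>UNIV. \<phi> [x, y, e k] *\<^sub>R e k)"

lemma g_cross: "g [cross x y, z] = \<phi> [x, y, z]"
proof -
  have "g [cross x y, z] = (\<Sum>k\<in>UNIV. g [z, e k] * \<phi> [x, y, e k])"
    by (simp add: cross_def g_simps g_sym[of "e _" z] mult.commute)
  then show ?thesis using linear_frame_sum[OF lin_\<phi>(3)] by simp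
qed

lemma cross_simps:
  "cross y x = - cross x y" "cross (x + x') y = cross x y + cross x' y" "cross x (y + y') = cross x y + cross x y'"
  "cross (- x) y = - cross x y" "cross x (- y) = - cross x y"
  by (rule g_eqI; simp add: g_simps g_cross \<phi>_simps \<phi>_alt(1)[of y x])+

lemma cross_cross: "cross x (cross x y) = g [x, y] *\<^sub>R x - g [x, x] *\<^sub>R y"
proof (rule g_eqI)
  fix z
  have "g [cross x (cross x y), z] = - \<phi> [x, z, cross x y]"
    using \<phi>_alt(2)[of x z "cross x y"] by (simp add: g_cross)
  also have "\<phi> [x, z, cross x y] = (\<Sum>k\<in>UNIV. \<phi> [x, y, e k] * \<phi> [x, z, e k])"
    by (simp add: cross_def \<phi>_simps)
  finally show "g [cross x (cross x y), z] = g [g [x, y] *\<^sub>R x - g [x, x] *\<^sub>R y, z]"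
    by (simp add: \<phi>_square g_simps)
qed

text \<open>\<open>cross_cross\<close> for \<open>x + y\<close>, compared with the cases
  \<open>x\<close> and \<open>y\<close>.\<close>

lemma cross_cross_swap:
  assumes "g [x, y] = 0" "g [x, z] = 0" "g [y, z] = 0"
  shows "cross x (cross y z) = - cross y (cross x z)"
  using cross_cross[of "x + y" z] cross_cross[of x z] cross_cross[of y z] assms g_sym[of y x]
  by (simp add: cross_simps(2,3) g_simps algebra_simps eq_neg_iff_add_eq_0)

text \<open>G_2 acts transitively on unit vectors. Concretely, \<open>n\<close>, a unit vector
  orthogonal to it and a third one orthogonal to both and to their cross product determine the
  remaining four vectors as cross products along the lines of the Fano plane.\<close>

lemma exists_adapted_frame:
  assumes "g [n, n] = 1"
  obtains e' where "cayley g \<phi> e'" "e' 0 = n"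
proof -
  obtain f1 where f1: "g [f1, f1] = 1" "g [n, f1] = 0" using exists_unit_orthogonal by blast
  define f3 where "f3 = cross n f1"
  \<comment> \<open>The vectors \<open>n\<close>, \<open>f1\<close>, \<open>f3\<close> span a
    subspace closed under the cross product; the next generator must be orthogonal to it.\<close>
  obtain f2 where f2: "g [f2, f2] = 1" "g [n, f2] = 0" "g [f1, f2] = 0" "g [f3, f2] = 0"
    using exists_unit_orthogonal[of n f1 f3] by blast
  \<comment> \<open>With \<open>f3\<close> these definitions realise four of the seven lines. The
    other three, through {3, 4, 6}, {4, 5, 0} and {5, 6, 1}, are derived below as
    \<open>c34\<close>, \<open>c45\<close> and \<open>c15\<close>.\<close>
  define f4 f5 f6 where "f4 = cross f1 f2" and "f5 = cross f2 f3" and "f6 = cross n f2"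
  have cc: "cross x (cross x y) = - y" if "g [x, x] = 1" "g [x, y] = 0" for x y
    using cross_cross[of x y] that by simp
  have anti: "cross y x = - cross x y" for x y by (rule cross_simps)
  have perp: "g [x, cross x y] = 0" "g [y, cross x y] = 0" for x y
    using g_cross[of x y x] g_cross[of x y y] by (simp_all add: g_sym[of _ "cross x y"] \<phi>_repeat)
  have unit: "g [cross x y, cross x y] = 1" if "g [x, x] = 1" "g [y, y] = 1" "g [x, y] = 0" for x y
  proof -
    have "g [cross x y, cross x y] = (\<Sum>k\<in>UNIV. \<phi> [x, y, e k] * \<phi> [x, y, e k])"
      by (subst g_cross) (simp add: cross_def \<phi>_simps)
    then show ?thesis using \<phi>_square[of x y y] that by simp
  qed
  have neg: "cross (- x) y = - cross x y" "cross x (- y) = - cross x y" for x y by (rule cross_simps)+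
  have d: "cross n f1 = f3" "cross f1 f2 = f4" "cross f2 f3 = f5" "cross n f2 = f6"
    by (simp_all add: f3_def f4_def f5_def f6_def)
  have d': "cross f1 n = - f3" "cross f2 f1 = - f4" "cross f3 f2 = - f5" "cross f2 n = - f6"
    unfolding d[symmetric] by (rule anti)+
  have 3: "g [f3, f3] = 1" "g [n, f3] = 0" "g [f1, f3] = 0" "g [f2, f3] = 0"
    using unit[OF assms f1] perp(1)[of n f1] perp(2)[of f1 n] f2(4) by (simp_all add: d g_sym[of f2])
  have 4: "g [f4, f4] = 1" "g [f1, f4] = 0" "g [f2, f4] = 0"
    using unit[OF f1(1) f2(1,3)] perp(1)[of f1 f2] perp(2)[of f2 f1] by (simp_all add: d)
  have 5: "g [f5, f5] = 1" "g [f2, f5] = 0" "g [f3, f5] = 0"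
    using unit[OF f2(1) 3(1,4)] perp(1)[of f2 f3] perp(2)[of f3 f2] by (simp_all add: d)
  have 6: "g [f6, f6] = 1" "g [n, f6] = 0" "g [f2, f6] = 0"
    using unit[OF assms f2(1,2)] perp(1)[of n f2] perp(2)[of f2 n] by (simp_all add: d)
  have c03: "cross n f3 = - f1" using cc[OF assms f1(2)] by (simp add: d)
  have c13: "cross f1 f3 = n" using cc[OF f1(1), of n] f1(2) by (simp add: d' neg g_sym[of f1 n])
  have 04: "g [n, f4] = 0"
    using g_cross[of f1 f2 n] g_cross[of n f1 f2] \<phi>_cyclic[of f1 f2 n] f2(4) by (simp add: d g_sym[of n f4])
  have 34: "g [f3, f4] = 0"
    using g_cross[of f1 f2 f3] g_cross[of f1 f3 f2] \<phi>_alt(2)[of f1 f3 f2] c13 f2(2)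
    by (simp add: d g_sym[of f3 f4])
  have 05: "g [n, f5] = 0"
    using g_cross[of f2 f3 n] g_cross[of n f3 f2] \<phi>_cyclic[of f2 f3 n] \<phi>_alt(2)[of n f3 f2] c03 f2(3)
    by (simp add: d g_sym[of n f5] g_simps)
  have 15: "g [f1, f5] = 0"
    using g_cross[of f2 f3 f1] g_cross[of f1 f3 f2] \<phi>_cyclic[of f2 f3 f1] \<phi>_alt(2)[of f1 f3 f2] c13 f2(2)
    by (simp add: d g_sym[of f1 f5])
  have c14: "cross f1 f4 = - f2" using cc[OF f1(1) f2(3)] by (simp add: d)
  have c15: "cross f1 f5 = f6"
    using cross_cross_swap[of f1 f2 f3] f2(3) 3(3,4) by (simp add: c13 d d')
  have c16: "cross f1 f6 = - f5" using cc[OF f1(1) 15] by (simp add: c15)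
  have c04: "cross n f4 = f5"
    using cross_cross_swap[of n f1 f2] f1(2) f2(2,3) by (simp add: d c16)
  have c05: "cross n f5 = - f4"
    using cross_cross_swap[of n f2 f3] f2(2) 3(2,4) by (simp add: d d' c03 neg)
  have c24: "cross f2 f4 = f1"
    using cc[OF f2(1), of f1] f2(3) by (simp add: d' neg g_sym[of f2 f1])
  have c25: "cross f2 f5 = - f3" using cc[OF f2(1) 3(4)] by (simp add: d)
  have c34: "cross f3 f4 = f6"
    using cross_cross_swap[of f3 f1 f2] 3(3) f2(3,4) by (simp add: d d' c15 neg g_sym[of f3 f1])
  have c35: "cross f3 f5 = f2"
    using cc[OF 3(1), of f2] f2(4) by (simp add: d' neg)
  have 45: "g [f4, f5] = 0" using perp(2)[of f4 n] by (simp add: c04)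
  have 46: "g [f4, f6] = 0" using perp(2)[of f4 f3] by (simp add: c34)
  have 36: "g [f3, f6] = 0" using perp(1)[of f3 f4] by (simp add: c34)
  have 16: "g [f1, f6] = 0" using perp(1)[of f1 f5] by (simp add: c15)
  have 56: "g [f5, f6] = 0" using perp(2)[of f5 f1] by (simp add: c15)
  have c45: "cross f4 f5 = n"
    using cc[OF 4(1), of n] 04 anti[of f4 n] by (simp add: c04 neg g_sym[of f4 n])
  define e' :: "7 \<Rightarrow> real^7" where "e' i = (if i = 0 then n else if i = 1 then f1 else if i = 2 then f2 else
    if i = 3 then f3 else if i = 4 then f4 else if i = 5 then f5 else f6)" for i
  note e' = e'_def neq_numeral_7
  note inner = assms f1 f2 3 4 5 6 04 34 05 15 45 46 36 16 56
  note inner' = inner[THEN trans[OF g_sym]]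
  have on: "orthonormal_basis g e'"
    unfolding orthonormal_basis_def
  proof (intro allI)
    fix i j
    show "g [e' i, e' j] = (if i = j then 1 else 0)"
      using exhaust_7[of i] exhaust_7[of j] by (elim disjE; simp add: e' inner inner')
  qed
  have "\<phi> [x, y, z] = (\<Sum>i\<in>UNIV. wedge1 (map (\<lambda>j v. g [e' j, v]) [i, i + 1, i + 3]) [x, y, z])" (is "_ = ?W [x, y, z]") for x y z
  proof (rule alternating_eq_sorted[OF on g_multilinear \<phi>_alternating _ \<phi>_multilinear])
    show "alternating 3 ?W"
      by (intro alternating_sum) (use wedge1_alternating[of "map _ [_, _, _]"] in \<open>simp add: numeral_3_eq_3\<close>)
    show "multilinear 3 ?W"
      by (rule multilinear_3I; rule linearI) (simp_all add: wedge1_3 g_simps algebra_simps sum.distrib sum_subtractf sum_distrib_left)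
    fix js :: "7 list" assume js: "length js = 3" "sorted_wrt (<) js"
    then obtain i j k where ijk: "js = [i, j, k]" by (auto simp: eval_nat_numeral length_Suc_conv)
    have "\<phi> (map e' js) = phi0 i j k"
      using sorted_7_length_3[OF js] unfolding ijk
      by (simp only: insert_iff empty_iff list.inject simp_thms list.map g_cross[symmetric])
        (elim disjE conjE FalseE; simp add: e' eval_phi0 d c03 c13 c14 c15 c04 c05 c24 c25 c34 c35 c45 g_simps inner inner')
    then show "\<phi> (map e' js) = ?W (map e' js)"
      using sum_wedge1_frame[OF on, of i j k] by (simp add: ijk)
  qed simp
  then have "cayley_frame g \<phi> e'" using on unfolding cayley_frame_def by blast
  then have "cayley g \<phi> e'" by unfold_locales (use g_multilinear g_sym \<phi>_multilinear in auto)
  moreover have "e' 0 = n" by (simp add: e'_def)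
  ultimately show thesis by (rule that)
qed

end


section \<open>Calculus and linear algebra\<close>

lemma linear_axis_sum:
  fixes f :: "real^'n \<Rightarrow> 'b::real_vector"
  assumes "linear f" shows "f x = (\<Sum>j\<in>UNIV. x $ j *\<^sub>R f (axis j 1))"
proof -
  have "f x = f (\<Sum>j\<in>UNIV. x $ j *\<^sub>R axis j 1)"
    using basis_expansion[of x] by (simp add: scalar_mult_eq_scaleR)
  then show ?thesis by (simp add: linear_sum[OF assms] linear_scale[OF assms])
qed

text \<open>A product rule that only assumes differentiability of \<open>T\<close> for each fixed
  argument list; this is the form in which smoothness of tensor fields is defined.\<close>

lemma has_derivative_tensor:
  fixes T :: "'a::real_normed_vector \<Rightarrow> 'n::finite tensor"
  assumes S: "open S" "u \<in> S" and ml: "\<And>v. v \<in> S \<Longrightarrow> multilinear k (T v)"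
    and T: "\<And>ys. length ys = k \<Longrightarrow> ((\<lambda>v. T v ys) has_derivative DT ys) (at u)"
    and X: "\<And>i. i < k \<Longrightarrow> (X i has_derivative DX i) (at u)"
  shows "((\<lambda>v. T v (map (\<lambda>i. X i v) [0..<k])) has_derivative
     (\<lambda>h. DT (map (\<lambda>i. X i u) [0..<k]) h + (\<Sum>i<k. T u ((map (\<lambda>i. X i u) [0..<k])[i := DX i h])))) (at u)"
proof -
  \<comment> \<open>The first \<open>m\<close> slots move and the others are frozen at
    \<open>c\<close>, so the induction releases one slot at a time.\<close>
  define L where "L m c v = map (\<lambda>i. if i < m then X i v else c i) [0..<k]" for m c v
  have "((\<lambda>v. T v (L m c v)) has_derivative
      (\<lambda>h. DT (L m c u) h + (\<Sum>i<m. T u ((L m c u)[i := DX i h])))) (at u)" if "m \<le> k" for m c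
    using that
  proof (induction m arbitrary: c)
    case 0
    then show ?case using T[of "map c [0..<k]"] by (simp add: L_def)
  next
    case (Suc m)
    then have m: "m < k" by simp
    have len: "length (L m c v) = k" for m c v by (simp add: L_def)
    have upd: "L (Suc m) c v = (L m (c(m := z)) v)[m := X m v]" for v z
      using m by (intro nth_equalityI) (auto simp: L_def nth_list_update less_Suc_eq)
    have upd': "(L m (c(m := z)) v)[m := z'] = L m (c(m := z')) v" for v z z'
      using m by (intro nth_equalityI) (auto simp: L_def nth_list_update)
    have updS: "(L (Suc m) c v)[m := z] = L m (c(m := z)) v" for v z
      by (subst upd[of v z]) (simp add: upd')
    let ?a = "\<lambda>v. T v (L m (c(m := X m u)) v)"
    \<comment> \<open>The increment of slot \<open>m\<close> is written in the standard basis. Its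
      coefficients vanish at \<open>u\<close>, so the derivative of the other factor does not
      contribute.\<close>
    let ?b = "\<lambda>j v. (X m v $ j - X m u $ j) * T v (L m (c(m := axis j 1)) v)"
    have eq: "T v (L (Suc m) c v) = ?a v + (\<Sum>j\<in>UNIV. ?b j v)" if "v \<in> S" for v
    proof -
      have lin: "linear (\<lambda>z. T v ((L m c v)[m := z]))"
        by (rule multilinear_linear_update[OF ml[OF that] len m])
      have upd0: "(L m c v)[m := z] = L m (c(m := z)) v" for z
        using upd'[of "c m" v z] by simp
      have "T v (L (Suc m) c v) = T v ((L m c v)[m := X m u + (X m v - X m u)])"
        using upd[of v "c m"] by simp
      also have "\<dots> = T v ((L m c v)[m := X m u]) + T v ((L m c v)[m := X m v - X m u])"
        by (rule linear_add[OF lin])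
      also have "T v ((L m c v)[m := X m v - X m u]) = (\<Sum>j\<in>UNIV. ?b j v)"
        by (subst linear_axis_sum[OF lin]) (simp add: upd0)
      finally show ?thesis by (simp add: upd0)
    qed
    have Xj: "((\<lambda>v. X m v $ j) has_derivative (\<lambda>h. DX m h $ j)) (at u)" for j
      using bounded_linear.has_derivative[OF bounded_linear_vec_nth X[OF m]] .
    have b: "(?b j has_derivative (\<lambda>h. DX m h $ j * T u (L m (c(m := axis j 1)) u))) (at u)" for j
    proof -
      have "(?b j has_derivative (\<lambda>h. (X m u $ j - X m u $ j) *
          (DT (L m (c(m := axis j 1)) u) h + (\<Sum>i<m. T u ((L m (c(m := axis j 1)) u)[i := DX i h])))
          + (DX m h $ j - 0) * T u (L m (c(m := axis j 1)) u))) (at u)"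
        using Suc.prems by (intro has_derivative_mult has_derivative_diff Xj has_derivative_const Suc.IH) simp
      then show ?thesis by simp
    qed
    have "((\<lambda>v. ?a v + (\<Sum>j\<in>UNIV. ?b j v)) has_derivative
       (\<lambda>h. (DT (L m (c(m := X m u)) u) h + (\<Sum>i<m. T u ((L m (c(m := X m u)) u)[i := DX i h])))
         + (\<Sum>j\<in>UNIV. DX m h $ j * T u (L m (c(m := axis j 1)) u)))) (at u)"
      using Suc.prems by (intro has_derivative_add has_derivative_sum b Suc.IH) simp
    moreover have "(\<Sum>j\<in>UNIV. DX m h $ j * T u (L m (c(m := axis j 1)) u)) =
        T u ((L (Suc m) c u)[m := DX m h])" for h
      using linear_axis_sum[OF multilinear_linear_update[OF ml[OF S(2)] len m], of "Suc m" c u "DX m h"]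
      by (simp add: updS)
    moreover have "L m (c(m := X m u)) u = L (Suc m) c u"
      using m by (intro nth_equalityI) (auto simp: L_def less_Suc_eq)
    ultimately have "((\<lambda>v. ?a v + (\<Sum>j\<in>UNIV. ?b j v)) has_derivative
       (\<lambda>h. DT (L (Suc m) c u) h + (\<Sum>i<Suc m. T u ((L (Suc m) c u)[i := DX i h])))) (at u)"
      by (simp add: add.assoc)
    then show ?case
      by (rule has_derivative_transform_within_open[OF _ S]) (simp add: eq)
  qed
  from this[of k undefined] have "((\<lambda>v. T v (L k undefined v)) has_derivative
      (\<lambda>h. DT (L k undefined u) h + (\<Sum>i<k. T u ((L k undefined u)[i := DX i h])))) (at u)" by simp
  moreover have "L k undefined v = map (\<lambda>i. X i v) [0..<k]" for v by (simp add: L_def)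
  ultimately show ?thesis by simp
qed

text \<open>The mean value theorem twice: first for the difference of \<open>f\<close> along two
  parallel segments in direction \<open>x\<close>, then in direction \<open>y\<close>.\<close>

lemma second_difference:
  fixes f :: "'a::real_normed_vector \<Rightarrow> real"
  assumes "0 < t" and S: "\<And>s r. 0 \<le> s \<Longrightarrow> s \<le> t \<Longrightarrow> 0 \<le> r \<Longrightarrow> r \<le> t \<Longrightarrow> u + s *\<^sub>R x + r *\<^sub>R y \<in> S"
    and f: "\<And>w. w \<in> S \<Longrightarrow> (f has_derivative f' w) (at w)"
    and f': "\<And>w. w \<in> S \<Longrightarrow> ((\<lambda>w. f' w x) has_derivative f'' w) (at w)"
  obtains s r where "0 < s" "s < t" "0 < r" "r < t"
    "f (u + t *\<^sub>R x + t *\<^sub>R y) - f (u + t *\<^sub>R x) - f (u + t *\<^sub>R y) + f u = t * t * f'' (u + s *\<^sub>R x + r *\<^sub>R y) y"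
proof -
  have *: "((\<lambda>s. u + s *\<^sub>R x + r *\<^sub>R y) has_derivative (\<lambda>h. h *\<^sub>R x)) (at s)" for s r
    by (auto intro!: derivative_eq_intros)
  have 1: "((\<lambda>s. f (u + s *\<^sub>R x + r *\<^sub>R y)) has_real_derivative f' (u + s *\<^sub>R x + r *\<^sub>R y) x) (at s)"
    if "0 \<le> s" "s \<le> t" "0 \<le> r" "r \<le> t" for s r
    using has_derivative_compose[OF * f[OF S[OF that]]] linear_scale[OF has_derivative_linear[OF f[OF S[OF that]]]]
    by (simp add: has_field_derivative_def mult_commute_abs)
  have "((\<lambda>s. f (u + s *\<^sub>R x + t *\<^sub>R y) - f (u + s *\<^sub>R x + 0 *\<^sub>R y)) has_real_derivative
      f' (u + s *\<^sub>R x + t *\<^sub>R y) x - f' (u + s *\<^sub>R x + 0 *\<^sub>R y) x) (at s)" if "0 \<le> s" "s \<le> t" for s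
    using that assms(1) by (intro DERIV_diff 1) auto
  from MVT2[OF assms(1) this] obtain s where s: "0 < s" "s < t"
    "f (u + t *\<^sub>R x + t *\<^sub>R y) - f (u + t *\<^sub>R x) - (f (u + t *\<^sub>R y) - f u) =
      t * (f' (u + s *\<^sub>R x + t *\<^sub>R y) x - f' (u + s *\<^sub>R x) x)" by auto
  have **: "((\<lambda>r. u + s *\<^sub>R x + r *\<^sub>R y) has_derivative (\<lambda>h. h *\<^sub>R y)) (at r)" for r
    by (auto intro!: derivative_eq_intros)
  have "((\<lambda>r. f' (u + s *\<^sub>R x + r *\<^sub>R y) x) has_real_derivative f'' (u + s *\<^sub>R x + r *\<^sub>R y) y) (at r)"
    if r: "0 \<le> r" "r \<le> t" for r
  proof -
    have i: "u + s *\<^sub>R x + r *\<^sub>R y \<in> S" using s r by (intro S) auto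
    show ?thesis
      using has_derivative_compose[OF ** f'[OF i]] linear_scale[OF has_derivative_linear[OF f'[OF i]]]
      by (simp add: has_field_derivative_def mult_commute_abs)
  qed
  from MVT2[OF assms(1) this] obtain r where "0 < r" "r < t"
    "f' (u + s *\<^sub>R x + t *\<^sub>R y) x - f' (u + s *\<^sub>R x) x = t * f'' (u + s *\<^sub>R x + r *\<^sub>R y) y" by auto
  with s show thesis by (intro that[of s r]) (auto simp: algebra_simps)
qed

text \<open>The second difference is symmetric in \<open>x\<close> and \<open>y\<close>, so the two
  mixed derivatives agree at a pair of points arbitrarily near \<open>u\<close>; continuity forbids
  different values at \<open>u\<close>.\<close>

lemma second_derivative_symmetric_real:
  fixes f :: "'a::real_normed_vector \<Rightarrow> real"
  assumes S: "open S" "u \<in> S"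
    and f: "\<And>w. w \<in> S \<Longrightarrow> (f has_derivative f' w) (at w)"
    and f': "\<And>w v. w \<in> S \<Longrightarrow> ((\<lambda>w. f' w v) has_derivative f'' v w) (at w)"
    and cont: "\<And>v z. continuous_on S (\<lambda>w. f'' v w z)"
  shows "f'' x u y = f'' y u x"
proof (rule ccontr)
  assume ne: "f'' x u y \<noteq> f'' y u x"
  \<comment> \<open>Half the gap: two errors below \<epsilon> cannot bridge it.\<close>
  define \<epsilon> where "\<epsilon> = \<bar>f'' x u y - f'' y u x\<bar> / 2"
  have \<epsilon>: "0 < \<epsilon>" using ne by (simp add: \<epsilon>_def)
  obtain \<delta>1 where \<delta>1: "0 < \<delta>1" "\<And>w. w \<in> S \<Longrightarrow> dist w u < \<delta>1 \<Longrightarrow> dist (f'' x w y) (f'' x u y) < \<epsilon>"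
    using cont[of x y] S(2) \<epsilon> unfolding continuous_on_iff by metis
  obtain \<delta>2 where \<delta>2: "0 < \<delta>2" "\<And>w. w \<in> S \<Longrightarrow> dist w u < \<delta>2 \<Longrightarrow> dist (f'' y w x) (f'' y u x) < \<epsilon>"
    using cont[of y x] S(2) \<epsilon> unfolding continuous_on_iff by metis
  obtain \<delta>3 where \<delta>3: "0 < \<delta>3" "\<And>w. dist w u < \<delta>3 \<Longrightarrow> w \<in> S"
    using S unfolding open_dist by metis
  define \<delta> where "\<delta> = min \<delta>1 (min \<delta>2 \<delta>3)"
  define t where "t = \<delta> / (norm x + norm y + 1)"
  have \<delta>: "0 < \<delta>" using \<delta>1(1) \<delta>2(1) \<delta>3(1) by (simp add: \<delta>_def)
  have np: "0 < norm x + norm y + 1" using norm_ge_zero[of x] norm_ge_zero[of y] by linarith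
  then have t: "0 < t" using \<delta> by (simp add: t_def)
  have near: "dist (u + s *\<^sub>R x + r *\<^sub>R y) u < \<delta>" if "0 \<le> s" "s \<le> t" "0 \<le> r" "r \<le> t" for s r
  proof -
    have "dist (u + s *\<^sub>R x + r *\<^sub>R y) u = norm (s *\<^sub>R x + r *\<^sub>R y)" by (simp add: dist_norm add.assoc)
    also have "\<dots> \<le> s * norm x + r * norm y"
      using norm_triangle_ineq[of "s *\<^sub>R x" "r *\<^sub>R y"] that by simp
    also have "\<dots> \<le> t * norm x + t * norm y" using that by (intro add_mono mult_right_mono) auto
    also have "\<dots> < t * (norm x + norm y + 1)" using t by (simp add: algebra_simps)
    also have "\<dots> = \<delta>" using np by (simp add: t_def)
    finally show ?thesis .
  qed
  have in_S: "u + s *\<^sub>R x + r *\<^sub>R y \<in> S" if "0 \<le> s" "s \<le> t" "0 \<le> r" "r \<le> t" for s r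
    using \<delta>3(2) near[OF that] by (simp add: \<delta>_def)
  have in_S': "u + r *\<^sub>R y + s *\<^sub>R x \<in> S" if "0 \<le> r" "r \<le> t" "0 \<le> s" "s \<le> t" for s r
    using in_S[OF that(3,4,1,2)] by (simp add: add_ac)
  obtain s r where 1: "0 < s" "s < t" "0 < r" "r < t"
    "f (u + t *\<^sub>R x + t *\<^sub>R y) - f (u + t *\<^sub>R x) - f (u + t *\<^sub>R y) + f u = t * t * f'' x (u + s *\<^sub>R x + r *\<^sub>R y) y"
    by (rule second_difference[where S = S and u = u and x = x and y = y and t = t and f = f and f' = f' and f'' = "f'' x", OF t in_S f f'])
  obtain r' s' where 2: "0 < r'" "r' < t" "0 < s'" "s' < t"
    "f (u + t *\<^sub>R y + t *\<^sub>R x) - f (u + t *\<^sub>R y) - f (u + t *\<^sub>R x) + f u = t * t * f'' y (u + r' *\<^sub>R y + s' *\<^sub>R x) x"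
    by (rule second_difference[where S = S and u = u and x = y and y = x and t = t and f = f and f' = f' and f'' = "f'' y", OF t in_S' f f'])
  have "t * t * f'' x (u + s *\<^sub>R x + r *\<^sub>R y) y = t * t * f'' y (u + r' *\<^sub>R y + s' *\<^sub>R x) x"
  proof -
    have c: "u + t *\<^sub>R y + t *\<^sub>R x = u + t *\<^sub>R x + t *\<^sub>R y" by (simp add: algebra_simps)
    show ?thesis using 1(5) 2(5) unfolding c by linarith
  qed
  then have "f'' x (u + s *\<^sub>R x + r *\<^sub>R y) y = f'' y (u + s' *\<^sub>R x + r' *\<^sub>R y) x"
    using t by (simp add: add_ac)
  moreover have "dist (f'' x (u + s *\<^sub>R x + r *\<^sub>R y) y) (f'' x u y) < \<epsilon>"
    using \<delta>1(2)[OF in_S] near[of s r] 1 by (simp add: \<delta>_def)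
  moreover have "dist (f'' y (u + s' *\<^sub>R x + r' *\<^sub>R y) x) (f'' y u x) < \<epsilon>"
    using \<delta>2(2)[OF in_S] near[of s' r'] 2 by (simp add: \<delta>_def)
  ultimately show False unfolding dist_real_def \<epsilon>_def by (smt (verit) field_sum_of_halves)
qed

section \<open>Smooth maps and their second derivatives\<close>

lemma smooth_on_Ck: "smooth_on S f \<Longrightarrow> Ck_on k S f"
  by (simp add: smooth_on_def)

lemma smooth_on_has_derivative:
  assumes "smooth_on S f" "x \<in> S" shows "(f has_derivative frechet_derivative f (at x)) (at x)"
  using smooth_on_Ck[OF assms(1), of 1] assms(2) by (simp add: frechet_derivative_works[symmetric])

lemma smooth_on_frechet_derivative:
  assumes "smooth_on S f" shows "smooth_on S (\<lambda>x. frechet_derivative f (at x) v)"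
  unfolding smooth_on_def using smooth_on_Ck[OF assms, of "Suc _"] by simp

text \<open>Applied below to the immersion in coordinates, where it gives the symmetry of the second
  fundamental form.\<close>

lemma second_derivative_symmetric:
  fixes f :: "'a::real_normed_vector \<Rightarrow> real^'m"
  assumes S: "open S" "u \<in> S" and f: "smooth_on S f"
  shows "frechet_derivative (\<lambda>w. frechet_derivative f (at w) y) (at u) x =
    frechet_derivative (\<lambda>w. frechet_derivative f (at w) x) (at u) y"
proof -
  let ?D = "\<lambda>w. frechet_derivative f (at w)"
  let ?DD = "\<lambda>v w. frechet_derivative (\<lambda>w. ?D w v) (at w)"
  have "?DD y u x $ i = ?DD x u y $ i" for i
  proof (rule second_derivative_symmetric_real[OF S, of "\<lambda>w. f w $ i" "\<lambda>w h. ?D w h $ i" "\<lambda>v w h. ?DD v w h $ i"])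
    show "((\<lambda>w. f w $ i) has_derivative (\<lambda>h. ?D w h $ i)) (at w)" if "w \<in> S" for w
      by (rule bounded_linear.has_derivative[OF bounded_linear_vec_nth smooth_on_has_derivative[OF f that]])
    show "((\<lambda>w. ?D w v $ i) has_derivative (\<lambda>h. ?DD v w h $ i)) (at w)" if "w \<in> S" for w v
      by (rule bounded_linear.has_derivative[OF bounded_linear_vec_nth
            smooth_on_has_derivative[OF smooth_on_frechet_derivative[OF f] that]])
    show "continuous_on S (\<lambda>w. ?DD v w z $ i)" for v z
      using smooth_on_Ck[OF smooth_on_frechet_derivative[OF smooth_on_frechet_derivative[OF f]], of 0 v z]
      by (intro continuous_on_component) simp
  qed
  then show ?thesis by (simp add: vec_eq_iff)
qed

section \<open>Solutions of linear systems, inner products and the Koszul formula\<close>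

lemma differentiable_prod:
  fixes f :: "'i \<Rightarrow> 'a::real_normed_vector \<Rightarrow> real"
  assumes "\<And>i. i \<in> A \<Longrightarrow> f i differentiable (at u)" shows "(\<lambda>v. \<Prod>i\<in>A. f i v) differentiable (at u)"
  using assms by (induction A rule: infinite_finite_induct) auto

lemma differentiable_det:
  fixes A :: "'a::real_normed_vector \<Rightarrow> real^'n^'n"
  assumes "\<And>i j. (\<lambda>v. A v $ i $ j) differentiable (at u)" shows "(\<lambda>v. det (A v)) differentiable (at u)"
  unfolding det_def
  by (intro differentiable_sum ballI differentiable_mult differentiable_const differentiable_prod assms)
     (simp add: finite_permutations)

lemma differentiable_vec:
  fixes f :: "'a::real_normed_vector \<Rightarrow> real^'n"
  assumes "\<And>i. (\<lambda>v. f v $ i) differentiable (at u)" shows "f differentiable (at u)"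
proof -
  have "(\<lambda>v. \<Sum>i\<in>UNIV. f v $ i *\<^sub>R axis i (1::real)) differentiable (at u)"
    by (intro differentiable_sum ballI differentiable_scaleR differentiable_const assms) simp
  moreover have "f v = (\<Sum>i\<in>UNIV. f v $ i *\<^sub>R axis i (1::real))" for v
    using basis_expansion[of "f v"] by (simp add: scalar_mult_eq_scaleR)
  ultimately show ?thesis by simp
qed

text \<open>By Cramer's rule the components of the solution are quotients of determinants. Only its
  defining equation is known of the solution, as for fields given by a definite description.\<close>

lemma linear_system_differentiable:
  fixes A :: "'a::real_normed_vector \<Rightarrow> real^'n^'n"
  assumes S: "open S" "u \<in> S" and A: "\<And>i j. (\<lambda>v. A v $ i $ j) differentiable (at u)" "det (A u) \<noteq> 0"
    and b: "\<And>i. (\<lambda>v. b v $ i) differentiable (at u)" and y: "\<And>v. v \<in> S \<Longrightarrow> A v *v y v = b v"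
  shows "y differentiable (at u)"
proof (rule differentiable_vec)
  fix k
  let ?N = "\<lambda>v. (\<chi> i j. if j = k then b v $ i else A v $ i $ j) :: real^'n^'n"
  have det: "(\<lambda>v. det (A v)) differentiable (at u)" by (rule differentiable_det[OF A(1)])
  then have "isCont (\<lambda>v. det (A v)) u" by (rule differentiable_imp_continuous_within)
  then have "\<forall>\<^sub>F v in at u. det (A v) \<noteq> 0" using A(2) by (intro tendsto_imp_eventually_ne) (auto simp: isCont_def)
  then have "\<forall>\<^sub>F v in nhds u. det (A v) \<noteq> 0" using A(2) by (auto simp: eventually_at_filter elim: eventually_mono)
  then obtain T where T: "open T" "u \<in> T" "\<And>v. v \<in> T \<Longrightarrow> det (A v) \<noteq> 0"
    unfolding eventually_nhds by blast
  have "(\<lambda>v. det (?N v)) differentiable (at u)"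
    by (rule differentiable_det) (case_tac "j = k", simp_all add: b A(1))
  then have "(\<lambda>v. det (?N v) / det (A v)) differentiable (at u)"
    using det A(2) by (rule differentiable_divide)
  then obtain D where D: "((\<lambda>v. det (?N v) / det (A v)) has_derivative D) (at u)"
    unfolding differentiable_def by blast
  have "((\<lambda>v. y v $ k) has_derivative D) (at u)"
  proof (rule has_derivative_transform_within_open[OF D, of "S \<inter> T"])
    show "det (?N v) / det (A v) = y v $ k" if "v \<in> S \<inter> T" for v
      using cramer[OF T(3), of v "y v" "b v"] y[of v] that by (simp add: vec_eq_iff)
  qed (use S T in auto)
  then show "(\<lambda>v. y v $ k) differentiable (at u)" unfolding differentiable_def by blast
qed

lemma inner_product_det:
  fixes g :: "'n::finite tensor"
  assumes g: "multilinear 2 g" and pos: "\<And>x. x \<noteq> 0 \<Longrightarrow> 0 < g [x, x]"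
  shows "det ((\<chi> i j. g [axis i 1, axis j 1]) :: real^'n^'n) \<noteq> 0"
proof -
  have "x = 0" if "(\<chi> i j. g [axis i 1, axis j 1]) *v x = 0" for x :: "real^'n"
  proof (rule ccontr)
    assume "x \<noteq> 0"
    have "g [axis i 1, x] = 0" for i
    proof -
      have "g [axis i 1, x] = (\<Sum>j\<in>UNIV. g [axis i 1, axis j 1] * x $ j)"
        by (subst linear_axis_sum[OF multilinear_2(2)[OF g]]) (simp add: mult.commute)
      also have "\<dots> = ((\<chi> i j. g [axis i 1, axis j 1]) *v x) $ i" by (simp add: matrix_vector_mult_def)
      finally show ?thesis using that by simp
    qed
    then have "g [x, x] = 0" by (subst linear_axis_sum[OF multilinear_2(1)[OF g]]) simp
    then show False using pos[OF \<open>x \<noteq> 0\<close>] by simp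
  qed
  then have "invertible ((\<chi> i j. g [axis i 1, axis j 1]) :: real^'n^'n)"
    using matrix_left_invertible_ker invertible_left_inverse by blast
  then show ?thesis by (simp add: invertible_det_nz)
qed

lemma riesz:
  fixes g :: "'n::finite tensor"
  assumes g: "multilinear 2 g" and pos: "\<And>x. x \<noteq> 0 \<Longrightarrow> 0 < g [x, x]" and L: "linear L"
  shows "\<exists>v. \<forall>z. g [v, z] = L z"
proof -
  let ?T = "\<lambda>v. (\<chi> i. g [v, axis i 1]) :: real^'n"
  note lin = multilinear_2[OF g]
  have T: "linear ?T" by (intro linearI) (simp_all add: vec_eq_iff linear_add[OF lin(1)] linear_scale[OF lin(1)])
  have z: "g [v, z] = (\<Sum>i\<in>UNIV. z $ i * ?T v $ i)" for v z
    by (subst linear_axis_sum[OF lin(2)]) simp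
  have "inj ?T"
    unfolding linear_injective_0[OF T]
  proof (intro allI impI)
    fix v assume "?T v = 0"
    then have "g [v, v] = 0" using z[of v v] by simp
    then show "v = 0" using pos[of v] by (cases "v = 0") auto
  qed
  then have "surj ?T" by (rule linear_inj_imp_surj[OF T])
  then obtain v where v: "(\<chi> i. L (axis i 1)) = ?T v" by (rule surjE)
  then have v: "g [v, axis i 1] = L (axis i 1)" for i by (simp add: vec_eq_iff)
  have "g [v, w] = L w" for w
    by (subst z, subst linear_axis_sum[OF L]) (simp add: v)
  then show ?thesis by blast
qed

lemma inner_product_eqI:
  assumes "multilinear 2 g" and "\<And>x. x \<noteq> 0 \<Longrightarrow> 0 < g [x, x]" and "\<And>z. g [v, z] = g [w, z]"
  shows "v = w"
proof -
  have "g [v - w, v - w] = 0" using assms(3) by (simp add: linear_diff[OF multilinear_2(1)[OF assms(1)]])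
  then show ?thesis using assms(2)[of "v - w"] by (cases "v = w") auto
qed

text \<open>\<open>D\<close> stands for the derivatives of the metric components, and
  \<open>?L\<close> gives the Christoffel symbols of the first kind. Coordinate fields commute, so
  the formula has no bracket terms.\<close>

lemma koszul:
  fixes g :: "'n::finite tensor" and D :: "real^'n \<Rightarrow> real^'n \<Rightarrow> real^'n \<Rightarrow> real"
  assumes g: "multilinear 2 g" "\<And>x y. g [x, y] = g [y, x]" "\<And>x. x \<noteq> 0 \<Longrightarrow> 0 < g [x, x]"
    and D: "\<And>y z. linear (\<lambda>x. D x y z)" "\<And>x z. linear (\<lambda>y. D x y z)" "\<And>x y z. D x y z = D x z y"
  shows "\<exists>!\<Gamma>. bilinear \<Gamma> \<and> (\<forall>x y. \<Gamma> x y = \<Gamma> y x) \<and> (\<forall>x y z. D x y z = g [\<Gamma> x y, z] + g [y, \<Gamma> x z])"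
proof -
  note lin = multilinear_2[OF g(1)]
  have D3: "linear (\<lambda>z. D x y z)" for x y using D(2)[of x y] by (simp add: D(3)[of x y])
  let ?L = "\<lambda>x y z. (D x y z + D y x z - D z x y) / 2"
  have "linear (?L x y)" for x y
    by (intro linearI) (simp_all add: linear_add[OF D3] linear_scale[OF D3] linear_add[OF D(1)] linear_scale[OF D(1)] field_simps)
  then have "\<forall>x y. \<exists>v. \<forall>z. g [v, z] = ?L x y z" using riesz[OF g(1,3)] by blast
  then obtain \<Gamma> where \<Gamma>: "\<And>x y z. g [\<Gamma> x y, z] = ?L x y z" by metis
  have eqI: "v = w" if "\<And>z. g [v, z] = g [w, z]" for v w
    by (rule inner_product_eqI[OF g(1,3) that])
  have "bilinear \<Gamma>" unfolding bilinear_def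
    by (intro conjI allI linearI eqI; simp add: linear_add[OF lin(1)] linear_scale[OF lin(1)] \<Gamma>
      linear_add[OF D(1)] linear_scale[OF D(1)] linear_add[OF D(2)] linear_scale[OF D(2)]
      linear_add[OF D3] linear_scale[OF D3] field_simps)
  moreover have "\<Gamma> x y = \<Gamma> y x" for x y
    by (rule eqI) (simp add: \<Gamma> D(3)[of _ x y])
  moreover have "D x y z = g [\<Gamma> x y, z] + g [y, \<Gamma> x z]" for x y z
    using g(2)[of y "\<Gamma> x z"] D(3)[of x z y] D(3)[of y z x] D(3)[of z y x] by (simp add: \<Gamma> field_simps)
  ultimately have ex: "bilinear \<Gamma> \<and> (\<forall>x y. \<Gamma> x y = \<Gamma> y x) \<and> (\<forall>x y z. D x y z = g [\<Gamma> x y, z] + g [y, \<Gamma> x z])" by blast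
  show ?thesis
  proof (rule ex1I[where a = \<Gamma>])
    show "bilinear \<Gamma> \<and> (\<forall>x y. \<Gamma> x y = \<Gamma> y x) \<and> (\<forall>x y z. D x y z = g [\<Gamma> x y, z] + g [y, \<Gamma> x z])"
      by (rule ex)
    fix \<Gamma>' assume \<Gamma>': "bilinear \<Gamma>' \<and> (\<forall>x y. \<Gamma>' x y = \<Gamma>' y x) \<and> (\<forall>x y z. D x y z = g [\<Gamma>' x y, z] + g [y, \<Gamma>' x z])"
    have G': "g [\<Gamma>' x y, z] = ?L x y z" for x y z
    proof -
      have "D x y z = g [\<Gamma>' x y, z] + g [\<Gamma>' x z, y]" for x y z using \<Gamma>' g(2) by metis
      moreover have "\<Gamma>' y x = \<Gamma>' x y" "\<Gamma>' z x = \<Gamma>' x z" "\<Gamma>' z y = \<Gamma>' y z" using \<Gamma>' by blast+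
      ultimately show ?thesis by simp
    qed
    show "\<Gamma>' = \<Gamma>" by (intro ext eqI) (simp add: G' \<Gamma>)
  qed
qed


section \<open>Atlases and connections\<close>

text \<open>The charts at source and target are free, so that coordinate changes and differentials
  are both instances and share one chain rule.\<close>

definition chart_deriv ::
    "('m, 'n::finite) atlas \<Rightarrow> ('l, 'k::finite) atlas \<Rightarrow> ('m \<Rightarrow> 'l) \<Rightarrow> 'm \<Rightarrow> 'l \<Rightarrow> 'm \<Rightarrow> real^'n \<Rightarrow> real^'k" where
  "chart_deriv A B f p r q = frechet_derivative (coord_at B r \<circ> f \<circ> param_at A p) (at (coord_at A p q))"

lemma coord_change_eq: "coord_change A p r q = chart_deriv A A (\<lambda>q. q) p r q"
  unfolding coord_change_def chart_deriv_def by (simp add: comp_def)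

lemma differential_eq: "differential A B f p = chart_deriv A B f p (f p) p"
  unfolding differential_def chart_deriv_def ..

locale atlas =
  fixes A :: "('m::topological_space, 'n::finite) atlas"
  assumes smooth_atlas: "smooth_atlas A"
begin

lemma chart_at: "(dom_at A p, coord_at A p) \<in> A" and mem_dom: "p \<in> dom_at A p"
proof -
  have "(\<Union>(U, \<kappa>)\<in>A. U) = UNIV" using smooth_atlas unfolding smooth_atlas_def by blast
  then have "p \<in> (\<Union>(U, \<kappa>)\<in>A. U)" by simp
  then obtain c where "c \<in> A" "p \<in> (case c of (U, \<kappa>) \<Rightarrow> U)" by (rule UN_E)
  then have "c \<in> A \<and> p \<in> fst c" by (simp add: case_prod_unfold)
  then have "chart_at A p \<in> A \<and> p \<in> fst (chart_at A p)"
    unfolding chart_at_def by (rule someI)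
  then show "(dom_at A p, coord_at A p) \<in> A" "p \<in> dom_at A p"
    by (simp_all add: dom_at_def coord_at_def)
qed

lemma open_dom: "open (dom_at A p)" and open_image: "open (coord_at A p ` dom_at A p)"
  and homeo: "homeomorphism (dom_at A p) (coord_at A p ` dom_at A p) (coord_at A p) (param_at A p)"
proof -
  have "\<forall>(U, \<kappa>)\<in>A. open U \<and> open (\<kappa> ` U) \<and> homeomorphism U (\<kappa> ` U) \<kappa> (inv_into U \<kappa>)"
    using smooth_atlas unfolding smooth_atlas_def by blast
  from bspec[OF this chart_at[of p]] show "open (dom_at A p)" "open (coord_at A p ` dom_at A p)"
    "homeomorphism (dom_at A p) (coord_at A p ` dom_at A p) (coord_at A p) (param_at A p)"
    by (simp_all add: param_at_def)
qed

lemma param_coord: "q \<in> dom_at A p \<Longrightarrow> param_at A p (coord_at A p q) = q"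
  using homeo unfolding homeomorphism_def by blast

lemma open_coord_image:
  assumes "open S" shows "open (coord_at A p ` (dom_at A p \<inter> S))"
proof -
  have "continuous_on (coord_at A p ` dom_at A p) (param_at A p)"
    using homeo unfolding homeomorphism_def by blast
  then have "open (coord_at A p ` dom_at A p \<inter> param_at A p -` S)"
    using open_image assms by (rule continuous_open_preimage)
  moreover have "coord_at A p ` (dom_at A p \<inter> S) = coord_at A p ` dom_at A p \<inter> param_at A p -` S"
    by (auto simp: param_coord)
  ultimately show ?thesis by simp
qed

lemma smooth_map_id: "smooth_map A A (\<lambda>q. q)"
  using smooth_atlas unfolding smooth_map_def smooth_atlas_def by (simp add: comp_def)

lemma coord_change_same:
  assumes "q \<in> dom_at A p" shows "coord_change A p p q y = y"
proof -
  have "((\<lambda>u. u) has_derivative (\<lambda>y. y)) (at (coord_at A p q))" by simp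
  then have "(coord_at A p \<circ> param_at A p has_derivative (\<lambda>y. y)) (at (coord_at A p q))"
    by (rule has_derivative_transform_within_open[OF _ open_image])
      (use assms in \<open>auto simp: param_coord\<close>)
  then show ?thesis unfolding coord_change_def using frechet_derivative_at by metis
qed

lemma tensor_in_chart_at: "tensor_in_chart A p b (coord_at A p p) xs = b p xs"
  using coord_change_same[OF mem_dom] by (simp add: tensor_in_chart_def Let_def param_coord mem_dom map_idI)

end

lemma smooth_map_chart:
  assumes "atlas A" "atlas B" "smooth_map A B f"
  shows "smooth_on (coord_at A p ` (dom_at A p \<inter> f -` dom_at B r)) (coord_at B r \<circ> f \<circ> param_at A p)"
proof -
  have "\<forall>(U, \<kappa>)\<in>A. \<forall>(V, \<mu>)\<in>B. smooth_on (\<kappa> ` (U \<inter> f -` V)) (\<mu> \<circ> f \<circ> inv_into U \<kappa>)"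
    using assms(3) unfolding smooth_map_def by blast
  from bspec[OF this atlas.chart_at[OF assms(1), of p]]
  have "\<forall>(V, \<mu>)\<in>B. smooth_on (coord_at A p ` (dom_at A p \<inter> f -` V)) (\<mu> \<circ> f \<circ> param_at A p)"
    by (simp add: param_at_def)
  from bspec[OF this atlas.chart_at[OF assms(2), of r]] show ?thesis by simp
qed

lemma open_chart_preimage:
  assumes "atlas A" "atlas B" "smooth_map A B f"
  shows "open (coord_at A p ` (dom_at A p \<inter> f -` dom_at B r))"
proof -
  have "open (f -` dom_at B r)"
    using assms(3) atlas.open_dom[OF assms(2)] unfolding smooth_map_def by (simp add: open_vimage)
  then show ?thesis by (rule atlas.open_coord_image[OF assms(1)])
qed

lemma chart_deriv:
  assumes "atlas A" "atlas B" "smooth_map A B f" "q \<in> dom_at A p" "f q \<in> dom_at B r"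
  shows "(coord_at B r \<circ> f \<circ> param_at A p has_derivative chart_deriv A B f p r q) (at (coord_at A p q))"
  unfolding chart_deriv_def
  by (rule smooth_on_has_derivative[OF smooth_map_chart[OF assms(1-3)]]) (use assms(4,5) in auto)

lemma chart_deriv_linear:
  assumes "atlas A" "atlas B" "smooth_map A B f" "q \<in> dom_at A p" "f q \<in> dom_at B r"
  shows "linear (chart_deriv A B f p r q)"
  by (rule has_derivative_linear[OF chart_deriv[OF assms]])

lemma chart_deriv_chain:
  assumes A: "atlas A" and B: "atlas B" and C: "atlas C" and f: "smooth_map A B f" and h: "smooth_map B C h"
    and q: "q \<in> dom_at A p" "f q \<in> dom_at B r" "h (f q) \<in> dom_at C s"
  shows "chart_deriv B C h r s (f q) (chart_deriv A B f p r q y) = chart_deriv A C (\<lambda>q. h (f q)) p s q y"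
proof -
  let ?u = "coord_at A p q"
  have F: "(coord_at B r \<circ> f \<circ> param_at A p) ?u = coord_at B r (f q)"
    using q(1) by (simp add: atlas.param_coord[OF A])
  have "((coord_at C s \<circ> h \<circ> param_at B r) \<circ> (coord_at B r \<circ> f \<circ> param_at A p) has_derivative
      chart_deriv B C h r s (f q) \<circ> chart_deriv A B f p r q) (at ?u)"
    by (rule diff_chain_at[OF chart_deriv[OF A B f q(1,2)]]) (simp add: F chart_deriv[OF B C h q(2,3)] del: comp_apply)
  then have "(coord_at C s \<circ> (\<lambda>q. h (f q)) \<circ> param_at A p has_derivative
      chart_deriv B C h r s (f q) \<circ> chart_deriv A B f p r q) (at ?u)"
    by (rule has_derivative_transform_within_open[OF _ open_chart_preimage[OF A B f]])
      (use q in \<open>auto simp: atlas.param_coord[OF A] atlas.param_coord[OF B]\<close>)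
  then have "chart_deriv A C (\<lambda>q. h (f q)) p s q = chart_deriv B C h r s (f q) \<circ> chart_deriv A B f p r q"
    unfolding chart_deriv_def[of A C] using frechet_derivative_at by metis
  then show ?thesis by simp
qed

context atlas
begin

lemma coord_change_linear:
  assumes "q \<in> dom_at A p" "q \<in> dom_at A r" shows "linear (coord_change A p r q)"
  unfolding coord_change_eq
  by (rule chart_deriv_linear[OF atlas_axioms atlas_axioms smooth_map_id]) (use assms in auto)

lemma coord_change_inverse:
  assumes "q \<in> dom_at A p" "q \<in> dom_at A r"
  shows "coord_change A p r q (coord_change A r p q y) = y"
proof -
  have "coord_change A p r q (coord_change A r p q y) = coord_change A r r q y"
    unfolding coord_change_eq
    using chart_deriv_chain[OF atlas_axioms atlas_axioms atlas_axioms smooth_map_id smooth_map_id, of q r p r y] assms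
    by simp
  then show ?thesis by (simp add: coord_change_same assms)
qed

lemma tensor_in_chart_multilinear:
  assumes "u \<in> coord_at A p ` dom_at A p" "\<And>q. multilinear k (b q)"
  shows "multilinear k (tensor_in_chart A p b u)"
proof -
  let ?q = "param_at A p u"
  have q: "?q \<in> dom_at A p" using assms(1) by (auto simp: param_coord)
  note lin = coord_change_linear[OF q mem_dom]
  show ?thesis
    unfolding multilinear_def
  proof (intro allI impI)
    fix xs :: "(real^'n) list" and i :: nat assume "length xs = k" "i < k"
    then have l: "linear (\<lambda>v. b ?q ((map (coord_change A p ?q ?q) xs)[i := v]))"
      by (intro multilinear_linear_update[OF assms(2)]) auto
    show "linear (\<lambda>v. tensor_in_chart A p b u (xs[i := v]))"
      using linear_compose[OF lin l] by (simp add: tensor_in_chart_def Let_def comp_def map_update)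
  qed
qed

lemma smooth_tensor_field_derivative:
  assumes "smooth_tensor_field A k b" "length ys = k" "u \<in> coord_at A p ` dom_at A p"
  shows "((\<lambda>u. tensor_in_chart A p b u ys) has_derivative frechet_derivative (\<lambda>u. tensor_in_chart A p b u ys) (at u)) (at u)"
  using assms unfolding smooth_tensor_field_def by (blast intro: smooth_on_has_derivative)

text \<open>\<open>F\<close> is a map in coordinates and the \<open>X i\<close> are vector fields along it. The coefficients \<open>\<Gamma>\<close>
  are arbitrary, since they cancel on the right.\<close>

lemma has_derivative_tensor_along:
  fixes F :: "'a::real_normed_vector \<Rightarrow> real^'n"
  assumes F: "(F has_derivative DF) (at u)" "F u = coord_at A p p"
    and S: "open S" "u \<in> S" "F ` S \<subseteq> coord_at A p ` dom_at A p"
    and ml: "\<And>q. multilinear k (b q)"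
    and b: "\<And>ys. length ys = k \<Longrightarrow> (\<lambda>v. tensor_in_chart A p b v ys) differentiable (at (coord_at A p p))"
    and X: "\<And>i. i < k \<Longrightarrow> (X i has_derivative DX i) (at u)"
  shows "((\<lambda>v. tensor_in_chart A p b (F v) (map (\<lambda>i. X i v) [0..<k])) has_derivative
    (\<lambda>h. cov_tensor A \<Gamma> b p (DF h) (map (\<lambda>i. X i u) [0..<k]) +
      (\<Sum>i<k. b p ((map (\<lambda>i. X i u) [0..<k])[i := DX i h + \<Gamma> (DF h) (X i u)])))) (at u)"
proof -
  let ?D = "\<lambda>ys. frechet_derivative (\<lambda>v. tensor_in_chart A p b v ys) (at (coord_at A p p))"
  let ?X = "map (\<lambda>i. X i u) [0..<k]"
  have "((\<lambda>v. tensor_in_chart A p b (F v) (map (\<lambda>i. X i v) [0..<k])) has_derivative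
    (\<lambda>h. ?D ?X (DF h) + (\<Sum>i<k. tensor_in_chart A p b (F u) (?X[i := DX i h])))) (at u)"
  proof (rule has_derivative_tensor[OF S(1,2) _ _ X, where DT = "\<lambda>ys h. ?D ys (DF h)"])
    show "multilinear k (tensor_in_chart A p b (F v))" if "v \<in> S" for v
      by (rule tensor_in_chart_multilinear[OF _ ml]) (use S(3) that in auto)
    show "((\<lambda>v. tensor_in_chart A p b (F v) ys) has_derivative (\<lambda>h. ?D ys (DF h))) (at u)" if "length ys = k" for ys
    proof -
      have "((\<lambda>v. tensor_in_chart A p b v ys) has_derivative ?D ys) (at (F u))"
        using b[OF that] unfolding F(2) frechet_derivative_works .
      from has_derivative_compose[OF F(1) this] show ?thesis .
    qed
  qed
  moreover have "b p (?X[i := DX i h + \<Gamma> (DF h) (X i u)]) =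
      tensor_in_chart A p b (F u) (?X[i := DX i h]) + b p (?X[i := \<Gamma> (DF h) (?X ! i)])" if "i < k" for i h
    using linear_add[OF multilinear_linear_update[OF ml[of p], of ?X i]] that
    by (simp add: F(2) tensor_in_chart_at)
  then have "cov_tensor A \<Gamma> b p (DF h) ?X + (\<Sum>i<k. b p (?X[i := DX i h + \<Gamma> (DF h) (X i u)])) =
      ?D ?X (DF h) + (\<Sum>i<k. tensor_in_chart A p b (F u) (?X[i := DX i h]))" for h
    by (simp add: cov_tensor_def sum.distrib)
  ultimately show ?thesis by simp
qed

lemma frechet_derivative_multilinear:
  assumes ml: "\<And>q. multilinear k (b q)"
    and b: "\<And>ys. length ys = k \<Longrightarrow> (\<lambda>v. tensor_in_chart A p b v ys) differentiable (at (coord_at A p p))"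
  shows "multilinear k (\<lambda>ys. frechet_derivative (\<lambda>v. tensor_in_chart A p b v ys) (at (coord_at A p p)) x)"
  unfolding multilinear_def
proof (intro allI impI)
  fix xs :: "(real^'n) list" and i :: nat assume xs: "length xs = k" "i < k"
  let ?u = "coord_at A p p"
  let ?D = "\<lambda>ys. frechet_derivative (\<lambda>v. tensor_in_chart A p b v ys) (at ?u)"
  have D: "((\<lambda>v. tensor_in_chart A p b v (xs[i := y])) has_derivative ?D (xs[i := y])) (at ?u)" for y
    using b[of "xs[i := y]"] xs(1) unfolding frechet_derivative_works by simp
  have u: "?u \<in> coord_at A p ` dom_at A p" using mem_dom by blast
  have lin: "linear (\<lambda>y. tensor_in_chart A p b v (xs[i := y]))" if "v \<in> coord_at A p ` dom_at A p" for v
    by (rule multilinear_linear_update[OF tensor_in_chart_multilinear[OF that ml] xs])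
  have eq: "?D (xs[i := y]) = D'" if "(f has_derivative D') (at ?u)"
    "\<And>v. v \<in> coord_at A p ` dom_at A p \<Longrightarrow> f v = tensor_in_chart A p b v (xs[i := y])" for f D' y
    using has_derivative_transform_within_open[OF that(1) open_image u that(2)] D[of y] has_derivative_unique by blast
  show "linear (\<lambda>y. ?D (xs[i := y]) x)"
  proof (rule linearI)
    fix y z c
    have "?D (xs[i := y + z]) = (\<lambda>h. ?D (xs[i := y]) h + ?D (xs[i := z]) h)"
      by (rule eq[OF has_derivative_add[OF D D]]) (simp add: linear_add[OF lin])
    then show "?D (xs[i := y + z]) x = ?D (xs[i := y]) x + ?D (xs[i := z]) x" by simp
    have "?D (xs[i := c *\<^sub>R y]) = (\<lambda>h. c *\<^sub>R ?D (xs[i := y]) h)"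
      by (rule eq[OF has_derivative_scaleR_right[OF D]]) (simp add: linear_scale[OF lin])
    then show "?D (xs[i := c *\<^sub>R y]) x = c *\<^sub>R ?D (xs[i := y]) x" by simp
  qed
qed

lemma cov_tensor_multilinear:
  assumes ml: "\<And>q. multilinear k (b q)"
    and b: "\<And>ys. length ys = k \<Longrightarrow> (\<lambda>v. tensor_in_chart A p b v ys) differentiable (at (coord_at A p p))"
    and \<Gamma>: "linear (\<Gamma> x)"
  shows "multilinear k (cov_tensor A \<Gamma> b p x)"
proof -
  have "multilinear k (\<lambda>ys. \<Sum>i<k. b p (ys[i := \<Gamma> x (ys ! i)]))"
  proof (rule multilinear_sum)
    fix i assume i: "i \<in> {..<k}"
    show "multilinear k (\<lambda>ys. b p (ys[i := \<Gamma> x (ys ! i)]))"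
      unfolding multilinear_def
    proof (intro allI impI)
      fix xs :: "(real^'n) list" and j :: nat assume xs: "length xs = k" "j < k"
      show "linear (\<lambda>v. b p (xs[j := v, i := \<Gamma> x (xs[j := v] ! i)]))"
      proof (cases "i = j")
        case True
        then show ?thesis
          using linear_compose[OF \<Gamma> multilinear_linear_update[OF ml[of p] xs]] xs by (simp add: comp_def)
      next
        case False
        then show ?thesis
          using multilinear_linear_update[OF ml[of p], of "xs[i := \<Gamma> x (xs ! i)]" j] xs
          by (simp add: list_update_swap[of i j])
      qed
    qed
  qed
  then have "multilinear k (\<lambda>ys. frechet_derivative (\<lambda>v. tensor_in_chart A p b v ys) (at (coord_at A p p)) x
      - (\<Sum>i<k. b p (ys[i := \<Gamma> x (ys ! i)])))"
    using frechet_derivative_multilinear[OF ml b, of x] unfolding multilinear_def by (auto intro: linear_compose_sub)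
  then show ?thesis unfolding multilinear_def cov_tensor_def by simp
qed

end

section \<open>Existence and uniqueness of the Levi-Civita connection\<close>

locale riemannian =
  fixes M :: "('m::topological_space, 'n::finite) riem"
  assumes riemannian: "riemannian_manifold M"

sublocale riemannian \<subseteq> atlas "mfd_atlas M"
  using riemannian by unfold_locales (simp add: riemannian_manifold_def)

context riemannian
begin

lemma metric_smooth: "smooth_tensor_field (mfd_atlas M) 2 (mfd_metric M)"
  and metric_multilinear: "multilinear 2 (mfd_metric M p)"
  and metric_sym: "mfd_metric M p [x, y] = mfd_metric M p [y, x]"
  and metric_pos: "x \<noteq> 0 \<Longrightarrow> 0 < mfd_metric M p [x, x]"
  using riemannian unfolding riemannian_manifold_def smooth_tensor_field_def by blast+

lemma metric_differentiable:
  "length ys = 2 \<Longrightarrow> (\<lambda>v. tensor_in_chart (mfd_atlas M) p (mfd_metric M) v ys) differentiable (at (coord_at (mfd_atlas M) p p))"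
  using smooth_tensor_field_derivative[OF metric_smooth, of ys "coord_at (mfd_atlas M) p p" p] mem_dom[of p]
  unfolding differentiable_def by blast

lemma levi_civita_unique:
  "\<exists>!\<Gamma>. bilinear \<Gamma> \<and> (\<forall>x y. \<Gamma> x y = \<Gamma> y x) \<and>
    (\<forall>x y z. cov_tensor (mfd_atlas M) \<Gamma> (mfd_metric M) p x [y, z] = 0)"
proof -
  let ?A = "mfd_atlas M" and ?g = "mfd_metric M"
  let ?D = "\<lambda>x y z. frechet_derivative (\<lambda>u. tensor_in_chart ?A p ?g u [y, z]) (at (coord_at ?A p p)) x"
  have ml: "multilinear 2 (\<lambda>ys. frechet_derivative (\<lambda>v. tensor_in_chart ?A p ?g v ys) (at (coord_at ?A p p)) x)" for x
    by (rule frechet_derivative_multilinear[OF metric_multilinear metric_differentiable])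
  have D1: "linear (\<lambda>x. ?D x y z)" for y z
    using metric_differentiable[of "[y, z]" p] by (simp add: linear_frechet_derivative)
  have D2: "linear (\<lambda>y. ?D x y z)" for x z using multilinear_2(1)[OF ml] .
  have D3: "?D x y z = ?D x z y" for x y z
    using metric_sym by (simp add: tensor_in_chart_def Let_def)
  have "\<exists>!\<Gamma>. bilinear \<Gamma> \<and> (\<forall>x y. \<Gamma> x y = \<Gamma> y x) \<and>
      (\<forall>x y z. ?D x y z = ?g p [\<Gamma> x y, z] + ?g p [y, \<Gamma> x z])"
    by (rule koszul[where D = ?D and g = "?g p", OF metric_multilinear metric_sym _ D1 D2 D3]) (rule metric_pos)
  then show ?thesis by (simp add: cov_tensor_def numeral_2_eq_2)
qed

lemma levi_civita:
  shows "bilinear (levi_civita M p)" and "levi_civita M p x y = levi_civita M p y x"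
    and "cov_tensor (mfd_atlas M) (levi_civita M p) (mfd_metric M) p x [y, z] = 0"
  using theI'[OF levi_civita_unique[of p]] unfolding levi_civita_def by blast+

lemma levi_civita_linear: "linear (levi_civita M p x)" "linear (\<lambda>x. levi_civita M p x y)"
  using levi_civita(1)[of p] unfolding bilinear_def by blast+

end


section \<open>\<open>G\<^sub>2\<close>-manifolds\<close>

locale g2_manifold = riemannian N for N :: "('l::topological_space, 7) riem" +
  fixes \<phi> :: "'l \<Rightarrow> 7 tensor"
  assumes g2_structure: "g2_structure N \<phi>"
begin

abbreviation "B \<equiv> mfd_atlas N"
abbreviation "g \<equiv> mfd_metric N"

text \<open>The frame chosen inside \<open>g2_hodge\<close> says nothing about neighbouring points;
  through \<open>star3\<close> the dual becomes a field that can be differentiated.\<close>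

definition star :: "'l \<Rightarrow> 7 tensor" where
  "star q = star3 (g q) (\<phi> q)"

lemma \<phi>_smooth: "smooth_tensor_field B 3 \<phi>" and \<phi>_multilinear: "multilinear 3 (\<phi> q)"
  using g2_structure unfolding g2_structure_def smooth_tensor_field_def by blast+

lemma cayleyI: "cayley_frame (g q) (\<phi> q) e \<Longrightarrow> cayley (g q) (\<phi> q) e"
  by unfold_locales (use metric_multilinear metric_sym \<phi>_multilinear in auto)

lemma exists_cayley: "\<exists>e. cayley (g q) (\<phi> q) e"
  using g2_structure cayleyI unfolding g2_structure_def by meson

text \<open>The frame selected in \<open>g2_vol\<close> is itself a Cayley frame, so the pointwise
  results on Hodge duals apply with it, whatever frame is used elsewhere.\<close>

lemma cayley_vol:
  obtains e where "cayley (g q) (\<phi> q) e" "g2_vol N \<phi> q = cayley.vol (g q) e"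
proof -
  let ?e = "SOME e. cayley_frame (g q) (\<phi> q) e"
  have "cayley_frame (g q) (\<phi> q) ?e"
    using exists_cayley[of q] cayley.frame by (metis someI_ex)
  then have c: "cayley (g q) (\<phi> q) ?e" by (rule cayleyI)
  show thesis by (rule that[OF c]) (simp add: g2_vol_def Let_def cayley.vol_def[OF c])
qed

lemma g2_hodge_star: "length xs = 4 \<Longrightarrow> g2_hodge N \<phi> 3 \<phi> q xs = star q xs"
  by (metis cayley_vol cayley.hodge_\<phi> g2_hodge_def star_def)

lemma star_multilinear: "multilinear 4 (star q)"
  using exists_cayley cayley.star_multilinear unfolding star_def by blast

lemma \<phi>_differentiable:
  "length ys = 3 \<Longrightarrow> (\<lambda>v. tensor_in_chart B p \<phi> v ys) differentiable (at (coord_at B p p))"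
  using smooth_tensor_field_derivative[OF \<phi>_smooth, of ys "coord_at B p p" p] mem_dom[of p]
  unfolding differentiable_def by blast

text \<open>\<open>E\<close> is the frame \<open>e\<close> read in the chart selected at \<open>p\<close>.\<close>

lemma local_frame:
  obtains S and E :: "7 \<Rightarrow> real^7 \<Rightarrow> real^7" and e :: "7 \<Rightarrow> 'l \<Rightarrow> real^7"
  where "open S" "coord_at B p p \<in> S" "S \<subseteq> coord_at B p ` dom_at B p"
    "\<And>i. (E i) differentiable (at (coord_at B p p))"
    "\<And>i. E i (coord_at B p p) = e i p"
    "\<And>v. v \<in> S \<Longrightarrow> cayley (g (param_at B p v)) (\<phi> (param_at B p v)) (\<lambda>i. e i (param_at B p v))"
    "\<And>v i. v \<in> S \<Longrightarrow> coord_change B p (param_at B p v) (param_at B p v) (E i v) = e i (param_at B p v)"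
proof -
  obtain W e where W: "open W" "p \<in> W" "\<And>i. smooth_along B B (\<lambda>q. q) W (e i)"
    "\<And>q. q \<in> W \<Longrightarrow> cayley_frame (g q) (\<phi> q) (\<lambda>i. e i q)"
    using g2_structure unfolding g2_structure_def by metis
  let ?S = "coord_at B p ` (dom_at B p \<inter> W)"
  let ?E = "\<lambda>i. along_in_chart B B (\<lambda>q. q) p (e i)"
  have v0: "coord_at B p p \<in> ?S" using W(2) mem_dom by blast
  show thesis
  proof (rule that[of ?S ?E e])
    show "open ?S" by (rule open_coord_image[OF W(1)])
    show "coord_at B p p \<in> ?S" by (rule v0)
    have "W \<inter> dom_at B p \<inter> (\<lambda>q. q) -` dom_at B p = dom_at B p \<inter> W" by auto
    then have "smooth_on ?S (?E i)" for i
      using W(3)[of i] unfolding smooth_along_def by metis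
    then show "?E i differentiable (at (coord_at B p p))" for i
      using smooth_on_has_derivative[OF _ v0] unfolding differentiable_def by blast
    show "?E i (coord_at B p p) = e i p" for i
      by (simp add: along_in_chart_def Let_def param_coord mem_dom coord_change_same)
    show "cayley (g (param_at B p v)) (\<phi> (param_at B p v)) (\<lambda>i. e i (param_at B p v))" if "v \<in> ?S" for v
      by (rule cayleyI, rule W(4)) (use that in \<open>auto simp: param_coord\<close>)
    show "coord_change B p (param_at B p v) (param_at B p v) (?E i v) = e i (param_at B p v)" if "v \<in> ?S" for v i
    proof -
      have "param_at B p v \<in> dom_at B p" using that by (auto simp: param_coord)
      then show ?thesis
        unfolding along_in_chart_def Let_def by (rule coord_change_inverse) (rule mem_dom)
    qed
  qed auto
qed

text \<open>In \<open>star_eq\<close> the sum may run over the smooth local frame of the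
  G_2-structure instead of \<open>onb\<close>, which turns the components into sums and products of
  differentiable functions.\<close>

lemma star_differentiable:
  assumes "length ys = 4" shows "(\<lambda>v. tensor_in_chart B p star v ys) differentiable (at (coord_at B p p))"
proof -
  obtain a b c d where ys: "ys = [a, b, c, d]"
    using assms by (auto simp: eval_nat_numeral length_Suc_conv)
  let ?v0 = "coord_at B p p"
  let ?G = "\<lambda>v. tensor_in_chart B p g v" and ?\<Phi> = "\<lambda>v. tensor_in_chart B p \<phi> v"
  obtain S E e where S: "open S" "?v0 \<in> S" "S \<subseteq> coord_at B p ` dom_at B p"
    and E: "\<And>i. (E i) differentiable (at ?v0)"
      "\<And>v. v \<in> S \<Longrightarrow> cayley (g (param_at B p v)) (\<phi> (param_at B p v)) (\<lambda>i. e i (param_at B p v))"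
      "\<And>v i. v \<in> S \<Longrightarrow> coord_change B p (param_at B p v) (param_at B p v) (E i v) = e i (param_at B p v)"
    by (rule local_frame[of p]) metis
  have eq: "tensor_in_chart B p star v ys = ?G v [a, c] * ?G v [b, d] - ?G v [a, d] * ?G v [b, c]
     - (\<Sum>m\<in>UNIV. ?\<Phi> v [E m v, a, b] * ?\<Phi> v [E m v, c, d])" if "v \<in> S" for v
    by (simp add: tensor_in_chart_def Let_def star_def cayley.star_eq[OF E(2)[OF that]] E(3)[OF that] ys)
  have \<Phi>: "(\<lambda>v. ?\<Phi> v [E m v, y, z]) differentiable (at ?v0)" for m y z
  proof -
    obtain D where "(E m has_derivative D) (at ?v0)" using E(1) unfolding differentiable_def by blast
    then have X: "([E m, \<lambda>v. y, \<lambda>v. z] ! i has_derivative [D, \<lambda>h. 0, \<lambda>h. 0] ! i) (at ?v0)" if "i < 3" for i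
      using that by (auto simp: numeral_3_eq_3 less_Suc_eq)
    from has_derivative_tensor_along[where X = "(!) [E m, \<lambda>v. y, \<lambda>v. z]" and DX = "(!) [D, \<lambda>h. 0, \<lambda>h. 0]"
        and \<Gamma> = "\<lambda>x y. 0", OF has_derivative_ident refl S(1,2) _ \<phi>_multilinear \<phi>_differentiable X]
    show ?thesis using S(3) unfolding differentiable_def by (auto simp: numeral_3_eq_3)
  qed
  have "(\<lambda>v. ?G v [a, c] * ?G v [b, d] - ?G v [a, d] * ?G v [b, c]
     - (\<Sum>m\<in>UNIV. ?\<Phi> v [E m v, a, b] * ?\<Phi> v [E m v, c, d])) differentiable (at ?v0)"
    by (intro differentiable_diff differentiable_mult differentiable_sum ballI metric_differentiable \<Phi>) auto
  then obtain D where D: "((\<lambda>v. ?G v [a, c] * ?G v [b, d] - ?G v [a, d] * ?G v [b, c]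
     - (\<Sum>m\<in>UNIV. ?\<Phi> v [E m v, a, b] * ?\<Phi> v [E m v, c, d])) has_derivative D) (at ?v0)"
    unfolding differentiable_def by blast
  have "((\<lambda>v. tensor_in_chart B p star v ys) has_derivative D) (at ?v0)"
    by (rule has_derivative_transform_within_open[OF D S(1,2)]) (simp add: eq)
  then show ?thesis unfolding differentiable_def by blast
qed

lemma nabla_linear:
  assumes "length ys = k" "\<And>ys. length ys = k \<Longrightarrow> (\<lambda>v. tensor_in_chart B p b v ys) differentiable (at (coord_at B p p))"
    and "\<And>q. multilinear k (b q)"
  shows "linear (\<lambda>x. nabla N b p x ys)"
proof -
  have 1: "linear (frechet_derivative (\<lambda>v. tensor_in_chart B p b v ys) (at (coord_at B p p)))"
    by (rule linear_frechet_derivative[OF assms(2)[OF assms(1)]])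
  have "linear (\<lambda>x. b p (ys[i := levi_civita N p x (ys ! i)]))" if "i < k" for i
    using linear_compose[OF levi_civita_linear(2) multilinear_linear_update[OF assms(3) assms(1) that]]
    by (simp add: comp_def)
  then show ?thesis
    unfolding nabla_def cov_tensor_def assms(1) by (intro linear_compose_sub linear_compose_sum ballI 1) auto
qed

lemma nabla_multilinear:
  assumes "\<And>ys. length ys = k \<Longrightarrow> (\<lambda>v. tensor_in_chart B p b v ys) differentiable (at (coord_at B p p))"
    and "\<And>q. multilinear k (b q)"
  shows "multilinear k (nabla N b p x)"
  unfolding nabla_def by (rule cov_tensor_multilinear[where \<Gamma> = "levi_civita N p", OF assms(2,1) levi_civita_linear(1)])

text \<open>In a Cayley frame the metric, \<phi> and its dual have constant components.
  Differentiating these constants expresses the covariant derivatives by those of the frame, and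
  parallelism of the metric makes the latter skew.\<close>

lemma exists_torsion_form:
  obtains e q where "cayley (g p) (\<phi> p) e" "linear q"
    and "\<And>a b c. nabla N \<phi> p x [a, b, c] = (\<Sum>l\<in>UNIV. q (e l) * star p [e l, a, b, c])"
    and "\<And>a b c d. nabla N star p x [a, b, c, d] =
      - (q a * \<phi> p [b, c, d] - q b * \<phi> p [a, c, d] + q c * \<phi> p [a, b, d] - q d * \<phi> p [a, b, c])"
proof -
  let ?v0 = "coord_at B p p" and ?\<Gamma> = "levi_civita N p"
  obtain S E e where S: "open S" "?v0 \<in> S" "S \<subseteq> coord_at B p ` dom_at B p"
    and E: "\<And>i. (E i) differentiable (at ?v0)" "\<And>i. E i ?v0 = e i p"
      "\<And>v. v \<in> S \<Longrightarrow> cayley (g (param_at B p v)) (\<phi> (param_at B p v)) (\<lambda>i. e i (param_at B p v))"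
      "\<And>v i. v \<in> S \<Longrightarrow> coord_change B p (param_at B p v) (param_at B p v) (E i v) = e i (param_at B p v)"
    by (rule local_frame[of p]) metis
  \<comment> \<open>The covariant derivative of the i-th frame field in direction
    \<open>x\<close>.\<close>
  define w where "w i = frechet_derivative (E i) (at ?v0) x + ?\<Gamma> x (e i p)" for i
  have c: "cayley (g p) (\<phi> p) (\<lambda>i. e i p)" using E(3)[OF S(2)] by (simp add: param_coord mem_dom)
  interpret C: cayley "g p" "\<phi> p" "\<lambda>i. e i p" by (rule c)
  have rule: "cov_tensor B ?\<Gamma> b p x (map (\<lambda>i. e (is ! i) p) [0..<k])
      + (\<Sum>i<k. b p ((map (\<lambda>i. e (is ! i) p) [0..<k])[i := w (is ! i)])) = 0"
    if b: "\<And>q. multilinear k (b q)"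
      "\<And>ys. length ys = k \<Longrightarrow> (\<lambda>v. tensor_in_chart B p b v ys) differentiable (at ?v0)"
      and const: "\<And>v. v \<in> S \<Longrightarrow> b (param_at B p v) (map (\<lambda>i. e (is ! i) (param_at B p v)) [0..<k]) = t"
    for b :: "'l \<Rightarrow> 7 tensor" and k "is" t
  proof -
    have "((\<lambda>v. tensor_in_chart B p b v (map (\<lambda>i. E (is ! i) v) [0..<k])) has_derivative (\<lambda>h. 0)) (at ?v0)"
      by (rule has_derivative_transform_within_open[OF has_derivative_const[of t] S(1,2)])
        (simp add: tensor_in_chart_def Let_def comp_def E(4) const)
    moreover have "((\<lambda>v. tensor_in_chart B p b v (map (\<lambda>i. E (is ! i) v) [0..<k])) has_derivative
        (\<lambda>h. cov_tensor B ?\<Gamma> b p h (map (\<lambda>i. E (is ! i) ?v0) [0..<k]) +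
          (\<Sum>i<k. b p ((map (\<lambda>i. E (is ! i) ?v0) [0..<k])
            [i := frechet_derivative (E (is ! i)) (at ?v0) h + ?\<Gamma> h (E (is ! i) ?v0)])))) (at ?v0)"
      using E(1) S(3) unfolding frechet_derivative_works
      by (intro has_derivative_tensor_along[OF has_derivative_ident refl S(1,2) _ b]) auto
    ultimately have "(\<lambda>h. cov_tensor B ?\<Gamma> b p h (map (\<lambda>i. E (is ! i) ?v0) [0..<k]) +
          (\<Sum>i<k. b p ((map (\<lambda>i. E (is ! i) ?v0) [0..<k])
            [i := frechet_derivative (E (is ! i)) (at ?v0) h + ?\<Gamma> h (E (is ! i) ?v0)]))) = (\<lambda>h. 0)"
      by (rule has_derivative_unique[rotated])
    from fun_cong[OF this, of x] show ?thesis by (simp add: E(2) w_def)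
  qed
  have skew: "g p [w i, e j p] = - g p [e i p, w j]" for i j
  proof -
    have "g (param_at B p v) (map (\<lambda>k. e ([i, j] ! k) (param_at B p v)) [0..<2]) = (if i = j then 1 else 0)" if "v \<in> S" for v
      using cayley.g_frame[OF E(3)[OF that]] by (simp add: numeral_2_eq_2)
    from rule[OF metric_multilinear metric_differentiable this] show ?thesis
      by (simp add: numeral_2_eq_2 levi_civita(3))
  qed
  have T: "nabla N \<phi> p x [e i p, e j p, e k p] =
      - (\<phi> p [w i, e j p, e k p] + \<phi> p [e i p, w j, e k p] + \<phi> p [e i p, e j p, w k])" for i j k
  proof -
    have "\<phi> (param_at B p v) (map (\<lambda>l. e ([i, j, k] ! l) (param_at B p v)) [0..<3]) = phi0 i j k" if "v \<in> S" for v
      using cayley.\<phi>_frame[OF E(3)[OF that]] by (simp add: numeral_3_eq_3)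
    from rule[OF \<phi>_multilinear \<phi>_differentiable this] show ?thesis
      by (simp add: numeral_3_eq_3 nabla_def)
  qed
  have T4: "nabla N star p x [e i p, e j p, e k p, e l p] =
      - (star p [w i, e j p, e k p, e l p] + star p [e i p, w j, e k p, e l p]
         + star p [e i p, e j p, w k, e l p] + star p [e i p, e j p, e k p, w l])" for i j k l
  proof -
    have "star (param_at B p v) (map (\<lambda>m. e ([i, j, k, l] ! m) (param_at B p v)) [0..<4]) = star0 i j k l" if "v \<in> S" for v
      using cayley.star_frame[OF E(3)[OF that]] by (simp add: eval_nat_numeral star_def)
    from rule[OF star_multilinear star_differentiable this] show ?thesis
      by (simp add: eval_nat_numeral nabla_def)
  qed
  show thesis
  proof (rule C.skew_derivative[OF skew nabla_multilinear[OF \<phi>_differentiable \<phi>_multilinear] T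
          nabla_multilinear[OF star_differentiable star_multilinear] T4[unfolded star_def[of p]]])
    fix q assume "linear q"
      and "\<And>a b c. nabla N \<phi> p x [a, b, c] = (\<Sum>l\<in>UNIV. q (e l p) * star3 (g p) (\<phi> p) [e l p, a, b, c])"
      and "\<And>a b c d. nabla N star p x [a, b, c, d] =
        - (q a * \<phi> p [b, c, d] - q b * \<phi> p [a, c, d] + q c * \<phi> p [a, b, d] - q d * \<phi> p [a, b, c])"
    with c show thesis by (intro that[of "\<lambda>i. e i p" q]) (simp_all add: star_def)
  qed
qed

text \<open>The contraction 24 g, divided by 3! in the inner product of 3-forms and by 4 in
  \<open>r_phi\<close>, is exactly g.\<close>

lemma r_phi_eq:
  assumes "cayley (g p) (\<phi> p) e" "linear q"
    and N: "\<And>a b c. nabla N \<phi> p x [a, b, c] = (\<Sum>l\<in>UNIV. q (e l) * star p [e l, a, b, c])"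
  shows "r_phi N \<phi> p [x, y] = q y"
proof -
  interpret C: cayley "g p" "\<phi> p" e by (rule assms(1))
  have ml: "multilinear 3 (\<lambda>ys. star p (y # ys))"
    using multilinear_Cons[of 3 "star p"] star_multilinear by simp
  have "form_inner (g p) 3 (nabla N \<phi> p x) (interior_mult y (g2_hodge N \<phi> 3 \<phi> p)) =
      (\<Sum>is | length is = 3. nabla N \<phi> p x (map (onb (g p)) is) * star p (y # map (onb (g p)) is)) / 6"
    unfolding form_inner_def by (simp add: interior_mult_def g2_hodge_star fact_numeral)
  also have "\<dots> = (\<Sum>is | length is = 3. nabla N \<phi> p x (map e is) * star p (y # map e is)) / 6"
    using orthonormal_sum_lists_invariant[OF C.onb_orthonormal C.orthonormal C.g_multilinear C.g_sym
        nabla_multilinear[OF \<phi>_differentiable \<phi>_multilinear] ml] by simp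
  also have "\<dots> = (\<Sum>i\<in>UNIV. \<Sum>j\<in>UNIV. \<Sum>k\<in>UNIV. \<Sum>l\<in>UNIV.
      q (e l) * (star p [e l, e i, e j, e k] * star p [y, e i, e j, e k])) / 6"
    by (simp add: sum_lists N sum_distrib_right mult.assoc)
  also have "\<dots> = (\<Sum>l\<in>UNIV. \<Sum>i\<in>UNIV. \<Sum>j\<in>UNIV. \<Sum>k\<in>UNIV.
      q (e l) * (star p [e l, e i, e j, e k] * star p [y, e i, e j, e k])) / 6"
  proof -
    have 3: "(\<Sum>j\<in>UNIV. \<Sum>k\<in>UNIV. \<Sum>l\<in>UNIV. f j k l) = (\<Sum>l\<in>UNIV. \<Sum>j\<in>UNIV. \<Sum>k\<in>UNIV. f j k l)"
      for f :: "7 \<Rightarrow> 7 \<Rightarrow> 7 \<Rightarrow> real"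
    proof -
      have "(\<Sum>j\<in>UNIV. \<Sum>k\<in>UNIV. \<Sum>l\<in>UNIV. f j k l) = (\<Sum>j\<in>UNIV. \<Sum>l\<in>UNIV. \<Sum>k\<in>UNIV. f j k l)"
        by (rule sum.cong[OF refl], rule sum.swap)
      also have "\<dots> = (\<Sum>l\<in>UNIV. \<Sum>j\<in>UNIV. \<Sum>k\<in>UNIV. f j k l)" by (rule sum.swap)
      finally show ?thesis .
    qed
    show ?thesis
      by (rule arg_cong[where f = "\<lambda>x. x / 6"], rule trans[OF sum.cong[OF refl 3]], rule sum.swap)
  qed
  also have "\<dots> = (\<Sum>l\<in>UNIV. q (e l) * (24 * g p [e l, y])) / 6"
    unfolding sum_distrib_left[symmetric] star_def C.star_star_contraction ..
  also have "\<dots> = 4 * (\<Sum>l\<in>UNIV. g p [y, e l] * q (e l))"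
    by (simp add: C.g_sym[of y] sum_distrib_left sum_divide_distrib mult_ac)
  also have "\<dots> = 4 * q y"
    using C.linear_frame_sum[OF assms(2)] by simp
  finally show ?thesis by (simp add: r_phi_def)
qed

lemma exists_cayley_nabla:
  "\<exists>e. cayley (g p) (\<phi> p) e \<and> linear (\<lambda>y. r_phi N \<phi> p [x, y]) \<and>
    (\<forall>a b c. nabla N \<phi> p x [a, b, c] = (\<Sum>l\<in>UNIV. r_phi N \<phi> p [x, e l] * star p [e l, a, b, c])) \<and>
    (\<forall>a b c d. nabla N star p x [a, b, c, d] =
      - (r_phi N \<phi> p [x, a] * \<phi> p [b, c, d] - r_phi N \<phi> p [x, b] * \<phi> p [a, c, d]
        + r_phi N \<phi> p [x, c] * \<phi> p [a, b, d] - r_phi N \<phi> p [x, d] * \<phi> p [a, b, c]))"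
proof (rule exists_torsion_form[of p x])
  fix e q assume q: "cayley (g p) (\<phi> p) e" "linear q"
    "\<And>a b c. nabla N \<phi> p x [a, b, c] = (\<Sum>l\<in>UNIV. q (e l) * star p [e l, a, b, c])"
    and s: "\<And>a b c d. nabla N star p x [a, b, c, d] =
      - (q a * \<phi> p [b, c, d] - q b * \<phi> p [a, c, d] + q c * \<phi> p [a, b, d] - q d * \<phi> p [a, b, c])"
  have "r_phi N \<phi> p [x, y] = q y" for y by (rule r_phi_eq[OF q])
  then show ?thesis using q s by (intro exI[of _ e]) simp
qed

lemma r_phi_linear: "linear (\<lambda>y. r_phi N \<phi> p [x, y])"
  using exists_cayley_nabla[of p x] by blast

lemma r_phi_linear_1: "linear (\<lambda>x. r_phi N \<phi> p [x, y])"
proof -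
  have "linear (\<lambda>x. nabla N \<phi> p x ys)" if "length ys = 3" for ys
    by (rule nabla_linear[OF that \<phi>_differentiable \<phi>_multilinear])
  moreover have "r_phi N \<phi> p [x, y] = (\<Sum>is | length is = 3.
      (interior_mult y (g2_hodge N \<phi> 3 \<phi> p) (map (onb (g p)) is) / 24) * nabla N \<phi> p x (map (onb (g p)) is))" for x
    by (simp add: r_phi_def form_inner_def fact_numeral sum_divide_distrib mult.commute)
  ultimately show ?thesis
    by (simp only:) (intro linear_compose_sum ballI linear_times, simp)
qed

text \<open>The frame in \<open>exists_cayley_nabla\<close> depends on \<open>x\<close>; as the sum
  is a trace, any Cayley frame will do.\<close>

lemma nabla_\<phi>:
  assumes "cayley (g p) (\<phi> p) e"
  shows "nabla N \<phi> p x [a, b, c] = (\<Sum>l\<in>UNIV. r_phi N \<phi> p [x, e l] * star p [e l, a, b, c])"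
proof -
  obtain e' where q: "cayley (g p) (\<phi> p) e'"
    "\<And>a b c. nabla N \<phi> p x [a, b, c] = (\<Sum>l\<in>UNIV. r_phi N \<phi> p [x, e' l] * star p [e' l, a, b, c])"
    using exists_cayley_nabla[of p x] by blast
  let ?q = "\<lambda>y. r_phi N \<phi> p [x, y]"
  note r = r_phi_linear[of p x]
  note lin = multilinear_4(1)[OF star_multilinear]
  have "(\<Sum>l\<in>UNIV. ?q (e' l) * star p [e' l, a, b, c]) = (\<Sum>l\<in>UNIV. ?q (e l) * star p [e l, a, b, c])"
    by (rule orthonormal_sum_invariant[OF cayley.orthonormal[OF q(1)] cayley.orthonormal[OF assms]
          metric_multilinear metric_sym, where b = "\<lambda>x y. ?q x * star p [y, a, b, c]"])
      (auto intro!: linearI simp: linear_add[OF r] linear_scale[OF r] linear_add[OF lin] linear_scale[OF lin] algebra_simps)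
  then show ?thesis by (simp add: q(2))
qed

lemma nabla_star:
  "nabla N star p x [a, b, c, d] = - (r_phi N \<phi> p [x, a] * \<phi> p [b, c, d] - r_phi N \<phi> p [x, b] * \<phi> p [a, c, d]
     + r_phi N \<phi> p [x, c] * \<phi> p [a, b, d] - r_phi N \<phi> p [x, d] * \<phi> p [a, b, c])"
  using exists_cayley_nabla[of p x] by blast

text \<open>The Christoffel terms cancel in pairs, since the connection is torsion-free and \<phi>
  alternates.\<close>

lemma ext_deriv_\<phi>:
  "ext_deriv B \<phi> p [x, y, z, v] = nabla N \<phi> p x [y, z, v] - nabla N \<phi> p y [x, z, v]
     + nabla N \<phi> p z [x, y, v] - nabla N \<phi> p v [x, y, z]"
proof -
  obtain e where "cayley (g p) (\<phi> p) e" using exists_cayley by blast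
  then interpret C: cayley "g p" "\<phi> p" e .
  let ?\<Gamma> = "levi_civita N p"
  have "\<phi> p [y, ?\<Gamma> x z, v] = - \<phi> p [?\<Gamma> z x, y, v]" using C.\<phi>_alt(1)[of y "?\<Gamma> x z" v] levi_civita(2)[of p x z] by simp
  moreover have "\<phi> p [y, z, ?\<Gamma> x v] = \<phi> p [?\<Gamma> v x, y, z]" using C.\<phi>_cyclic[of y z "?\<Gamma> x v"] levi_civita(2)[of p x v] by simp
  moreover have "\<phi> p [x, z, ?\<Gamma> y v] = - \<phi> p [x, ?\<Gamma> v y, z]" using C.\<phi>_alt(2)[of x z "?\<Gamma> y v"] levi_civita(2)[of p y v] by simp
  moreover have "?\<Gamma> x y = ?\<Gamma> y x" "?\<Gamma> y z = ?\<Gamma> z y" "?\<Gamma> z v = ?\<Gamma> v z" by (rule levi_civita(2))+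
  ultimately show ?thesis
    by (simp add: ext_deriv_def nabla_def cov_tensor_def eval_nat_numeral)
qed

lemma ext_deriv_\<phi>_multilinear: "multilinear 4 (ext_deriv B \<phi> p)"
proof -
  note lin = multilinear_3[OF nabla_multilinear[OF \<phi>_differentiable \<phi>_multilinear]]
    nabla_linear[OF _ \<phi>_differentiable \<phi>_multilinear, of "[_, _, _]", simplified]
  show ?thesis
    by (rule multilinear_4I; unfold ext_deriv_\<phi>; intro linear_compose_sub linear_compose_add lin; simp)
qed

lemma ext_deriv_\<phi>_alternating: "alternating 4 (ext_deriv B \<phi> p)"
proof -
  obtain e where e: "cayley (g p) (\<phi> p) e" using exists_cayley by blast
  note s = alternating_4D[OF cayley.star_alternating[OF e], folded star_def]
  have alt: "nabla N \<phi> p x [z, y, w] = - nabla N \<phi> p x [y, z, w]" "nabla N \<phi> p x [y, w, z] = - nabla N \<phi> p x [y, z, w]" for x y z w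
    unfolding nabla_\<phi>[OF e] using s(2)[of "e _" z y w] s(3)[of "e _" y w z] by (simp_all add: sum_negf)
  show ?thesis
  proof (rule alternating_4I)
    fix x y z w
    show "ext_deriv B \<phi> p [y, x, z, w] = - ext_deriv B \<phi> p [x, y, z, w]"
      using alt(1)[of z y x w] alt(1)[of w y x z] by (simp add: ext_deriv_\<phi>)
    show "ext_deriv B \<phi> p [x, z, y, w] = - ext_deriv B \<phi> p [x, y, z, w]"
      using alt(1)[of x z y w] alt(2)[of w x z y] by (simp add: ext_deriv_\<phi>)
    show "ext_deriv B \<phi> p [x, y, w, z] = - ext_deriv B \<phi> p [x, y, z, w]"
      using alt(2)[of x y w z] alt(2)[of y x w z] by (simp add: ext_deriv_\<phi>)
  qed
qed

text \<open>So \<open>pd_star\<close> sees only the skew part of \<open>r_phi\<close>, through its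
  contraction with \<phi>.\<close>

lemma pd_star_eq:
  assumes e: "cayley (g p) (\<phi> p) e"
  shows "pd_star N \<phi> p [x] = - 2 * (\<Sum>i\<in>UNIV. \<Sum>l\<in>UNIV. r_phi N \<phi> p [e i, e l] * \<phi> p [e i, e l, x])"
proof -
  interpret C: cayley "g p" "\<phi> p" e by (rule e)
  let ?N = "nabla N \<phi> p" and ?r = "\<lambda>x y. r_phi N \<phi> p [x, y]"
  obtain e' where e': "cayley (g p) (\<phi> p) e'" "g2_vol N \<phi> p = cayley.vol (g p) e'" by (rule cayley_vol)
  have inv: "(\<Sum>is | length is = 3. ext_deriv B \<phi> p (x # map e' is) * \<phi> p (map e' is)) =
      (\<Sum>is | length is = 3. ext_deriv B \<phi> p (x # map e is) * \<phi> p (map e is))"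
    using multilinear_Cons[of 3 "ext_deriv B \<phi> p" x] ext_deriv_\<phi>_multilinear
    by (intro orthonormal_sum_lists_invariant[OF cayley.orthonormal[OF e'(1)] C.orthonormal C.g_multilinear C.g_sym _ \<phi>_multilinear]) simp
  have "pd_star N \<phi> p [x] = - (\<Sum>i\<in>UNIV. \<Sum>j\<in>UNIV. \<Sum>k\<in>UNIV.
      ext_deriv B \<phi> p [x, e i, e j, e k] * \<phi> p [e i, e j, e k]) / 6"
    using cayley.hodge_hodge_wedge[where x = x, OF e'(1) ext_deriv_\<phi>_multilinear ext_deriv_\<phi>_alternating] inv
    by (simp add: pd_star_def g2_hodge_def e'(2) sum_lists)
  \<comment> \<open>Of the four terms of d\<phi> the one differentiating along \<open>x\<close>
    drops out and the other three each give minus \<open>?S\<close>. The contraction of the dual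
    with \<phi> gives -4, and (-3) (-4) = 12.\<close>
  also have "(\<Sum>i\<in>UNIV. \<Sum>j\<in>UNIV. \<Sum>k\<in>UNIV. ext_deriv B \<phi> p [x, e i, e j, e k] * \<phi> p [e i, e j, e k]) =
      12 * (\<Sum>i\<in>UNIV. \<Sum>l\<in>UNIV. ?r (e i) (e l) * \<phi> p [e i, e l, x])"
  proof -
    have comm: "(\<Sum>j\<in>UNIV. \<Sum>k\<in>UNIV. ?N y [a j k, b j k, c j k] * f j k) =
        (\<Sum>l\<in>UNIV. ?r y (e l) * (\<Sum>j\<in>UNIV. \<Sum>k\<in>UNIV. star p [e l, a j k, b j k, c j k] * f j k))" for y a b c f
    proof -
      have "(\<Sum>j\<in>UNIV. \<Sum>k\<in>UNIV. ?N y [a j k, b j k, c j k] * f j k) =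
        (\<Sum>j\<in>UNIV. \<Sum>l\<in>UNIV. \<Sum>k\<in>UNIV. ?r y (e l) * (star p [e l, a j k, b j k, c j k] * f j k))"
        unfolding nabla_\<phi>[OF e] sum_distrib_right mult.assoc by (rule sum.cong[OF refl], rule sum.swap)
      also have "\<dots> = (\<Sum>l\<in>UNIV. ?r y (e l) * (\<Sum>j\<in>UNIV. \<Sum>k\<in>UNIV. star p [e l, a j k, b j k, c j k] * f j k))"
        unfolding sum_distrib_left by (rule sum.swap)
      finally show ?thesis .
    qed
    have 2: "(\<Sum>j\<in>UNIV. \<Sum>k\<in>UNIV. ?N (e i) [x, e j, e k] * \<phi> p [e i, e j, e k]) =
        - 4 * (\<Sum>l\<in>UNIV. ?r (e i) (e l) * \<phi> p [e i, e l, x])" for i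
      unfolding comm star_def C.star_\<phi>_contraction by (simp add: sum_distrib_left mult_ac)
    have 1: "(\<Sum>i\<in>UNIV. \<Sum>j\<in>UNIV. \<Sum>k\<in>UNIV. ?N x [e i, e j, e k] * \<phi> p [e i, e j, e k]) = 0"
    proof -
      have "(\<Sum>i\<in>UNIV. \<Sum>j\<in>UNIV. \<Sum>k\<in>UNIV. ?N x [e i, e j, e k] * \<phi> p [e i, e j, e k]) =
          (\<Sum>l\<in>UNIV. ?r x (e l) * (\<Sum>i\<in>UNIV. \<Sum>j\<in>UNIV. \<Sum>k\<in>UNIV. star p [e l, e i, e j, e k] * \<phi> p [e i, e j, e k]))"
        unfolding comm sum_distrib_left by (rule sum.swap)
      then show ?thesis unfolding star_def C.star_\<phi>_full_contraction by simp
    qed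
    let ?S = "\<Sum>i\<in>UNIV. \<Sum>j\<in>UNIV. \<Sum>k\<in>UNIV. ?N (e i) [x, e j, e k] * \<phi> p [e i, e j, e k]"
    have 3: "(\<Sum>i\<in>UNIV. \<Sum>j\<in>UNIV. \<Sum>k\<in>UNIV. ?N (e j) [x, e i, e k] * \<phi> p [e i, e j, e k]) = - ?S"
    proof -
      have "?N (e j) [x, e i, e k] * \<phi> p [e i, e j, e k] = - (?N (e j) [x, e i, e k] * \<phi> p [e j, e i, e k])" for i j k
        using C.\<phi>_alt(1)[of "e i" "e j" "e k"] by simp
      then show ?thesis by (subst sum.swap) (simp add: sum_negf)
    qed
    have 4: "(\<Sum>i\<in>UNIV. \<Sum>j\<in>UNIV. \<Sum>k\<in>UNIV. ?N (e k) [x, e i, e j] * \<phi> p [e i, e j, e k]) = ?S"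
    proof -
      have "(\<Sum>i\<in>UNIV. \<Sum>j\<in>UNIV. \<Sum>k\<in>UNIV. ?N (e k) [x, e i, e j] * \<phi> p [e i, e j, e k]) =
          (\<Sum>i\<in>UNIV. \<Sum>k\<in>UNIV. \<Sum>j\<in>UNIV. ?N (e k) [x, e i, e j] * \<phi> p [e i, e j, e k])"
        by (rule sum.cong[OF refl], rule sum.swap)
      also have "\<dots> = (\<Sum>i\<in>UNIV. \<Sum>k\<in>UNIV. \<Sum>j\<in>UNIV. ?N (e k) [x, e i, e j] * \<phi> p [e k, e i, e j])"
        by (intro sum.cong refl arg_cong2[where f = "(*)"] C.\<phi>_cyclic)
      also have "\<dots> = ?S" by (rule sum.swap)
      finally show ?thesis .
    qed
    have "(\<Sum>i\<in>UNIV. \<Sum>j\<in>UNIV. \<Sum>k\<in>UNIV. ext_deriv B \<phi> p [x, e i, e j, e k] * \<phi> p [e i, e j, e k]) = - 3 * ?S"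
      unfolding ext_deriv_\<phi> distrib_right left_diff_distrib sum.distrib sum_subtractf 1 3 4 by simp
    also have "?S = - 4 * (\<Sum>i\<in>UNIV. \<Sum>l\<in>UNIV. ?r (e i) (e l) * \<phi> p [e i, e l, x])"
      unfolding 2 by (simp add: sum_distrib_left)
    finally show ?thesis by simp
  qed
  finally show ?thesis by simp
qed

end


section \<open>Hypersurfaces\<close>

lemma multilinear_2I:
  fixes F :: "'n::finite tensor"
  assumes "\<And>y. linear (\<lambda>v. F [v, y])" "\<And>x. linear (\<lambda>v. F [x, v])" shows "multilinear 2 F"
  unfolding multilinear_def
proof (intro allI impI)
  fix xs :: "(real^'n) list" and i :: nat assume "length xs = 2" "i < 2"
  then obtain x y where "xs = [x, y]" "i = 0 \<or> i = 1"
    by (auto simp: numeral_2_eq_2 length_Suc_conv less_Suc_eq)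
  then show "linear (\<lambda>v. F (xs[i := v]))" using assms by auto
qed

locale hypersurface = g2_manifold N \<phi> + M: riemannian M
  for N :: "('l::topological_space, 7) riem" and \<phi> and M :: "('m::topological_space, 6) riem" +
  fixes \<iota> :: "'m \<Rightarrow> 'l" and n :: "'m \<Rightarrow> real^7"
  assumes immersion: "smooth_immersion (mfd_atlas M) (mfd_atlas N) \<iota>"
    and induced: "induced_metric M N \<iota>" and normal: "unit_normal_field M N \<iota> n"
begin

abbreviation "A \<equiv> mfd_atlas M"
abbreviation "gM \<equiv> mfd_metric M"
abbreviation "d\<iota> \<equiv> differential A B \<iota>"
abbreviation "I \<equiv> su3_I M N \<phi> \<iota> n"
abbreviation "\<omega> \<equiv> su3_omega M N \<phi> \<iota> n"

lemma \<iota>_smooth: "smooth_map A B \<iota>" and d\<iota>_inj: "inj (d\<iota> p)"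
  using immersion unfolding smooth_immersion_def by blast+

lemma d\<iota>_eqD: "d\<iota> p x = d\<iota> p y \<Longrightarrow> x = y"
  using d\<iota>_inj by (rule injD)

lemma d\<iota>_linear: "linear (d\<iota> p)"
  unfolding differential_eq
  by (rule chart_deriv_linear[OF M.atlas_axioms atlas_axioms \<iota>_smooth M.mem_dom mem_dom])

lemma gM_eq: "gM p [x, y] = g (\<iota> p) [d\<iota> p x, d\<iota> p y]"
  using induced unfolding induced_metric_def pullback_def by simp

lemma n_unit: "g (\<iota> p) [n p, n p] = 1" and n_normal: "g (\<iota> p) [n p, d\<iota> p x] = 0"
  and n_smooth: "smooth_along A B \<iota> UNIV n"
  using normal unfolding unit_normal_field_def by blast+

text \<open>The image of the differential has dimension 6 and lies in the hyperplane orthogonal to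
  the normal, hence equals it.\<close>

lemma tangent_range:
  assumes "g (\<iota> p) [n p, w] = 0" shows "\<exists>y. d\<iota> p y = w"
proof -
  note lin = multilinear_2[OF metric_multilinear[of "\<iota> p"]]
  let ?K = "{w. g (\<iota> p) [n p, w] = 0}"
  have K: "subspace ?K"
    by (auto simp: subspace_def linear_0[OF lin(2)] linear_add[OF lin(2)] linear_scale[OF lin(2)])
  have R: "subspace (range (d\<iota> p))" by (rule linear_subspace_image[OF d\<iota>_linear subspace_UNIV])
  have sub: "range (d\<iota> p) \<subseteq> ?K" using n_normal by auto
  have "dim (range (d\<iota> p)) = dim (UNIV :: (real^6) set)"
    using d\<iota>_linear d\<iota>_inj by (intro dim_image_eq) (auto simp: inj_on_def inj_def)
  then have "dim (range (d\<iota> p)) = 6" by simp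
  moreover have "dim ?K < dim (UNIV :: (real^7) set)"
  proof (rule dim_psubset)
    have "n p \<notin> ?K" using n_unit by simp
    then show "span ?K \<subset> span UNIV" using K by (auto simp: span_eq_iff[THEN iffD2])
  qed
  ultimately have "dim ?K \<le> dim (range (d\<iota> p))" by simp
  then have "range (d\<iota> p) = ?K" using R K sub by (rule subspace_dim_equal[rotated 3])
  then have "w \<in> range (d\<iota> p)" using assms by (simp only: mem_Collect_eq)
  then show ?thesis by (rule rangeE) (rule exI, rule sym)
qed

lemma g_cross: "g q [g2_cross N \<phi> q x y, z] = \<phi> q [x, y, z]"
proof -
  have ex: "\<exists>v. \<forall>z. g q [v, z] = \<phi> q [x, y, z]"
    by (rule riesz[OF metric_multilinear metric_pos multilinear_3(3)[OF \<phi>_multilinear]])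
  have "\<exists>!v. \<forall>z. g q [v, z] = \<phi> q [x, y, z]"
    using ex inner_product_eqI[OF metric_multilinear metric_pos, of q] by (intro ex_ex1I) auto
  from theI'[OF this] show ?thesis unfolding g2_cross_def by blast
qed

lemma d\<iota>_I: "d\<iota> p (I p x) = g2_cross N \<phi> (\<iota> p) (n p) (d\<iota> p x)"
proof -
  obtain e where e: "cayley (g (\<iota> p)) (\<phi> (\<iota> p)) e" using exists_cayley by blast
  have "g (\<iota> p) [n p, g2_cross N \<phi> (\<iota> p) (n p) (d\<iota> p x)] = 0"
    by (simp add: metric_sym[of _ "n p"] g_cross cayley.\<phi>_repeat[OF e])
  then obtain y where y: "d\<iota> p y = g2_cross N \<phi> (\<iota> p) (n p) (d\<iota> p x)" using tangent_range by blast
  have "\<exists>!y. d\<iota> p y = g2_cross N \<phi> (\<iota> p) (n p) (d\<iota> p x)"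
    by (rule ex1I[where a = y]) (rule y, rule d\<iota>_eqD[of p], simp add: y)
  from theI'[OF this] show ?thesis unfolding su3_I_def Let_def .
qed

lemma \<omega>_eq: "\<omega> p [x, y] = \<phi> (\<iota> p) [n p, d\<iota> p y, d\<iota> p x]"
  by (simp add: su3_omega_def gM_eq d\<iota>_I metric_sym[of _ "d\<iota> p x"] g_cross)

lemma I_linear: "linear (I p)"
proof -
  have "gM p [x, I p y] = \<phi> (\<iota> p) [n p, d\<iota> p y, d\<iota> p x]" for x y
    using \<omega>_eq[of p x y] by (simp add: su3_omega_def)
  then have e: "gM p [I p y, x] = \<phi> (\<iota> p) [n p, d\<iota> p y, d\<iota> p x]" for x y
    by (simp add: M.metric_sym[of _ "I p y"])
  note lin = multilinear_2(1)[OF M.metric_multilinear[of p]] multilinear_3(2)[OF \<phi>_multilinear[of "\<iota> p"]]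
  have eqI: "v = w" if "\<And>z. gM p [v, z] = gM p [w, z]" for v w
    by (rule inner_product_eqI[OF M.metric_multilinear M.metric_pos that])
  show ?thesis
    by (intro linearI eqI)
       (simp_all add: linear_add[OF lin(1)] linear_scale[OF lin(1)] e linear_add[OF d\<iota>_linear] linear_scale[OF d\<iota>_linear]
          linear_add[OF lin(2)] linear_scale[OF lin(2)])
qed

lemma pull_n_star_phi_eq:
  "length xs = 3 \<Longrightarrow> pull_n_star_phi M N \<phi> \<iota> n p xs = star (\<iota> p) (n p # map (d\<iota> p) xs)"
  by (simp add: pull_n_star_phi_def interior_mult_def g2_hodge_star)

lemma \<omega>_multilinear: "multilinear 2 (\<omega> p)"
  and pull_phi_multilinear: "multilinear 3 (pull_phi M N \<phi> \<iota> p)"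
  and pull_n_star_phi_multilinear: "multilinear 3 (pull_n_star_phi M N \<phi> \<iota> n p)"
proof -
  note lin = multilinear_3[OF \<phi>_multilinear[of "\<iota> p"]] multilinear_4[OF star_multilinear[of "\<iota> p"]]
  have d: "linear (\<lambda>v. L (d\<iota> p v))" if "linear L" for L :: "real^7 \<Rightarrow> real"
    using linear_compose[OF d\<iota>_linear that] by (simp add: comp_def)
  show "multilinear 2 (\<omega> p)"
    by (rule multilinear_2I; unfold \<omega>_eq) (rule d lin)+
  show "multilinear 3 (pull_phi M N \<phi> \<iota> p)"
    by (rule multilinear_3I; unfold pull_phi_def pullback_def list.map) (rule d lin)+
  show "multilinear 3 (pull_n_star_phi M N \<phi> \<iota> n p)"
    by (rule multilinear_3I; simp add: pull_n_star_phi_eq) (rule d lin)+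
qed

end

locale hypersurface_point = hypersurface N \<phi> M \<iota> n
  for N :: "('l::topological_space, 7) riem" and \<phi> and M :: "('m::topological_space, 6) riem" and \<iota> n +
  fixes p :: 'm
begin

abbreviation "u0 \<equiv> coord_at A p p"
definition "Dom = coord_at A p ` (dom_at A p \<inter> \<iota> -` dom_at B (\<iota> p))"
definition "F = coord_at B (\<iota> p) \<circ> \<iota> \<circ> param_at A p"
definition "DF u = frechet_derivative F (at u)"
definition "field a u = (case a of None \<Rightarrow> along_in_chart A B \<iota> p n u | Some y \<Rightarrow> DF u y)"
definition "Dfield a x = frechet_derivative (field a) (at u0) x + levi_civita N (\<iota> p) (d\<iota> p x) (field a u0)"

text \<open>\<open>field None\<close> is the normal field and \<open>field (Some y)\<close> the image of a vector field with constant
  components \<open>y\<close>; \<open>Dfield\<close> is their derivative in the pulled back Levi-Civita connection.\<close>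

lemma open_Dom: "open Dom"
  unfolding Dom_def by (rule open_chart_preimage[OF M.atlas_axioms atlas_axioms \<iota>_smooth])

lemma u0_Dom: "u0 \<in> Dom"
  unfolding Dom_def using M.mem_dom mem_dom by blast

lemma DomD:
  assumes "u \<in> Dom"
  shows "param_at A p u \<in> dom_at A p" "\<iota> (param_at A p u) \<in> dom_at B (\<iota> p)" "coord_at A p (param_at A p u) = u"
    "F u \<in> coord_at B (\<iota> p) ` dom_at B (\<iota> p)" "param_at B (\<iota> p) (F u) = \<iota> (param_at A p u)"
  using assms by (auto simp: Dom_def F_def M.param_coord param_coord)

lemma F_u0: "F u0 = coord_at B (\<iota> p) (\<iota> p)"
  by (simp add: F_def M.param_coord M.mem_dom)

lemma F_smooth: "smooth_on Dom F"
  unfolding Dom_def F_def by (rule smooth_map_chart[OF M.atlas_axioms atlas_axioms \<iota>_smooth])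

lemma DF_u0: "DF u0 = d\<iota> p"
  by (simp add: DF_def F_def differential_def)

text \<open>Both sides are the derivative of \<iota> between the charts at \<open>p\<close> and at
  \<iota> \<open>q\<close>, factored through the chart at \<open>q\<close> on the left and through
  the chart at \<iota> \<open>p\<close> on the right.\<close>

lemma d\<iota>_chart:
  assumes "u \<in> Dom"
  defines "q \<equiv> param_at A p u"
  shows "d\<iota> q (coord_change A p q q y) = coord_change B (\<iota> p) (\<iota> q) (\<iota> q) (DF u y)"
proof -
  note D = DomD(1-3)[OF assms(1), folded q_def]
  have "d\<iota> q (coord_change A p q q y) = chart_deriv A B \<iota> p (\<iota> q) q y"
    unfolding differential_eq coord_change_eq
    by (rule chart_deriv_chain[OF M.atlas_axioms M.atlas_axioms atlas_axioms M.smooth_map_id \<iota>_smooth])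
      (use D M.mem_dom mem_dom in auto)
  also have "\<dots> = coord_change B (\<iota> p) (\<iota> q) (\<iota> q) (chart_deriv A B \<iota> p (\<iota> p) q y)"
    unfolding coord_change_eq
    by (rule chart_deriv_chain[OF M.atlas_axioms atlas_axioms atlas_axioms \<iota>_smooth smooth_map_id, symmetric])
      (use D mem_dom in auto)
  also have "chart_deriv A B \<iota> p (\<iota> p) q y = DF u y"
    by (simp add: chart_deriv_def DF_def F_def D(3))
  finally show ?thesis .
qed

lemma field_None:
  assumes "u \<in> Dom"
  defines "q \<equiv> param_at A p u"
  shows "coord_change B (\<iota> p) (\<iota> q) (\<iota> q) (field None u) = n q"
  unfolding field_def option.case along_in_chart_def Let_def q_def
  by (rule coord_change_inverse[OF DomD(2)[OF assms(1)] mem_dom])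

lemma field_u0: "field None u0 = n p" "field (Some y) u0 = d\<iota> p y"
  by (simp_all add: field_def along_in_chart_def Let_def M.param_coord M.mem_dom coord_change_same mem_dom DF_u0)

lemma field_derivative: "(field a has_derivative frechet_derivative (field a) (at u0)) (at u0)"
proof (cases a)
  case None
  have "UNIV \<inter> dom_at A p \<inter> \<iota> -` dom_at B (\<iota> p) = dom_at A p \<inter> \<iota> -` dom_at B (\<iota> p)" by simp
  then have "smooth_on Dom (along_in_chart A B \<iota> p n)"
    using n_smooth unfolding smooth_along_def Dom_def by metis
  then have "smooth_on Dom (field None)" by (simp add: field_def[abs_def])
  then show ?thesis using smooth_on_has_derivative[OF _ u0_Dom] None by simp
next
  case (Some y)
  have "smooth_on Dom (field (Some y))"
    using smooth_on_frechet_derivative[OF F_smooth, of y] by (simp add: field_def[abs_def] DF_def)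
  then show ?thesis using smooth_on_has_derivative[OF _ u0_Dom] Some by simp
qed

lemma tensor_field_derivative:
  assumes "\<And>q. multilinear k (b q)"
    and "\<And>ys. length ys = k \<Longrightarrow> (\<lambda>v. tensor_in_chart B (\<iota> p) b v ys) differentiable (at (coord_at B (\<iota> p) (\<iota> p)))"
    and "length as = k"
  shows "((\<lambda>u. tensor_in_chart B (\<iota> p) b (F u) (map (\<lambda>a. field a u) as)) has_derivative
    (\<lambda>x. nabla N b (\<iota> p) (d\<iota> p x) (map (\<lambda>a. field a u0) as)
      + (\<Sum>i<k. b (\<iota> p) ((map (\<lambda>a. field a u0) as)[i := Dfield (as ! i) x])))) (at u0)"
proof -
  have m: "map (\<lambda>i. field (as ! i) u) [0..<k] = map (\<lambda>a. field a u) as" for u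
    using assms(3) by (intro nth_equalityI) auto
  have "(F has_derivative d\<iota> p) (at u0)"
    using smooth_on_has_derivative[OF F_smooth u0_Dom] DF_u0 unfolding DF_def by simp
  from has_derivative_tensor_along[OF this F_u0 open_Dom u0_Dom _ assms(1,2), of "\<lambda>i. field (as ! i)"
      "\<lambda>i. frechet_derivative (field (as ! i)) (at u0)" "levi_civita N (\<iota> p)"]
  show ?thesis using DomD(4) field_derivative unfolding m nabla_def Dfield_def by auto
qed

text \<open>The bridge between the fixed ambient chart, in which one differentiates, and the tensors
  at the moving point of the hypersurface.\<close>

lemma tensor_in_chart_field:
  assumes "u \<in> Dom"
  shows "tensor_in_chart B (\<iota> p) b (F u) (map (\<lambda>a. field a u) as) =
    b (\<iota> (param_at A p u)) (map (\<lambda>a. case a of None \<Rightarrow> n (param_at A p u)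
      | Some y \<Rightarrow> d\<iota> (param_at A p u) (coord_change A p (param_at A p u) (param_at A p u) y)) as)"
  unfolding tensor_in_chart_def Let_def DomD(5)[OF assms] map_map comp_def
  using field_None[OF assms] d\<iota>_chart[OF assms]
  by (intro arg_cong2[where f = b] refl map_cong) (auto simp: field_def split: option.splits)

lemma frechet_derivative_field:
  assumes "\<And>q. multilinear k (b q)"
    and "\<And>ys. length ys = k \<Longrightarrow> (\<lambda>v. tensor_in_chart B (\<iota> p) b v ys) differentiable (at (coord_at B (\<iota> p) (\<iota> p)))"
    and "length as = k"
    and "\<And>u. u \<in> Dom \<Longrightarrow> f u = tensor_in_chart B (\<iota> p) b (F u) (map (\<lambda>a. field a u) as)"
  shows "f differentiable (at u0)"
    and "frechet_derivative f (at u0) x = nabla N b (\<iota> p) (d\<iota> p x) (map (\<lambda>a. field a u0) as)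
      + (\<Sum>i<k. b (\<iota> p) ((map (\<lambda>a. field a u0) as)[i := Dfield (as ! i) x]))"
proof -
  have "(f has_derivative
    (\<lambda>x. nabla N b (\<iota> p) (d\<iota> p x) (map (\<lambda>a. field a u0) as)
      + (\<Sum>i<k. b (\<iota> p) ((map (\<lambda>a. field a u0) as)[i := Dfield (as ! i) x])))) (at u0)"
    by (rule has_derivative_transform_within_open[OF tensor_field_derivative[OF assms(1-3)] open_Dom u0_Dom])
      (assumption | erule assms(4)[symmetric])+
  note d = this
  then show "f differentiable (at u0)" unfolding differentiable_def by blast
  show "frechet_derivative f (at u0) x = nabla N b (\<iota> p) (d\<iota> p x) (map (\<lambda>a. field a u0) as)
      + (\<Sum>i<k. b (\<iota> p) ((map (\<lambda>a. field a u0) as)[i := Dfield (as ! i) x]))"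
    using fun_cong[OF frechet_derivative_at[OF d], of x] by simp
qed

section \<open>The formulas of Gauss and Weingarten\<close>

abbreviation "ga \<equiv> g (\<iota> p)"
abbreviation "S x y \<equiv> Dfield (Some y) x"
abbreviation "W x \<equiv> Dfield None x"
definition "II x y = scalar_second_ff M N \<iota> n p [x, y]"

text \<open>Second partial derivatives of the immersion commute and the ambient connection is
  torsion-free.\<close>

lemma S_sym: "S x y = S y x"
proof -
  have "frechet_derivative (field (Some y)) (at u0) x = frechet_derivative (field (Some x)) (at u0) y"
    using second_derivative_symmetric[OF open_Dom u0_Dom F_smooth, of y x]
    by (simp add: field_def[abs_def] DF_def)
  then show ?thesis using levi_civita(2)[of "\<iota> p" "d\<iota> p x" "d\<iota> p y"] by (simp add: Dfield_def field_u0)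
qed

lemma II_eq: "II x y = ga [S x y, n p]"
proof -
  have "along_in_chart A B \<iota> p (\<lambda>q. d\<iota> q (const_ext A p y q)) u = field (Some y) u" if "u \<in> Dom" for u
    unfolding along_in_chart_def Let_def const_ext_def d\<iota>_chart[OF that] field_def option.case
    by (rule coord_change_inverse[OF mem_dom DomD(2)[OF that]])
  then have "(along_in_chart A B \<iota> p (\<lambda>q. d\<iota> q (const_ext A p y q)) has_derivative frechet_derivative (field (Some y)) (at u0)) (at u0)"
    by (intro has_derivative_transform_within_open[OF field_derivative open_Dom u0_Dom]) simp
  then have "frechet_derivative (along_in_chart A B \<iota> p (\<lambda>q. d\<iota> q (const_ext A p y q))) (at u0) =
      frechet_derivative (field (Some y)) (at u0)"
    by (rule frechet_derivative_at[symmetric])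
  then have "cov_along A B (levi_civita N (\<iota> p)) \<iota> (\<lambda>q. d\<iota> q (const_ext A p y q)) p x = S x y"
    by (simp add: cov_along_def Dfield_def field_u0 const_ext_def M.coord_change_same M.mem_dom)
  then show ?thesis
    unfolding II_def scalar_second_ff_def second_ff_def Let_def
    by (simp add: linear_scale[OF multilinear_2(1)[OF metric_multilinear]] n_unit)
qed

lemma II_sym: "II x y = II y x"
  by (simp add: II_eq S_sym[of x y])

lemma metric_field_derivative:
  assumes "\<And>u. u \<in> Dom \<Longrightarrow> f u = tensor_in_chart B (\<iota> p) g (F u) [field a u, field b u]"
  shows "frechet_derivative f (at u0) x = ga [Dfield a x, field b u0] + ga [field a u0, Dfield b x]"
  using frechet_derivative_field(2)[OF metric_multilinear metric_differentiable, of "[a, b]" f x] assms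
  by (simp add: numeral_2_eq_2 nabla_def levi_civita(3))

lemma W_normal: "ga [W x, n p] = 0"
proof -
  have "1 = tensor_in_chart B (\<iota> p) g (F u) [field None u, field None u]" if "u \<in> Dom" for u
    using tensor_in_chart_field[OF that, of g "[None, None]"] by (simp add: n_unit)
  from metric_field_derivative[OF this, of x] show ?thesis
    by (simp add: frechet_derivative_const field_u0 metric_sym[of _ "n p"])
qed

text \<open>The derivative of the constant zero inner product of the normal with an image
  vector.\<close>

lemma W_tangent: "ga [W x, d\<iota> p y] = - II x y"
proof -
  have "0 = tensor_in_chart B (\<iota> p) g (F u) [field None u, field (Some y) u]" if "u \<in> Dom" for u
    using tensor_in_chart_field[OF that, of g "[None, Some y]"] by (simp add: n_normal)
  from metric_field_derivative[OF this, of x] show ?thesis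
    by (simp add: frechet_derivative_const field_u0 II_eq metric_sym[of _ "n p"])
qed

text \<open>The tangential part of the ambient derivative is bilinear, symmetric and compatible with
  the induced metric, so uniqueness identifies it with the Levi-Civita connection of
  \<open>M\<close>.\<close>

lemma gauss: "S x y = d\<iota> p (levi_civita M p x y) + II x y *\<^sub>R n p"
proof -
  note lin = multilinear_2[OF metric_multilinear[of "\<iota> p"]]
  have S_linear: "linear (\<lambda>y. S x y)" "linear (\<lambda>x. S x y)" for x y
  proof -
    show 1: "linear (\<lambda>x. S x y)" for y
      unfolding Dfield_def
      by (intro linear_compose_add has_derivative_linear[OF field_derivative]
          linear_compose[OF d\<iota>_linear levi_civita_linear(2), unfolded comp_def])
    show "linear (\<lambda>y. S x y)" using 1[of x] by (simp add: S_sym[of x])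
  qed
  define \<Gamma> where "\<Gamma> x y = (SOME z. d\<iota> p z = S x y - II x y *\<^sub>R n p)" for x y
  have \<Gamma>: "d\<iota> p (\<Gamma> x y) = S x y - II x y *\<^sub>R n p" for x y
  proof -
    have "ga [n p, S x y - II x y *\<^sub>R n p] = 0"
      by (subst metric_sym) (simp add: linear_diff[OF lin(1)] linear_scale[OF lin(1)] n_unit II_eq)
    then show ?thesis unfolding \<Gamma>_def using someI_ex[OF tangent_range] by blast
  qed
  note inj = d\<iota>_eqD[of p]
  have II_linear: "linear (\<lambda>y. II x y)" "linear (\<lambda>x. II x y)" for x y
    unfolding II_eq using linear_compose[OF S_linear(1) lin(1)] linear_compose[OF S_linear(2) lin(1)]
    by (simp_all add: comp_def)
  have "bilinear \<Gamma>"
    unfolding bilinear_def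
    by (intro conjI allI linearI inj; simp add: \<Gamma> linear_add[OF d\<iota>_linear] linear_scale[OF d\<iota>_linear]
      linear_add[OF S_linear(1)] linear_scale[OF S_linear(1)] linear_add[OF S_linear(2)] linear_scale[OF S_linear(2)]
      linear_add[OF II_linear(1)] linear_scale[OF II_linear(1)] linear_add[OF II_linear(2)] linear_scale[OF II_linear(2)]
      algebra_simps)
  moreover have "\<Gamma> x y = \<Gamma> y x" for x y
    by (rule inj) (simp add: \<Gamma> S_sym[of x y] II_sym[of x y])
  moreover have "cov_tensor A \<Gamma> gM p x [y, z] = 0" for x y z
  proof -
    have "tensor_in_chart A p gM u [y, z] = tensor_in_chart B (\<iota> p) g (F u) [field (Some y) u, field (Some z) u]"
      if "u \<in> Dom" for u
      using tensor_in_chart_field[OF that, of g "[Some y, Some z]"] by (simp add: tensor_in_chart_def Let_def gM_eq)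
    from metric_field_derivative[OF this, of x]
    have "frechet_derivative (\<lambda>u. tensor_in_chart A p gM u [y, z]) (at u0) x =
        ga [S x y, d\<iota> p z] + ga [d\<iota> p y, S x z]" by (simp add: field_u0)
    then show ?thesis
      by (simp add: cov_tensor_def numeral_2_eq_2 gM_eq \<Gamma> linear_diff[OF lin(1)] linear_diff[OF lin(2)]
        linear_scale[OF lin(1)] linear_scale[OF lin(2)] n_normal metric_sym[of _ _ "n p"])
  qed
  moreover have "\<exists>!\<Gamma>. bilinear \<Gamma> \<and> (\<forall>x y. \<Gamma> x y = \<Gamma> y x) \<and> (\<forall>x y z. cov_tensor A \<Gamma> gM p x [y, z] = 0)"
    by (rule M.levi_civita_unique)
  ultimately have "\<Gamma> = levi_civita M p"
    using M.levi_civita[of p] by blast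
  then show ?thesis using \<Gamma>[of x y] by simp
qed

lemma II_linear: "linear (\<lambda>y. II x y)"
proof -
  have "linear (\<lambda>x. S x y)" for y
    unfolding Dfield_def
    by (intro linear_compose_add has_derivative_linear[OF field_derivative]
        linear_compose[OF d\<iota>_linear levi_civita_linear(2), unfolded comp_def])
  then have "linear (\<lambda>y. S y x)" .
  from linear_compose[OF this multilinear_2(1)[OF metric_multilinear]]
  have "linear (\<lambda>y. ga [S y x, n p])" by (simp add: comp_def)
  then show ?thesis by (simp add: II_eq S_sym[of x])
qed

section \<open>Covariant derivatives of the induced tensors\<close>

lemma \<omega>_chart:
  assumes "u \<in> Dom"
  shows "tensor_in_chart A p \<omega> u [y, z] =
    tensor_in_chart B (\<iota> p) \<phi> (F u) (map (\<lambda>a. field a u) [None, Some z, Some y])"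
  unfolding tensor_in_chart_field[OF assms] by (simp add: tensor_in_chart_def Let_def \<omega>_eq)

lemma pull_phi_chart:
  assumes "u \<in> Dom"
  shows "tensor_in_chart A p (pull_phi M N \<phi> \<iota>) u [y, z, v] =
    tensor_in_chart B (\<iota> p) \<phi> (F u) (map (\<lambda>a. field a u) [Some y, Some z, Some v])"
  unfolding tensor_in_chart_field[OF assms] by (simp add: tensor_in_chart_def Let_def pull_phi_def pullback_def)

lemma pull_n_star_phi_chart:
  assumes "u \<in> Dom"
  shows "tensor_in_chart A p (pull_n_star_phi M N \<phi> \<iota> n) u [y, z, v] =
    tensor_in_chart B (\<iota> p) star (F u) (map (\<lambda>a. field a u) [None, Some y, Some z, Some v])"
  unfolding tensor_in_chart_field[OF assms] by (simp add: tensor_in_chart_def Let_def pull_n_star_phi_eq)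

lemma \<omega>_differentiable:
  assumes "length ys = 2" shows "(\<lambda>u. tensor_in_chart A p \<omega> u ys) differentiable (at u0)"
proof -
  obtain y z where "ys = [y, z]" using assms by (auto simp: numeral_2_eq_2 length_Suc_conv)
  then show ?thesis
    using frechet_derivative_field(1)[OF \<phi>_multilinear \<phi>_differentiable _ \<omega>_chart] by simp
qed

text \<open>The normal part in \<open>gauss\<close> would put \<open>n\<close> into two slots of
  \<phi>. So the second fundamental form enters only through the derivative \<open>W x\<close> of
  the normal.\<close>

lemma nabla_\<omega>:
  "nabla M \<omega> p x [y, z] = nabla N \<phi> (\<iota> p) (d\<iota> p x) [n p, d\<iota> p z, d\<iota> p y] + \<phi> (\<iota> p) [W x, d\<iota> p z, d\<iota> p y]"
proof -
  obtain e where "cayley ga (\<phi> (\<iota> p)) e" using exists_cayley by blast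
  then interpret C: cayley ga "\<phi> (\<iota> p)" e .
  have "frechet_derivative (\<lambda>u. tensor_in_chart A p \<omega> u [y, z]) (at u0) x =
      nabla N \<phi> (\<iota> p) (d\<iota> p x) [n p, d\<iota> p z, d\<iota> p y] + (\<phi> (\<iota> p) [W x, d\<iota> p z, d\<iota> p y]
      + \<phi> (\<iota> p) [n p, S x z, d\<iota> p y] + \<phi> (\<iota> p) [n p, d\<iota> p z, S x y])"
    using frechet_derivative_field(2)[OF \<phi>_multilinear \<phi>_differentiable _ \<omega>_chart, where x = x]
    by (simp add: numeral_3_eq_3 field_u0)
  then show ?thesis
    by (simp add: nabla_def[of M] cov_tensor_def numeral_2_eq_2 \<omega>_eq gauss C.\<phi>_simps C.\<phi>_repeat)
qed

text \<open>No slot is occupied by \<open>n\<close> here, so the normal parts in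
  \<open>gauss\<close> survive as the terms with \<open>II\<close>.\<close>

lemma nabla_pull_phi:
  shows "length ys = 3 \<Longrightarrow> (\<lambda>u. tensor_in_chart A p (pull_phi M N \<phi> \<iota>) u ys) differentiable (at u0)"
    and "nabla M (pull_phi M N \<phi> \<iota>) p x [a, b, c] = nabla N \<phi> (\<iota> p) (d\<iota> p x) [d\<iota> p a, d\<iota> p b, d\<iota> p c]
      + II x a * \<phi> (\<iota> p) [n p, d\<iota> p b, d\<iota> p c] + II x b * \<phi> (\<iota> p) [d\<iota> p a, n p, d\<iota> p c]
      + II x c * \<phi> (\<iota> p) [d\<iota> p a, d\<iota> p b, n p]"
proof -
  obtain e where "cayley ga (\<phi> (\<iota> p)) e" using exists_cayley by blast
  then interpret C: cayley ga "\<phi> (\<iota> p)" e .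
  show "(\<lambda>u. tensor_in_chart A p (pull_phi M N \<phi> \<iota>) u ys) differentiable (at u0)" if len: "length ys = 3"
  proof -
    obtain a b c where "ys = [a, b, c]" using len by (auto simp: numeral_3_eq_3 length_Suc_conv)
    then show ?thesis
      using frechet_derivative_field(1)[OF \<phi>_multilinear \<phi>_differentiable _ pull_phi_chart] by simp
  qed
  have "frechet_derivative (\<lambda>u. tensor_in_chart A p (pull_phi M N \<phi> \<iota>) u [a, b, c]) (at u0) x =
      nabla N \<phi> (\<iota> p) (d\<iota> p x) [d\<iota> p a, d\<iota> p b, d\<iota> p c] + (\<phi> (\<iota> p) [S x a, d\<iota> p b, d\<iota> p c]
      + \<phi> (\<iota> p) [d\<iota> p a, S x b, d\<iota> p c] + \<phi> (\<iota> p) [d\<iota> p a, d\<iota> p b, S x c])"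
    using frechet_derivative_field(2)[OF \<phi>_multilinear \<phi>_differentiable _ pull_phi_chart, where x = x]
    by (simp add: numeral_3_eq_3 field_u0)
  then show "nabla M (pull_phi M N \<phi> \<iota>) p x [a, b, c] = nabla N \<phi> (\<iota> p) (d\<iota> p x) [d\<iota> p a, d\<iota> p b, d\<iota> p c]
      + II x a * \<phi> (\<iota> p) [n p, d\<iota> p b, d\<iota> p c] + II x b * \<phi> (\<iota> p) [d\<iota> p a, n p, d\<iota> p c]
      + II x c * \<phi> (\<iota> p) [d\<iota> p a, d\<iota> p b, n p]"
    by (simp add: nabla_def[of M] cov_tensor_def numeral_3_eq_3 pull_phi_def pullback_def gauss C.\<phi>_simps)
qed

lemma nabla_pull_n_star_phi:
  shows "length ys = 3 \<Longrightarrow> (\<lambda>u. tensor_in_chart A p (pull_n_star_phi M N \<phi> \<iota> n) u ys) differentiable (at u0)"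
    and "nabla M (pull_n_star_phi M N \<phi> \<iota> n) p x [a, b, c] =
      nabla N star (\<iota> p) (d\<iota> p x) [n p, d\<iota> p a, d\<iota> p b, d\<iota> p c] + star (\<iota> p) [W x, d\<iota> p a, d\<iota> p b, d\<iota> p c]"
proof -
  obtain e where "cayley ga (\<phi> (\<iota> p)) e" using exists_cayley by blast
  then interpret C: cayley ga "\<phi> (\<iota> p)" e .
  have rep: "star (\<iota> p) [v, v, y, z] = 0" "star (\<iota> p) [v, y, v, z] = 0" "star (\<iota> p) [v, y, z, v] = 0" for v y z
    using alternating_4D[OF C.star_alternating, folded star_def]
    by (metis (no_types) neg_equal_zero neg_0_equal_iff_equal)+
  note simps = C.star_simps[folded star_def]
  show "(\<lambda>u. tensor_in_chart A p (pull_n_star_phi M N \<phi> \<iota> n) u ys) differentiable (at u0)" if len: "length ys = 3"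
  proof -
    obtain a b c where "ys = [a, b, c]" using len by (auto simp: numeral_3_eq_3 length_Suc_conv)
    then show ?thesis
      using frechet_derivative_field(1)[OF star_multilinear star_differentiable _ pull_n_star_phi_chart] by simp
  qed
  have "frechet_derivative (\<lambda>u. tensor_in_chart A p (pull_n_star_phi M N \<phi> \<iota> n) u [a, b, c]) (at u0) x =
      nabla N star (\<iota> p) (d\<iota> p x) [n p, d\<iota> p a, d\<iota> p b, d\<iota> p c] + (star (\<iota> p) [W x, d\<iota> p a, d\<iota> p b, d\<iota> p c]
      + star (\<iota> p) [n p, S x a, d\<iota> p b, d\<iota> p c] + star (\<iota> p) [n p, d\<iota> p a, S x b, d\<iota> p c]
      + star (\<iota> p) [n p, d\<iota> p a, d\<iota> p b, S x c])"
    using frechet_derivative_field(2)[OF star_multilinear star_differentiable _ pull_n_star_phi_chart, where x = x]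
    by (simp add: eval_nat_numeral field_u0)
  then show "nabla M (pull_n_star_phi M N \<phi> \<iota> n) p x [a, b, c] =
      nabla N star (\<iota> p) (d\<iota> p x) [n p, d\<iota> p a, d\<iota> p b, d\<iota> p c] + star (\<iota> p) [W x, d\<iota> p a, d\<iota> p b, d\<iota> p c]"
    by (simp add: nabla_def[of M] cov_tensor_def numeral_3_eq_3 pull_n_star_phi_eq gauss simps rep)
qed

text \<open>Once I Y is known to be differentiable, this is the derivative of the equation g(z, I Y)
  = \<omega>(z, Y) with the metric parallel.\<close>

lemma nabla_endo_I: "gM p [z, nabla_endo M I p x y] = nabla M \<omega> p x [z, y]"
proof -
  let ?U = "coord_at A p ` dom_at A p" and ?\<Gamma> = "levi_civita M p"
  have u0: "u0 \<in> ?U" using M.mem_dom by blast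
  define J where "J = along_in_chart A A (\<lambda>q. q) p (\<lambda>q. I q (const_ext A p y q))"
  have J: "coord_change A p (param_at A p u) (param_at A p u) (J u) =
      I (param_at A p u) (coord_change A p (param_at A p u) (param_at A p u) y)" if "u \<in> ?U" for u
    unfolding J_def along_in_chart_def Let_def const_ext_def
    by (rule M.coord_change_inverse) (use that M.mem_dom in \<open>auto simp: M.param_coord\<close>)
  have G: "tensor_in_chart A p gM u [z, J u] = tensor_in_chart A p \<omega> u [z, y]" if "u \<in> ?U" for u z
    by (simp add: tensor_in_chart_def Let_def J[OF that] su3_omega_def)
  have J0: "J u0 = I p y"
    by (simp add: J_def along_in_chart_def Let_def const_ext_def M.param_coord M.mem_dom M.coord_change_same)
  \<comment> \<open>\<open>su3_I\<close> is a definite description, so smoothness is not built in.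
    The components of I Y solve a linear system whose matrix is the metric and whose right side is
    differentiable.\<close>
  have "J differentiable (at u0)"
  proof (rule linear_system_differentiable[OF M.open_image u0])
    let ?A = "\<lambda>u. (\<chi> i j. tensor_in_chart A p gM u [axis i 1, axis j 1]) :: real^6^6"
    show "(\<lambda>v. ?A v $ i $ j) differentiable (at u0)" for i j
      using M.metric_differentiable by simp
    show "det (?A u0) \<noteq> 0"
      using inner_product_det[OF M.metric_multilinear M.metric_pos, of p] by (simp add: M.tensor_in_chart_at)
    show "(\<lambda>v. (\<chi> i. tensor_in_chart A p \<omega> v [axis i 1, y]) $ i) differentiable (at u0)" for i :: 6
      using \<omega>_differentiable by simp
    show "?A v *v J v = (\<chi> i. tensor_in_chart A p \<omega> v [axis i 1, y])" if "v \<in> ?U" for v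
    proof -
      have "(?A v *v J v) $ i = tensor_in_chart A p gM v [axis i 1, J v]" for i
        by (subst linear_axis_sum[OF multilinear_2(2)[OF M.tensor_in_chart_multilinear[OF that M.metric_multilinear]]])
          (simp add: matrix_vector_mult_def mult.commute)
      then show ?thesis by (simp add: vec_eq_iff G[OF that])
    qed
  qed
  then have DJ: "(J has_derivative frechet_derivative J (at u0)) (at u0)"
    by (simp add: frechet_derivative_works)
  have X: "([\<lambda>u. z, J] ! i has_derivative [\<lambda>h. 0, frechet_derivative J (at u0)] ! i) (at u0)" if "i < 2" for i
    using that DJ by (auto simp: numeral_2_eq_2 less_Suc_eq)
  have "((\<lambda>u. tensor_in_chart A p gM u [z, J u]) has_derivative
      (\<lambda>h. gM p [?\<Gamma> h z, I p y] + gM p [z, frechet_derivative J (at u0) h + ?\<Gamma> h (I p y)])) (at u0)"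
    using M.has_derivative_tensor_along[where X = "(!) [\<lambda>u. z, J]" and DX = "(!) [\<lambda>h. 0, frechet_derivative J (at u0)]"
        and \<Gamma> = ?\<Gamma>, OF has_derivative_ident refl M.open_image u0 _ M.metric_multilinear M.metric_differentiable X]
    by (simp add: numeral_2_eq_2 M.levi_civita(3) J0)
  then have "((\<lambda>u. tensor_in_chart A p \<omega> u [z, y]) has_derivative
      (\<lambda>h. gM p [?\<Gamma> h z, I p y] + gM p [z, frechet_derivative J (at u0) h + ?\<Gamma> h (I p y)])) (at u0)"
    by (rule has_derivative_transform_within_open[OF _ M.open_image u0]) (simp add: G)
  from fun_cong[OF frechet_derivative_at[OF this], of x]
  have "frechet_derivative (\<lambda>u. tensor_in_chart A p \<omega> u [z, y]) (at u0) x =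
      gM p [?\<Gamma> x z, I p y] + gM p [z, frechet_derivative J (at u0) x + ?\<Gamma> x (I p y)]" by simp
  then have 1: "nabla M \<omega> p x [z, y] = gM p [z, frechet_derivative J (at u0) x + ?\<Gamma> x (I p y)] - gM p [z, I p (?\<Gamma> x y)]"
    by (simp add: nabla_def cov_tensor_def numeral_2_eq_2 su3_omega_def)
  have d: "differential A A (\<lambda>q. q) p x = x"
    by (simp add: differential_eq coord_change_eq[symmetric] M.coord_change_same M.mem_dom)
  have "along_in_chart A A (\<lambda>q. q) p (const_ext A p y) u = y" if "u \<in> ?U" for u
    unfolding along_in_chart_def Let_def const_ext_def
    by (rule M.coord_change_inverse) (use that M.mem_dom in \<open>auto simp: M.param_coord\<close>)
  then have "(along_in_chart A A (\<lambda>q. q) p (const_ext A p y) has_derivative (\<lambda>h. 0)) (at u0)"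
    by (intro has_derivative_transform_within_open[OF has_derivative_const[of y] M.open_image u0]) simp
  from fun_cong[OF frechet_derivative_at[OF this], of x]
  have c: "frechet_derivative (along_in_chart A A (\<lambda>q. q) p (const_ext A p y)) (at u0) x = 0" by simp
  have "const_ext A p y p = y" by (simp add: const_ext_def M.coord_change_same M.mem_dom)
  then have "nabla_endo M I p x y = frechet_derivative J (at u0) x + ?\<Gamma> x (I p y) - I p (?\<Gamma> x y)"
    by (simp add: nabla_endo_def Let_def cov_along_def d c J_def)
  then show ?thesis
    by (simp add: 1 linear_diff[OF multilinear_2(2)[OF M.metric_multilinear]])
qed

lemma cov_tensor_add:
  assumes "multilinear (length ys) (b p)"
  shows "cov_tensor A (\<lambda>x y. levi_civita M p x y + E x y) b p x ys =
    nabla M b p x ys - (\<Sum>i<length ys. b p (ys[i := E x (ys ! i)]))"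
  using linear_add[OF multilinear_linear_update[OF assms refl]]
  by (simp add: cov_tensor_def nabla_def sum.distrib)

text \<open>The last terms are the product rule applied to the rotation by \<theta>: its derivative
  turns each of the two rotated tensors into plus or minus the other.\<close>

lemma cov_tensor_rotate:
  fixes \<theta> :: "'m \<Rightarrow> real" and x and \<Gamma>' :: "real^6 \<Rightarrow> real^6 \<Rightarrow> real^6"
  assumes \<theta>: "smooth_tensor_field A 0 (\<lambda>p _. \<theta> p)"
    and b: "(\<lambda>u. tensor_in_chart A p b1 u ys) differentiable (at u0)" "(\<lambda>u. tensor_in_chart A p b2 u ys) differentiable (at u0)"
  defines "d\<theta> \<equiv> ext_deriv A (\<lambda>p _. \<theta> p) p [x]"
  shows "cov_tensor A \<Gamma>' (\<lambda>q xs. cos (\<theta> q) * b1 q xs - sin (\<theta> q) * b2 q xs) p x ys =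
      cos (\<theta> p) * cov_tensor A \<Gamma>' b1 p x ys - sin (\<theta> p) * cov_tensor A \<Gamma>' b2 p x ys
      - d\<theta> * (sin (\<theta> p) * b1 p ys + cos (\<theta> p) * b2 p ys)" (is ?plus)
    and "cov_tensor A \<Gamma>' (\<lambda>q xs. sin (\<theta> q) * b1 q xs + cos (\<theta> q) * b2 q xs) p x ys =
      sin (\<theta> p) * cov_tensor A \<Gamma>' b1 p x ys + cos (\<theta> p) * cov_tensor A \<Gamma>' b2 p x ys
      + d\<theta> * (cos (\<theta> p) * b1 p ys - sin (\<theta> p) * b2 p ys)" (is ?minus)
proof -
  let ?\<theta> = "\<lambda>u. \<theta> (param_at A p u)"
  let ?t = "\<lambda>b u. tensor_in_chart A p b u ys"
  have u0: "u0 \<in> coord_at A p ` dom_at A p" using M.mem_dom by blast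
  have t: "((\<lambda>u. tensor_in_chart A p (\<lambda>p _. \<theta> p) u []) has_derivative
      frechet_derivative (\<lambda>u. tensor_in_chart A p (\<lambda>p _. \<theta> p) u []) (at u0)) (at u0)"
    by (rule M.smooth_tensor_field_derivative[OF \<theta> _ u0]) simp
  then have t: "(?\<theta> has_derivative frechet_derivative ?\<theta> (at u0)) (at u0)"
    by (simp add: tensor_in_chart_def Let_def)
  have d\<theta>: "frechet_derivative ?\<theta> (at u0) x = d\<theta>"
    by (simp add: d\<theta>_def ext_deriv_def tensor_in_chart_def Let_def)
  have p: "param_at A p u0 = p" by (simp add: M.param_coord M.mem_dom)
  have D: "(?t b1 has_derivative frechet_derivative (?t b1) (at u0)) (at u0)"
    "(?t b2 has_derivative frechet_derivative (?t b2) (at u0)) (at u0)"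
    using b by (simp_all add: frechet_derivative_works)
  have "(?t (\<lambda>q xs. cos (\<theta> q) * b1 q xs - sin (\<theta> q) * b2 q xs) has_derivative
      (\<lambda>h. (cos (\<theta> p) * frechet_derivative (?t b1) (at u0) h - frechet_derivative ?\<theta> (at u0) h * sin (\<theta> p) * ?t b1 u0)
        - (sin (\<theta> p) * frechet_derivative (?t b2) (at u0) h + frechet_derivative ?\<theta> (at u0) h * cos (\<theta> p) * ?t b2 u0))) (at u0)"
    unfolding tensor_in_chart_def[of A p "\<lambda>q xs. cos (\<theta> q) * b1 q xs - sin (\<theta> q) * b2 q xs"] Let_def
      tensor_in_chart_def[of A p b1, unfolded Let_def, symmetric] tensor_in_chart_def[of A p b2, unfolded Let_def, symmetric]
    by (rule derivative_eq_intros t D | simp add: p)+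
  from fun_cong[OF frechet_derivative_at[OF this], of x] show ?plus
    by (simp add: cov_tensor_def d\<theta> M.tensor_in_chart_at sum_subtractf sum_distrib_left algebra_simps)
  have "(?t (\<lambda>q xs. sin (\<theta> q) * b1 q xs + cos (\<theta> q) * b2 q xs) has_derivative
      (\<lambda>h. (sin (\<theta> p) * frechet_derivative (?t b1) (at u0) h + frechet_derivative ?\<theta> (at u0) h * cos (\<theta> p) * ?t b1 u0)
        + (cos (\<theta> p) * frechet_derivative (?t b2) (at u0) h - frechet_derivative ?\<theta> (at u0) h * sin (\<theta> p) * ?t b2 u0))) (at u0)"
    unfolding tensor_in_chart_def[of A p "\<lambda>q xs. sin (\<theta> q) * b1 q xs + cos (\<theta> q) * b2 q xs"] Let_def
      tensor_in_chart_def[of A p b1, unfolded Let_def, symmetric] tensor_in_chart_def[of A p b2, unfolded Let_def, symmetric]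
    by (rule derivative_eq_intros t D | simp add: p)+
  from fun_cong[OF frechet_derivative_at[OF this], of x] show ?minus
    by (simp add: cov_tensor_def d\<theta> M.tensor_in_chart_at sum.distrib sum_distrib_left algebra_simps)
qed

end


section \<open>Structure constants in an adapted frame\<close>

lemma neq_numeral_6:
  "(0::6) \<noteq> 1" "(0::6) \<noteq> 2" "(0::6) \<noteq> 3" "(0::6) \<noteq> 4" "(0::6) \<noteq> 5"
    "(1::6) \<noteq> 0" "(1::6) \<noteq> 2" "(1::6) \<noteq> 3" "(1::6) \<noteq> 4" "(1::6) \<noteq> 5"
    "(2::6) \<noteq> 0" "(2::6) \<noteq> 1" "(2::6) \<noteq> 3" "(2::6) \<noteq> 4" "(2::6) \<noteq> 5"
    "(3::6) \<noteq> 0" "(3::6) \<noteq> 1" "(3::6) \<noteq> 2" "(3::6) \<noteq> 4" "(3::6) \<noteq> 5"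
    "(4::6) \<noteq> 0" "(4::6) \<noteq> 1" "(4::6) \<noteq> 2" "(4::6) \<noteq> 3" "(4::6) \<noteq> 5"
    "(5::6) \<noteq> 0" "(5::6) \<noteq> 1" "(5::6) \<noteq> 2" "(5::6) \<noteq> 3" "(5::6) \<noteq> 4"
  by simp_all

text \<open>In a Cayley frame with \<open>e 0 = n\<close>, the indices of the tangent vectors are \<open>shift 0, \<dots>, shift 5\<close>.\<close>

definition shift :: "6 \<Rightarrow> 7" where
  "shift i = (if i = 0 then 1 else if i = 1 then 2 else if i = 2 then 3 else if i = 3 then 4 else if i = 4 then 5 else 6)"

lemma shift_simps [simp]: "shift 0 = 1" "shift 1 = 2" "shift 2 = 3" "shift 3 = 4" "shift 4 = 5" "shift 5 = 6"
  unfolding shift_def by (simp_all only: neq_numeral_6 if_True if_False simp_thms)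

lemma shift_inject: "shift i = shift j \<longleftrightarrow> i = j"
  using exhaust_6[of i] exhaust_6[of j] by (elim disjE) (simp_all add: neq_numeral_7)

lemma shift_nonzero: "shift i \<noteq> 0"
  using exhaust_6[of i] by (elim disjE) (simp_all add: neq_numeral_7)

text \<open>Components of \<open>\<nabla>\<^sub>x\<omega>\<close>, where \<open>R = r(\<phi>)(x, \<cdot>)\<close> and \<open>b = - \<nabla>\<^sub>x n\<close>.\<close>

definition omega0 :: "(7 \<Rightarrow> real) \<Rightarrow> (7 \<Rightarrow> real) \<Rightarrow> 7 \<Rightarrow> 7 \<Rightarrow> real" where
  "omega0 R b i j = (\<Sum>l\<in>UNIV. R l * star0 l 0 j i) - (\<Sum>m\<in>UNIV. b m * phi0 m j i)"

text \<open>Coefficients of the endomorphism \<open>t I - 1/2 I (\<nabla>\<^sub>x I)\<close>.\<close>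

definition conn0 :: "(7 \<Rightarrow> real) \<Rightarrow> (7 \<Rightarrow> real) \<Rightarrow> real \<Rightarrow> 7 \<Rightarrow> 7 \<Rightarrow> real" where
  "conn0 R b t z k = t * phi0 0 z k - (\<Sum>y\<in>UNIV. omega0 R b (shift y) z * phi0 0 (shift y) k) / 2"

text \<open>Tabulated once, so that the case splits below become linear identities in
  \<open>R\<close> and \<open>b\<close>.\<close>

lemma omega0_table:
  assumes b: "b 0 = 0"
  shows
  "omega0 R b 1 1 = 0" "omega0 R b 1 2 = R 5 + b 4" "omega0 R b 1 3 = 0" "omega0 R b 1 4 = - R 6 - b 2"
    "omega0 R b 1 5 = - R 2 + b 6" "omega0 R b 1 6 = R 4 - b 5" "omega0 R b 2 1 = - R 5 - b 4"
    "omega0 R b 2 2 = 0" "omega0 R b 2 3 = - R 4 + b 5" "omega0 R b 2 4 = R 3 + b 1"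
    "omega0 R b 2 5 = R 1 - b 3" "omega0 R b 2 6 = 0" "omega0 R b 3 1 = 0" "omega0 R b 3 2 = R 4 - b 5"
    "omega0 R b 3 3 = 0" "omega0 R b 3 4 = - R 2 + b 6" "omega0 R b 3 5 = R 6 + b 2"
    "omega0 R b 3 6 = - R 5 - b 4" "omega0 R b 4 1 = R 6 + b 2" "omega0 R b 4 2 = - R 3 - b 1"
    "omega0 R b 4 3 = R 2 - b 6" "omega0 R b 4 4 = 0" "omega0 R b 4 5 = 0" "omega0 R b 4 6 = - R 1 + b 3"
    "omega0 R b 5 1 = R 2 - b 6" "omega0 R b 5 2 = - R 1 + b 3" "omega0 R b 5 3 = - R 6 - b 2"
    "omega0 R b 5 4 = 0" "omega0 R b 5 5 = 0" "omega0 R b 5 6 = R 3 + b 1" "omega0 R b 6 1 = - R 4 + b 5"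
    "omega0 R b 6 2 = 0" "omega0 R b 6 3 = R 5 + b 4" "omega0 R b 6 4 = R 1 - b 3"
    "omega0 R b 6 5 = - R 3 - b 1" "omega0 R b 6 6 = 0"
  unfolding omega0_def sum_UNIV_7 by (simp only: eval_star0; simp add: b)+

lemma conn0_table:
  assumes b: "b 0 = 0"
  shows
  "conn0 R b t 1 0 = 0" "conn0 R b t 1 1 = 0" "conn0 R b t 1 2 = - R 4 / 2 + b 5 / 2" "conn0 R b t 1 3 = t"
    "conn0 R b t 1 4 = R 2 / 2 - b 6 / 2" "conn0 R b t 1 5 = - R 6 / 2 - b 2 / 2"
    "conn0 R b t 1 6 = R 5 / 2 + b 4 / 2" "conn0 R b t 2 0 = 0" "conn0 R b t 2 1 = R 4 / 2 - b 5 / 2"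
    "conn0 R b t 2 2 = 0" "conn0 R b t 2 3 = - R 5 / 2 - b 4 / 2" "conn0 R b t 2 4 = - R 1 / 2 + b 3 / 2"
    "conn0 R b t 2 5 = R 3 / 2 + b 1 / 2" "conn0 R b t 2 6 = t" "conn0 R b t 3 0 = 0"
    "conn0 R b t 3 1 = - t" "conn0 R b t 3 2 = R 5 / 2 + b 4 / 2" "conn0 R b t 3 3 = 0"
    "conn0 R b t 3 4 = - R 6 / 2 - b 2 / 2" "conn0 R b t 3 5 = - R 2 / 2 + b 6 / 2"
    "conn0 R b t 3 6 = R 4 / 2 - b 5 / 2" "conn0 R b t 4 0 = 0" "conn0 R b t 4 1 = - R 2 / 2 + b 6 / 2"
    "conn0 R b t 4 2 = R 1 / 2 - b 3 / 2" "conn0 R b t 4 3 = R 6 / 2 + b 2 / 2" "conn0 R b t 4 4 = 0"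
    "conn0 R b t 4 5 = t" "conn0 R b t 4 6 = - R 3 / 2 - b 1 / 2" "conn0 R b t 5 0 = 0"
    "conn0 R b t 5 1 = R 6 / 2 + b 2 / 2" "conn0 R b t 5 2 = - R 3 / 2 - b 1 / 2"
    "conn0 R b t 5 3 = R 2 / 2 - b 6 / 2" "conn0 R b t 5 4 = - t" "conn0 R b t 5 5 = 0"
    "conn0 R b t 5 6 = - R 1 / 2 + b 3 / 2" "conn0 R b t 6 0 = 0" "conn0 R b t 6 1 = - R 5 / 2 - b 4 / 2"
    "conn0 R b t 6 2 = - t" "conn0 R b t 6 3 = - R 4 / 2 + b 5 / 2" "conn0 R b t 6 4 = R 3 / 2 + b 1 / 2"
    "conn0 R b t 6 5 = R 1 / 2 - b 3 / 2" "conn0 R b t 6 6 = 0"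
  unfolding conn0_def sum_UNIV_6 shift_simps omega0_table[of b R, OF b] by (simp only: eval_phi0; simp add: field_simps)+

text \<open>\<open>phi0 0 (shift w)\<close> lists the components of I applied to the tangent vector
  with index \<open>w\<close>. The divisor 4 combines the 1/2 of \<open>r_omega\<close> with the
  1/2! of the inner product of 2-forms.\<close>

lemma r_omega_frame:
  assumes b: "b 0 = 0"
  shows "(\<Sum>i\<in>UNIV. \<Sum>j\<in>UNIV. omega0 R b (shift i) (shift j) *
      (c * phi0 (shift w) (shift i) (shift j) - s * star0 0 (shift w) (shift i) (shift j))) / 4 =
    c * ((\<Sum>k\<in>UNIV. phi0 0 (shift w) k * R k) + b (shift w)) - s * (R (shift w) - (\<Sum>k\<in>UNIV. phi0 0 (shift w) k * b k))"
  unfolding sum_UNIV_6 sum_UNIV_7 shift_simps omega0_table[of b R, OF b]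
  using exhaust_6[of w]
  by (elim disjE; hypsubst; simp only: shift_simps eval_star0; simp add: b field_simps)

text \<open>\<open>B\<close> disappears because its symmetric components are contracted with the
  alternating \<open>phi0\<close>; hence the codifferential involves only r(\<phi>).\<close>

lemma codiff_frame:
  assumes b: "\<And>i. B i 0 = 0" and sym: "\<And>i j. B i j = B j i"
  shows "2 * (\<Sum>k\<in>UNIV. phi0 0 (shift w) (shift k) * (\<Sum>i\<in>UNIV. omega0 (R (shift i)) (B (shift i)) (shift i) (shift k))) =
    - 2 * (\<Sum>i\<in>UNIV. \<Sum>l\<in>UNIV. R i l * phi0 i l (shift w))
    - 2 * (\<Sum>k\<in>UNIV. phi0 0 (shift w) k * R 0 k) + 2 * (\<Sum>k\<in>UNIV. phi0 0 (shift w) k * R k 0)"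
proof -
  have s: "B 2 1 = B 1 2" "B 3 1 = B 1 3" "B 4 1 = B 1 4" "B 5 1 = B 1 5" "B 6 1 = B 1 6"
    "B 3 2 = B 2 3" "B 4 2 = B 2 4" "B 5 2 = B 2 5" "B 6 2 = B 2 6" "B 4 3 = B 3 4" "B 5 3 = B 3 5" "B 6 3 = B 3 6"
    "B 5 4 = B 4 5" "B 6 4 = B 4 6" "B 6 5 = B 5 6" by (rule sym)+
  show ?thesis
    unfolding sum_UNIV_6 sum_UNIV_7 shift_simps
    using exhaust_6[of w]
    by (elim disjE; hypsubst; simp only: shift_simps omega0_table b eval_star0; simp add: b s algebra_simps)
qed

text \<open>In both traces the contractions of the symmetric \<open>B\<close> with the skew
  components of I vanish. For \<open>c\<close> and \<open>s\<close> the cosine and sine of \<theta>,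
  the results are the vector with entries P + H and T rotated by \<theta>; rotating back yields the
  third and fourth identities.\<close>

lemma trace_frame:
  assumes b: "\<And>i. B i 0 = 0" and sym: "\<And>i j. B i j = B j i"
    and r: "\<And>i j. r i j = c * ((\<Sum>k\<in>UNIV. phi0 0 j k * R i k) + B i j) - s * (R i j - (\<Sum>k\<in>UNIV. phi0 0 j k * B i k))"
  defines "P \<equiv> (\<Sum>i\<in>UNIV. \<Sum>l\<in>UNIV. R i l * phi0 i l 0)" and "H \<equiv> (\<Sum>i\<in>UNIV. B (shift i) (shift i))"
    and "T \<equiv> (\<Sum>i\<in>UNIV. R (shift i) (shift i))"
  shows "(\<Sum>i\<in>UNIV. r (shift i) (shift i)) = c * (P + H) - s * T"
    and "(\<Sum>i\<in>UNIV. \<Sum>j\<in>UNIV. phi0 0 (shift j) (shift i) * r (shift i) (shift j)) = c * T + s * (P + H)"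
proof -
  have s: "B 2 1 = B 1 2" "B 3 1 = B 1 3" "B 4 1 = B 1 4" "B 5 1 = B 1 5" "B 6 1 = B 1 6"
    "B 3 2 = B 2 3" "B 4 2 = B 2 4" "B 5 2 = B 2 5" "B 6 2 = B 2 6" "B 4 3 = B 3 4" "B 5 3 = B 3 5" "B 6 3 = B 3 6"
    "B 5 4 = B 4 5" "B 6 4 = B 4 6" "B 6 5 = B 5 6" by (rule sym)+
  show "(\<Sum>i\<in>UNIV. r (shift i) (shift i)) = c * (P + H) - s * T"
    "(\<Sum>i\<in>UNIV. \<Sum>j\<in>UNIV. phi0 0 (shift j) (shift i) * r (shift i) (shift j)) = c * T + s * (P + H)"
    unfolding P_def H_def T_def r sum_UNIV_6 sum_UNIV_7
    by (simp only: shift_simps eval_star0, simp add: b s algebra_simps)+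
qed

text \<open>The value of \<open>t\<close> is immaterial since I acts trivially on \<omega> as a
  derivation. Each slot of \<omega> contributes half of the covariant derivative, which explains the
  1/2 in the connection.\<close>

lemma parallel_omega_frame:
  assumes b: "b 0 = 0"
  shows "omega0 R b (shift i) (shift j) =
    (\<Sum>k\<in>UNIV. conn0 R b t (shift i) k * phi0 0 (shift j) k) + (\<Sum>k\<in>UNIV. conn0 R b t (shift j) k * phi0 0 k (shift i))"
  unfolding sum_UNIV_7
  using exhaust_6[of i] exhaust_6[of j]
  by (elim disjE; hypsubst; simp only: shift_simps omega0_table[of b R, OF b] conn0_table[of b R t, OF b] eval_star0; simp add: field_simps)

text \<open>Components of the derivatives of \<open>\<iota>*\<phi>\<close> and \<open>\<iota>*(n \<lrcorner> *\<phi>)\<close> with respect to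
  \<open>\<nabla>\<^sub>x + t I - 1/2 I (\<nabla>\<^sub>x I)\<close>.\<close>

definition dphi0 :: "(7 \<Rightarrow> real) \<Rightarrow> (7 \<Rightarrow> real) \<Rightarrow> real \<Rightarrow> 7 \<Rightarrow> 7 \<Rightarrow> 7 \<Rightarrow> real" where
  "dphi0 R b t i j k = (\<Sum>l\<in>UNIV. R l * star0 l i j k) + b i * phi0 0 j k + b j * phi0 i 0 k + b k * phi0 i j 0
     - (\<Sum>l\<in>UNIV. conn0 R b t i l * phi0 l j k) - (\<Sum>l\<in>UNIV. conn0 R b t j l * phi0 i l k)
     - (\<Sum>l\<in>UNIV. conn0 R b t k l * phi0 i j l)"

definition dstar0 :: "(7 \<Rightarrow> real) \<Rightarrow> (7 \<Rightarrow> real) \<Rightarrow> real \<Rightarrow> 7 \<Rightarrow> 7 \<Rightarrow> 7 \<Rightarrow> real" where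
  "dstar0 R b t i j k = - (R 0 * phi0 i j k - R i * phi0 0 j k + R j * phi0 0 i k - R k * phi0 0 i j)
     - (\<Sum>m\<in>UNIV. b m * star0 m i j k)
     - (\<Sum>l\<in>UNIV. conn0 R b t i l * star0 0 l j k) - (\<Sum>l\<in>UNIV. conn0 R b t j l * star0 0 i l k)
     - (\<Sum>l\<in>UNIV. conn0 R b t k l * star0 0 i j l)"

text \<open>The 3 arises because t I acts in each of the three slots, always turning the form into
  its partner. The correction by the derivative of I cancels everything else except the component
  \<open>R 0\<close> in normal direction.\<close>

lemma dphi0_eq:
  assumes b: "b 0 = 0"
  shows "dphi0 R b t (shift i) (shift j) (shift k) = (3 * t + R 0) * star0 0 (shift i) (shift j) (shift k)"
  unfolding dphi0_def sum_UNIV_7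
  using exhaust_6[of i] exhaust_6[of j] exhaust_6[of k]
  by (elim disjE; hypsubst; simp only: shift_simps conn0_table[of b R t, OF b] b eval_star0; simp add: field_simps)

lemma dstar0_eq:
  assumes b: "b 0 = 0"
  shows "dstar0 R b t (shift i) (shift j) (shift k) = - (3 * t + R 0) * phi0 (shift i) (shift j) (shift k)"
  unfolding dstar0_def sum_UNIV_7
  using exhaust_6[of i] exhaust_6[of j] exhaust_6[of k]
  by (elim disjE; hypsubst; simp only: shift_simps conn0_table[of b R t, OF b] b eval_star0; simp add: field_simps)


section \<open>Torsion of the induced \<open>SU(3)\<close>-structure\<close>

locale adapted_point = hypersurface_point N \<phi> M \<iota> n p
  for N :: "('l::topological_space, 7) riem" and \<phi> and M :: "('m::topological_space, 6) riem" and \<iota> n p +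
  fixes e :: "7 \<Rightarrow> real^7" and f :: "6 \<Rightarrow> real^6"
  assumes cayley_e: "cayley ga (\<phi> (\<iota> p)) e" and e_0: "e 0 = n p" and d\<iota>_f: "d\<iota> p (f i) = e (shift i)"

sublocale adapted_point \<subseteq> C: cayley "g (\<iota> p)" "\<phi> (\<iota> p)" e
  by (rule cayley_e)

lemma (in hypersurface_point) exists_adapted_point: "\<exists>e f. adapted_point N \<phi> M \<iota> n p e f"
proof -
  obtain e0 where "cayley ga (\<phi> (\<iota> p)) e0" using exists_cayley by blast
  then obtain e where e: "cayley ga (\<phi> (\<iota> p)) e" "e 0 = n p"
    using cayley.exists_adapted_frame[where g = ga and \<phi> = "\<phi> (\<iota> p)", OF _ n_unit[of p]] by metis
  have "\<exists>y. d\<iota> p y = e (shift i)" for i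
    by (rule tangent_range)
      (simp add: e(2)[symmetric] cayley.g_frame[OF e(1)] shift_nonzero[of i, symmetric])
  then obtain f where "\<And>i. d\<iota> p (f i) = e (shift i)" by metis
  then have "adapted_point N \<phi> M \<iota> n p e f" using e by (intro adapted_point.intro adapted_point_axioms.intro hypersurface_point_axioms) auto
  then show ?thesis by blast
qed

context adapted_point
begin

abbreviation "rbar \<equiv> r_phi N \<phi> (\<iota> p)"

lemma f_orthonormal: "orthonormal_basis (gM p) f"
  unfolding orthonormal_basis_def by (simp add: gM_eq d\<iota>_f C.g_frame shift_inject)

lemmas onb_f = orthonormal_onb[OF f_orthonormal]
lemmas f_expansion = orthonormal_expansion[OF f_orthonormal M.metric_multilinear]

lemma linear_eq_on_f:
  assumes "linear L" "linear L'" "\<And>i. L (f i) = L' (f i)" shows "L x = (L' x :: real)"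
proof -
  have "L x = (\<Sum>i\<in>UNIV. gM p [x, f i] *\<^sub>R L (f i))"
    by (subst f_expansion[of x]) (simp add: linear_sum[OF assms(1)] linear_scale[OF assms(1)])
  also have "\<dots> = L' x"
    by (subst (2) f_expansion[of x]) (simp add: linear_sum[OF assms(2)] linear_scale[OF assms(2)] assms(3))
  finally show ?thesis .
qed

lemma d\<iota>_I_f: "d\<iota> p (I p (f i)) = (\<Sum>k\<in>UNIV. phi0 0 (shift i) k *\<^sub>R e k)"
proof -
  have "d\<iota> p (I p (f i)) = (\<Sum>k\<in>UNIV. ga [d\<iota> p (I p (f i)), e k] *\<^sub>R e k)" by (rule C.expansion)
  then show ?thesis by (simp add: d\<iota>_I g_cross d\<iota>_f e_0[symmetric] C.\<phi>_frame)
qed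

lemma sum_shift: "(\<Sum>k\<in>UNIV. h k) = h 0 + (\<Sum>i\<in>UNIV. h (shift i))" for h :: "7 \<Rightarrow> 'z::comm_monoid_add"
  by (simp add: sum_UNIV_7 sum_UNIV_6 add.assoc)

lemma phi0_0: "phi0 0 i 0 = 0"
  using C.\<phi>_frame[of 0 i 0] C.\<phi>_repeat(2) by simp

lemma I_f: "I p (f i) = (\<Sum>k\<in>UNIV. phi0 0 (shift i) (shift k) *\<^sub>R f k)"
  by (rule d\<iota>_eqD[of p])
    (simp add: d\<iota>_I_f sum_shift phi0_0 linear_sum[OF d\<iota>_linear] linear_scale[OF d\<iota>_linear] d\<iota>_f)

text \<open>The components of \<open>- \<nabla>\<^sub>x n\<close>, that is, of the second fundamental form.\<close>

definition "b x j = - ga [W x, e j]"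

lemma b_0: "b x 0 = 0"
  by (simp add: b_def e_0 W_normal)

lemma b_shift: "b x (shift i) = II x (f i)"
  using W_tangent[of x "f i"] by (simp add: b_def d\<iota>_f)

lemma W_eq: "W x = - (\<Sum>m\<in>UNIV. b x m *\<^sub>R e m)"
  using C.expansion[of "W x"] by (simp add: b_def sum_negf)

abbreviation "R x j \<equiv> rbar [d\<iota> p x, e j]"

lemma nabla_\<omega>_f: "nabla M \<omega> p x [f i, f j] = omega0 (R x) (b x) (shift i) (shift j)"
  unfolding nabla_\<omega> nabla_\<phi>[OF cayley_e] W_eq omega0_def
  by (simp add: d\<iota>_f star_def C.star_frame C.\<phi>_simps C.\<phi>_frame e_0[symmetric])

lemma \<omega>_f: "\<omega> p [f i, f j] = phi0 0 (shift j) (shift i)"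
  by (simp add: \<omega>_eq d\<iota>_f e_0[symmetric] C.\<phi>_frame)

lemma pull_phi_f: "pull_phi M N \<phi> \<iota> p [f i, f j, f k] = phi0 (shift i) (shift j) (shift k)"
  by (simp add: pull_phi_def pullback_def d\<iota>_f C.\<phi>_frame)

lemma pull_n_star_phi_f: "pull_n_star_phi M N \<phi> \<iota> n p [f i, f j, f k] = star0 0 (shift i) (shift j) (shift k)"
  by (simp add: pull_n_star_phi_eq d\<iota>_f star_def e_0[symmetric] C.star_frame)

lemma rbar_I: "rbar [x, d\<iota> p (I p (f w))] = (\<Sum>k\<in>UNIV. phi0 0 (shift w) k * rbar [x, e k])"
  "rbar [d\<iota> p (I p (f w)), x] = (\<Sum>k\<in>UNIV. phi0 0 (shift w) k * rbar [e k, x])"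
  by (simp_all add: d\<iota>_I_f linear_sum[OF r_phi_linear] linear_scale[OF r_phi_linear]
      linear_sum[OF r_phi_linear_1] linear_scale[OF r_phi_linear_1])

lemma II_I: "II x (I p (f w)) = (\<Sum>k\<in>UNIV. phi0 0 (shift w) k * b x k)"
  by (simp add: I_f sum_shift b_0 b_shift linear_sum[OF II_linear] linear_scale[OF II_linear])

lemma nabla_\<omega>_linear: "linear (\<lambda>x. nabla M \<omega> p x [y, z])"
proof -
  have "linear (\<lambda>x. W x)"
    unfolding Dfield_def
    by (intro linear_compose_add has_derivative_linear[OF field_derivative]
        linear_compose[OF d\<iota>_linear levi_civita_linear(2), unfolded comp_def])
  from linear_compose[OF this C.lin_\<phi>(1)] have "linear (\<lambda>x. \<phi> (\<iota> p) [W x, d\<iota> p z, d\<iota> p y])" by (simp add: comp_def)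
  moreover have "linear (\<lambda>x. nabla N \<phi> (\<iota> p) (d\<iota> p x) [n p, d\<iota> p z, d\<iota> p y])"
    using linear_compose[OF d\<iota>_linear nabla_linear[OF _ \<phi>_differentiable \<phi>_multilinear, of "[n p, d\<iota> p z, d\<iota> p y]"]]
    by (simp add: comp_def)
  ultimately show ?thesis unfolding nabla_\<omega> by (intro linear_compose_add)
qed

lemma nabla_\<omega>_multilinear: "multilinear 2 (nabla M \<omega> p x)"
  unfolding nabla_def
  by (rule M.cov_tensor_multilinear[where \<Gamma> = "levi_civita M p", OF \<omega>_multilinear \<omega>_differentiable M.levi_civita_linear(1)])

text \<open>Both sides are linear in \<open>y\<close>, so \<open>y\<close> may be a frame vector.
  The vector \<open>x\<close> stays arbitrary, since it enters the frame identity only through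
  \<open>R x\<close> and \<open>b x\<close>.\<close>

lemma r_omega_eq:
  fixes \<theta> :: "'m \<Rightarrow> real"
  defines "r \<equiv> r_omega M \<omega> (su3_psi_plus M N \<phi> \<iota> n \<theta>) p"
  shows "r [x, y] = cos (\<theta> p) * (rbar [d\<iota> p x, d\<iota> p (I p y)] + II x y)
    - sin (\<theta> p) * (rbar [d\<iota> p x, d\<iota> p y] - II x (I p y))"
proof -
  let ?\<psi> = "su3_psi_plus M N \<phi> \<iota> n \<theta> p" and ?c = "cos (\<theta> p)" and ?s = "sin (\<theta> p)"
  have \<psi>: "multilinear 3 ?\<psi>"
    using pull_phi_multilinear[of p] pull_n_star_phi_multilinear[of p]
    unfolding multilinear_def su3_psi_plus_def by (intro allI impI linear_compose_sub linear_times) blast+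
  have r_eq: "r [x, y] = 1 / 4 * (\<Sum>i\<in>UNIV. \<Sum>j\<in>UNIV. nabla M \<omega> p x [f i, f j] * ?\<psi> [y, f i, f j])" for y
  proof -
    have "multilinear 2 (\<lambda>ys. ?\<psi> (y # ys))" using multilinear_Cons[of 2 ?\<psi>] \<psi> by simp
    from orthonormal_sum_lists_invariant[OF onb_f f_orthonormal M.metric_multilinear M.metric_sym nabla_\<omega>_multilinear this]
    show ?thesis by (simp add: r_def r_omega_def form_inner_def interior_mult_def sum_lists)
  qed
  have r_linear: "linear (\<lambda>y. r [x, y])"
    unfolding r_eq by (intro linear_times linear_compose_sum ballI multilinear_3(1)[OF \<psi>])
  note lin = linear_compose[OF I_linear, unfolded comp_def] linear_compose[OF d\<iota>_linear, unfolded comp_def]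
  have rhs_linear: "linear (\<lambda>y. ?c * (rbar [d\<iota> p x, d\<iota> p (I p y)] + II x y) - ?s * (rbar [d\<iota> p x, d\<iota> p y] - II x (I p y)))"
    by (intro linear_compose_sub linear_compose_add linear_times II_linear lin(2)[OF r_phi_linear]
        lin(1)[OF lin(2)[OF r_phi_linear]] lin(1)[OF II_linear])
  show ?thesis
  proof (rule linear_eq_on_f[OF r_linear rhs_linear])
    fix w
    have "r [x, f w] = (\<Sum>i\<in>UNIV. \<Sum>j\<in>UNIV. omega0 (R x) (b x) (shift i) (shift j) *
      (?c * phi0 (shift w) (shift i) (shift j) - ?s * star0 0 (shift w) (shift i) (shift j))) / 4"
      unfolding r_eq by (simp add: nabla_\<omega>_f su3_psi_plus_def pull_phi_f pull_n_star_phi_f)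
    also have "\<dots> = ?c * ((\<Sum>k\<in>UNIV. phi0 0 (shift w) k * R x k) + b x (shift w))
        - ?s * (R x (shift w) - (\<Sum>k\<in>UNIV. phi0 0 (shift w) k * b x k))"
      by (rule r_omega_frame[where b = "b x" and R = "R x", OF b_0])
    finally show "r [x, f w] = ?c * (rbar [d\<iota> p x, d\<iota> p (I p (f w))] + II x (f w))
        - ?s * (rbar [d\<iota> p x, d\<iota> p (f w)] - II x (I p (f w)))"
      by (simp add: rbar_I II_I b_shift d\<iota>_f)
  qed
qed

section \<open>The codifferential and the trace identities\<close>

lemma codiff_eq: "codiff M \<omega> p [y] = - (\<Sum>i\<in>UNIV. nabla M \<omega> p (f i) [f i, y])"
proof -
  have "(\<Sum>i\<in>UNIV. nabla M \<omega> p (onb (gM p) i) [onb (gM p) i, y]) = (\<Sum>i\<in>UNIV. nabla M \<omega> p (f i) [f i, y])"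
    by (rule orthonormal_sum_invariant[OF onb_f f_orthonormal M.metric_multilinear M.metric_sym,
          where b = "\<lambda>x z. nabla M \<omega> p x [z, y]"])
      (rule nabla_\<omega>_linear multilinear_2(1)[OF nabla_\<omega>_multilinear])+
  then show ?thesis by (simp add: codiff_def Let_def interior_mult_def)
qed

text \<open>The second fundamental form, extended by zero to the normal direction.\<close>

definition "BB i j = (if i = 0 then 0 else b (inv_into UNIV (d\<iota> p) (e i)) j)"

lemma BB_shift: "BB (shift i) = b (f i)"
  using d\<iota>_inj[of p] by (simp add: BB_def[abs_def] shift_nonzero d\<iota>_f[symmetric] inv_into_f_f)

lemma shift_cases: "j = 0 \<or> (\<exists>i. j = shift i)"
proof -
  have "j = shift 0 \<or> j = shift 1 \<or> j = shift 2 \<or> j = shift 3 \<or> j = shift 4 \<or> j = shift 5" if "j \<noteq> 0"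
    using exhaust_7[of j] that unfolding shift_simps by blast
  then show ?thesis by blast
qed

lemma BB_0: "BB i 0 = 0"
  by (simp add: BB_def b_0)

lemma BB_sym: "BB i j = BB j i"
proof -
  have "BB (shift k) (shift l) = BB (shift l) (shift k)" for k l
    by (simp add: BB_shift b_shift II_sym[of "f k"])
  moreover have "BB 0 k = 0" for k by (simp add: BB_def)
  ultimately show ?thesis using shift_cases[of i] shift_cases[of j] BB_0 by metis
qed

abbreviation "RR i j \<equiv> rbar [e i, e j]"

lemma R_f: "R (f i) = RR (shift i)"
  by (simp add: d\<iota>_f)

text \<open>On a one-form \<open>act_all\<close> composes with I and changes the sign, which cancels
  the sign in the codifferential.\<close>

lemma codiff_I:
  "2 * act_all (I p) (codiff M \<omega> p) [x] =
    pd_star N \<phi> (\<iota> p) [d\<iota> p x] - 2 * rbar [n p, d\<iota> p (I p x)] + 2 * rbar [d\<iota> p (I p x), n p]"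
proof -
  note lin = linear_compose[OF I_linear, unfolded comp_def] linear_compose[OF d\<iota>_linear, unfolded comp_def]
  have "linear (\<lambda>x. 2 * (\<Sum>i\<in>UNIV. nabla M \<omega> p (f i) [f i, I p x]))"
    by (intro linear_times linear_compose_sum ballI lin(1)[OF multilinear_2(2)[OF nabla_\<omega>_multilinear]])
  moreover have "linear (\<lambda>x. - 2 * (\<Sum>i\<in>UNIV. \<Sum>l\<in>UNIV. RR i l * \<phi> (\<iota> p) [e i, e l, d\<iota> p x])
      - 2 * rbar [n p, d\<iota> p (I p x)] + 2 * rbar [d\<iota> p (I p x), n p])"
    by (intro linear_compose_add linear_compose_sub linear_times linear_compose_sum ballI
        lin(2)[OF C.lin_\<phi>(3)] lin(1)[OF lin(2)[OF r_phi_linear]] lin(1)[OF lin(2)[OF r_phi_linear_1]])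
  ultimately have "2 * (\<Sum>i\<in>UNIV. nabla M \<omega> p (f i) [f i, I p x]) =
      - 2 * (\<Sum>i\<in>UNIV. \<Sum>l\<in>UNIV. RR i l * \<phi> (\<iota> p) [e i, e l, d\<iota> p x])
      - 2 * rbar [n p, d\<iota> p (I p x)] + 2 * rbar [d\<iota> p (I p x), n p]"
  proof (rule linear_eq_on_f)
    fix w
    have "(\<Sum>i\<in>UNIV. nabla M \<omega> p (f i) [f i, I p (f w)]) =
      (\<Sum>i\<in>UNIV. \<Sum>k\<in>UNIV. phi0 0 (shift w) (shift k) * omega0 (RR (shift i)) (BB (shift i)) (shift i) (shift k))"
      by (simp add: I_f linear_sum[OF multilinear_2(2)[OF nabla_\<omega>_multilinear]]
          linear_scale[OF multilinear_2(2)[OF nabla_\<omega>_multilinear]] nabla_\<omega>_f R_f BB_shift)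
    also have "\<dots> = (\<Sum>k\<in>UNIV. phi0 0 (shift w) (shift k) *
        (\<Sum>i\<in>UNIV. omega0 (RR (shift i)) (BB (shift i)) (shift i) (shift k)))"
      unfolding sum_distrib_left by (rule sum.swap)
    finally show "2 * (\<Sum>i\<in>UNIV. nabla M \<omega> p (f i) [f i, I p (f w)]) =
      - 2 * (\<Sum>i\<in>UNIV. \<Sum>l\<in>UNIV. RR i l * \<phi> (\<iota> p) [e i, e l, d\<iota> p (f w)])
      - 2 * rbar [n p, d\<iota> p (I p (f w))] + 2 * rbar [d\<iota> p (I p (f w)), n p]"
      using codiff_frame[where B = BB and R = RR and w = w, OF BB_0 BB_sym]
      by (simp add: d\<iota>_f C.\<phi>_frame rbar_I e_0)
  qed
  then show ?thesis
    by (simp add: act_all_def codiff_eq pd_star_eq[OF cayley_e])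
qed

lemma traces:
  fixes \<theta> :: "'m \<Rightarrow> real"
  defines "r \<equiv> r_omega M \<omega> (su3_psi_plus M N \<phi> \<iota> n \<theta>) p"
    and "h \<equiv> ga [mean_curvature M N \<iota> n p, n p]"
    and "P \<equiv> (\<Sum>i\<in>UNIV. \<Sum>l\<in>UNIV. RR i l * phi0 i l 0)" and "T \<equiv> (\<Sum>i\<in>UNIV. RR (shift i) (shift i))"
  shows "metric_trace (gM p) r = cos (\<theta> p) * (P + 6 * h) - sin (\<theta> p) * T"
    and "contraction (gM p) (\<omega> p) r = cos (\<theta> p) * T + sin (\<theta> p) * (P + 6 * h)"
    and "metric_trace (gM p) (pullback A B \<iota> (r_phi N \<phi>) p) = T"
    and "pd_star N \<phi> (\<iota> p) [n p] = - 2 * P"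
proof -
  note d = linear_compose[OF d\<iota>_linear, unfolded comp_def]
  note I = linear_compose[OF I_linear, unfolded comp_def]
  have II1: "linear (\<lambda>x. II x y)" for y using II_linear[of y] by (simp add: II_sym[of y])
  have r1: "linear (\<lambda>x. r [x, y])" and r2: "linear (\<lambda>y. r [x, y])" for x y
    unfolding r_def r_omega_eq
    by (intro linear_compose_sub linear_compose_add linear_times II_linear II1 d[OF r_phi_linear]
        d[OF r_phi_linear_1] I[OF d[OF r_phi_linear]] I[OF II_linear])+
  define r0 where "r0 i j = cos (\<theta> p) * ((\<Sum>k\<in>UNIV. phi0 0 j k * RR i k) + BB i j)
      - sin (\<theta> p) * (RR i j - (\<Sum>k\<in>UNIV. phi0 0 j k * BB i k))" for i j
  have r_f: "r [f i, f j] = r0 (shift i) (shift j)" for i j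
    by (simp add: r_def r0_def r_omega_eq rbar_I II_I BB_shift b_shift d\<iota>_f)
  have h: "6 * h = (\<Sum>i\<in>UNIV. BB (shift i) (shift i))"
  proof -
    have "6 * h = (\<Sum>i\<in>UNIV. II (onb (gM p) i) (onb (gM p) i))"
      by (simp add: h_def mean_curvature_def Let_def C.g_simps II_def scalar_second_ff_def)
    also have "\<dots> = (\<Sum>i\<in>UNIV. II (f i) (f i))"
      by (rule orthonormal_sum_invariant[OF onb_f f_orthonormal M.metric_multilinear M.metric_sym II1 II_linear])
    finally show ?thesis by (simp add: BB_shift b_shift)
  qed
  have "metric_trace (gM p) r = (\<Sum>i\<in>UNIV. r [f i, f i])"
    unfolding metric_trace_def
    by (rule orthonormal_sum_invariant[OF onb_f f_orthonormal M.metric_multilinear M.metric_sym r1 r2])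
  then show "metric_trace (gM p) r = cos (\<theta> p) * (P + 6 * h) - sin (\<theta> p) * T"
    unfolding h P_def T_def r_f by (simp only: trace_frame(1)[where B = BB and R = RR and r = r0, OF BB_0 BB_sym r0_def])
  have "contraction (gM p) (\<omega> p) r = (\<Sum>i\<in>UNIV. \<Sum>j\<in>UNIV. \<omega> p [f i, f j] * r [f i, f j])"
    using orthonormal_sum_lists_invariant[OF onb_f f_orthonormal M.metric_multilinear M.metric_sym \<omega>_multilinear, of r]
      multilinear_2I[OF r1 r2] by (simp add: contraction_def sum_lists)
  then show "contraction (gM p) (\<omega> p) r = cos (\<theta> p) * T + sin (\<theta> p) * (P + 6 * h)"
    unfolding h P_def T_def r_f \<omega>_f by (simp only: trace_frame(2)[where B = BB and R = RR and r = r0, OF BB_0 BB_sym r0_def])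
  have "metric_trace (gM p) (pullback A B \<iota> (r_phi N \<phi>) p) = (\<Sum>i\<in>UNIV. rbar [d\<iota> p (f i), d\<iota> p (f i)])"
    unfolding metric_trace_def pullback_def list.map
    by (rule orthonormal_sum_invariant[OF onb_f f_orthonormal M.metric_multilinear M.metric_sym,
          where b = "\<lambda>x y. rbar [d\<iota> p x, d\<iota> p y]"]) (rule d[OF r_phi_linear] d[OF r_phi_linear_1])+
  then show "metric_trace (gM p) (pullback A B \<iota> (r_phi N \<phi>) p) = T"
    by (simp add: T_def d\<iota>_f)
  show "pd_star N \<phi> (\<iota> p) [n p] = - 2 * P"
    using pd_star_eq[OF cayley_e, of "n p"] by (simp add: P_def e_0[symmetric] C.\<phi>_frame)
qed

section \<open>The connection preserving the structure and its one-form\<close>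

lemma I_square: "I p (I p x) = - x"
proof -
  note neg = linear_neg[OF I_linear]
  have "I p (f 0) = f 2" "I p (f 1) = f 5" "I p (f 2) = - f 0" "I p (f 3) = f 4" "I p (f 4) = - f 3" "I p (f 5) = - f 1"
    by (simp only: I_f sum_UNIV_6 shift_simps; simp only: eval_phi0; simp)+
  then have "I p (I p (f i)) = - f i" for i
    using exhaust_6[of i] by (auto simp: neg)
  then have "I p (I p (\<Sum>i\<in>UNIV. gM p [x, f i] *\<^sub>R f i)) = - (\<Sum>i\<in>UNIV. gM p [x, f i] *\<^sub>R f i)"
    by (simp add: linear_sum[OF I_linear] linear_scale[OF I_linear] sum_negf)
  then show ?thesis unfolding f_expansion[of x, symmetric] .
qed

lemma nabla_endo_f: "nabla_endo M I p x (f z) = (\<Sum>y\<in>UNIV. omega0 (R x) (b x) (shift y) (shift z) *\<^sub>R f y)"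
proof -
  have "gM p [nabla_endo M I p x (f z), f y] = omega0 (R x) (b x) (shift y) (shift z)" for y
    by (simp add: M.metric_sym[of _ _ "f y"] nabla_endo_I nabla_\<omega>_f)
  then show ?thesis using f_expansion[of "nabla_endo M I p x (f z)"] by simp
qed

lemma nabla_endo_linear: "linear (nabla_endo M I p x)"
proof -
  note lin = multilinear_2(2)[OF nabla_\<omega>_multilinear] multilinear_2(2)[OF M.metric_multilinear]
  show ?thesis
    by (intro linearI; rule inner_product_eqI[OF M.metric_multilinear[of p] M.metric_pos])
      (simp_all add: M.metric_sym[of _ _ z for z] nabla_endo_I linear_add[OF lin(1)] linear_scale[OF lin(1)]
        linear_add[OF lin(2)] linear_scale[OF lin(2)])
qed

text \<open>The difference from the Levi-Civita connection, with the number (I\<eta>)(x) replaced by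
  a free parameter \<open>t\<close>. Parallelism then becomes an equation for
  \<open>t\<close>.\<close>

definition "conn t x y = t *\<^sub>R I p y + (- 1 / 2) *\<^sub>R I p (nabla_endo M I p x y)"

lemma conn_linear: "linear (conn t x)"
  unfolding conn_def[abs_def]
  by (intro linear_compose_add linear_compose_scale_right I_linear linear_compose[OF nabla_endo_linear I_linear, unfolded comp_def])

lemma conn_f: "d\<iota> p (conn t x (f z)) = (\<Sum>k\<in>UNIV. conn0 (R x) (b x) t (shift z) k *\<^sub>R e k)"
proof -
  let ?o = "\<lambda>y. omega0 (R x) (b x) (shift y) (shift z)"
  have "d\<iota> p (conn t x (f z)) = t *\<^sub>R (\<Sum>k\<in>UNIV. phi0 0 (shift z) k *\<^sub>R e k)
      - (1 / 2) *\<^sub>R (\<Sum>y\<in>UNIV. \<Sum>k\<in>UNIV. (?o y * phi0 0 (shift y) k) *\<^sub>R e k)"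
    by (simp add: conn_def nabla_endo_f linear_add[OF d\<iota>_linear] linear_diff[OF d\<iota>_linear] linear_scale[OF d\<iota>_linear] linear_neg[OF d\<iota>_linear]
        linear_sum[OF d\<iota>_linear] linear_sum[OF I_linear] linear_scale[OF I_linear] d\<iota>_I_f scaleR_sum_right sum_negf)
  also have "\<dots> = (\<Sum>k\<in>UNIV. conn0 (R x) (b x) t (shift z) k *\<^sub>R e k)"
  proof -
    have "(\<Sum>y\<in>UNIV. \<Sum>k\<in>UNIV. (?o y * phi0 0 (shift y) k) *\<^sub>R e k) =
        (\<Sum>k\<in>UNIV. (\<Sum>y\<in>UNIV. ?o y * phi0 0 (shift y) k) *\<^sub>R e k)"
      unfolding scaleR_sum_left by (rule sum.swap)
    then show ?thesis
      by (simp add: conn0_def scaleR_left_diff_distrib sum_subtractf scaleR_sum_right)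
  qed
  finally show ?thesis .
qed

lemma
  fixes t :: "real^6 \<Rightarrow> real"
  defines "\<Gamma>' \<equiv> \<lambda>x y. levi_civita M p x y + conn (t x) x y"
  shows cov_\<omega>_f: "cov_tensor A \<Gamma>' \<omega> p x [f i, f j] = 0"
    and cov_pull_phi_f: "cov_tensor A \<Gamma>' (pull_phi M N \<phi> \<iota>) p x [f i, f j, f k] =
      (3 * t x + R x 0) * star0 0 (shift i) (shift j) (shift k)"
    and cov_pull_n_star_phi_f: "cov_tensor A \<Gamma>' (pull_n_star_phi M N \<phi> \<iota> n) p x [f i, f j, f k] =
      - (3 * t x + R x 0) * phi0 (shift i) (shift j) (shift k)"
proof -
  note star_simps = C.star_simps[folded star_def]
  have star_e: "star (\<iota> p) [e i, e j, e k, e l] = star0 i j k l" for i j k l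
    unfolding star_def by (rule C.star_frame)
  have pull_phi_eq: "pull_phi M N \<phi> \<iota> p [u, v, w] = \<phi> (\<iota> p) [d\<iota> p u, d\<iota> p v, d\<iota> p w]" for u v w
    by (simp add: pull_phi_def pullback_def)
  have "cov_tensor A \<Gamma>' \<omega> p x [f i, f j] = omega0 (R x) (b x) (shift i) (shift j)
      - ((\<Sum>k\<in>UNIV. conn0 (R x) (b x) (t x) (shift i) k * phi0 0 (shift j) k)
        + (\<Sum>k\<in>UNIV. conn0 (R x) (b x) (t x) (shift j) k * phi0 0 k (shift i)))"
    unfolding \<Gamma>'_def using cov_tensor_add[of "[f i, f j]" \<omega> "\<lambda>x. conn (t x) x" x] \<omega>_multilinear
    by (simp add: numeral_2_eq_2 nabla_\<omega>_f \<omega>_eq conn_f d\<iota>_f e_0[symmetric] C.\<phi>_simps C.\<phi>_frame)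
  then show "cov_tensor A \<Gamma>' \<omega> p x [f i, f j] = 0"
    using parallel_omega_frame[of "b x" "R x" i j "t x"] b_0 by simp
  have "cov_tensor A \<Gamma>' (pull_phi M N \<phi> \<iota>) p x [f i, f j, f k] =
      dphi0 (R x) (b x) (t x) (shift i) (shift j) (shift k)"
    unfolding \<Gamma>'_def using cov_tensor_add[of "[f i, f j, f k]" "pull_phi M N \<phi> \<iota>" "\<lambda>x. conn (t x) x" x] pull_phi_multilinear
    by (simp add: numeral_3_eq_3 nabla_pull_phi(2) nabla_\<phi>[OF cayley_e] dphi0_def b_shift pull_phi_eq conn_f d\<iota>_f
        e_0[symmetric] C.\<phi>_simps C.\<phi>_frame star_e)
  also have "\<dots> = (3 * t x + R x 0) * star0 0 (shift i) (shift j) (shift k)"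
    by (rule dphi0_eq) (rule b_0)
  finally show "cov_tensor A \<Gamma>' (pull_phi M N \<phi> \<iota>) p x [f i, f j, f k] =
      (3 * t x + R x 0) * star0 0 (shift i) (shift j) (shift k)" .
  have "cov_tensor A \<Gamma>' (pull_n_star_phi M N \<phi> \<iota> n) p x [f i, f j, f k] =
      dstar0 (R x) (b x) (t x) (shift i) (shift j) (shift k)"
    unfolding \<Gamma>'_def using cov_tensor_add[of "[f i, f j, f k]" "pull_n_star_phi M N \<phi> \<iota> n" "\<lambda>x. conn (t x) x" x] pull_n_star_phi_multilinear
    by (simp add: numeral_3_eq_3 nabla_pull_n_star_phi(2) nabla_star dstar0_def W_eq pull_n_star_phi_eq conn_f d\<iota>_f
        e_0[symmetric] star_simps C.\<phi>_frame star_e)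
  also have "\<dots> = - (3 * t x + R x 0) * phi0 (shift i) (shift j) (shift k)"
    by (rule dstar0_eq) (rule b_0)
  finally show "cov_tensor A \<Gamma>' (pull_n_star_phi M N \<phi> \<iota> n) p x [f i, f j, f k] =
      - (3 * t x + R x 0) * phi0 (shift i) (shift j) (shift k)" .
qed

lemma parallel_iff:
  fixes \<theta> :: "'m \<Rightarrow> real" and t :: "real^6 \<Rightarrow> real"
  defines "\<Gamma>' \<equiv> \<lambda>x y. levi_civita M p x y + conn (t x) x y" and "d\<theta> \<equiv> ext_deriv A (\<lambda>p _. \<theta> p) p"
  assumes \<theta>: "smooth_tensor_field A 0 (\<lambda>p _. \<theta> p)"
  shows "parallel_at A \<Gamma>' 2 \<omega> p \<and> parallel_at A \<Gamma>' 3 (su3_psi_plus M N \<phi> \<iota> n \<theta>) p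
      \<and> parallel_at A \<Gamma>' 3 (su3_psi_minus M N \<phi> \<iota> n \<theta>) p \<longleftrightarrow>
    (\<forall>x. 3 * t x = d\<theta> [x] - rbar [d\<iota> p x, n p])" (is "_ \<and> ?plus \<and> ?minus \<longleftrightarrow> ?R")
proof -
  let ?c = "cos (\<theta> p)" and ?s = "sin (\<theta> p)"
  let ?\<phi> = "cov_tensor A \<Gamma>' (pull_phi M N \<phi> \<iota>) p" and ?\<sigma> = "cov_tensor A \<Gamma>' (pull_n_star_phi M N \<phi> \<iota> n) p"
  have plus: "cov_tensor A \<Gamma>' (su3_psi_plus M N \<phi> \<iota> n \<theta>) p x ys = ?c * ?\<phi> x ys - ?s * ?\<sigma> x ys
      - d\<theta> [x] * (?s * pull_phi M N \<phi> \<iota> p ys + ?c * pull_n_star_phi M N \<phi> \<iota> n p ys)"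
    and minus: "cov_tensor A \<Gamma>' (su3_psi_minus M N \<phi> \<iota> n \<theta>) p x ys = ?s * ?\<phi> x ys + ?c * ?\<sigma> x ys
      + d\<theta> [x] * (?c * pull_phi M N \<phi> \<iota> p ys - ?s * pull_n_star_phi M N \<phi> \<iota> n p ys)"
    if "length ys = 3" for x ys
    using cov_tensor_rotate[OF \<theta> nabla_pull_phi(1)[OF that] nabla_pull_n_star_phi(1)[OF that], of \<Gamma>' x]
    by (simp_all add: d\<theta>_def su3_psi_plus_def[abs_def] su3_psi_minus_def[abs_def])
  have \<Gamma>': "linear (\<Gamma>' x)" for x
    unfolding \<Gamma>'_def by (intro linear_compose_add M.levi_civita_linear(1) conn_linear)
  have \<phi>_f: "?\<phi> x [f i, f j, f k] = (3 * t x + R x 0) * star0 0 (shift i) (shift j) (shift k)"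
    and \<sigma>_f: "?\<sigma> x [f i, f j, f k] = - (3 * t x + R x 0) * phi0 (shift i) (shift j) (shift k)" for x i j k
    unfolding \<Gamma>'_def by (rule cov_pull_phi_f, rule cov_pull_n_star_phi_f)
  have "parallel_at A \<Gamma>' 2 \<omega> p"
    unfolding parallel_at_def
  proof (intro allI impI)
    fix x ys assume "length (ys :: (real^6) list) = 2"
    then show "cov_tensor A \<Gamma>' \<omega> p x ys = 0"
    proof (rule multilinear_extensionality[OF f_orthonormal M.metric_multilinear, rotated -1])
      show "multilinear 2 (cov_tensor A \<Gamma>' \<omega> p x)"
        by (rule M.cov_tensor_multilinear[where \<Gamma> = \<Gamma>', OF \<omega>_multilinear \<omega>_differentiable \<Gamma>'])
      fix l :: "6 list" assume "length l = 2"
      then show "cov_tensor A \<Gamma>' \<omega> p x (map f l) = 0"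
        by (auto simp: numeral_2_eq_2 length_Suc_conv \<Gamma>'_def cov_\<omega>_f)
    qed
  qed
  moreover have ?R if "?plus" "?minus"
  proof
    fix x
    \<comment> \<open>On this triple, with frame indices 1, 2, 5, the pullback of \<phi> is 0 and
      that of the contracted dual is 1. One of sine and cosine is nonzero, so the common factor
      vanishes.\<close>
    have "?c * (3 * t x + R x 0 - d\<theta> [x]) = 0" "?s * (3 * t x + R x 0 - d\<theta> [x]) = 0"
      using that(1)[unfolded parallel_at_def, rule_format, of "[f 0, f 1, f 4]" x]
        that(2)[unfolded parallel_at_def, rule_format, of "[f 0, f 1, f 4]" x]
      unfolding plus[of "[f 0, f 1, f 4]", simplified] minus[of "[f 0, f 1, f 4]", simplified]
      by (simp_all add: \<phi>_f \<sigma>_f pull_phi_f pull_n_star_phi_f eval_phi0 eval_star0 algebra_simps)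
    then have "3 * t x + R x 0 - d\<theta> [x] = 0"
      using sin_zero_abs_cos_one[of "\<theta> p"] by auto
    then show "3 * t x = d\<theta> [x] - rbar [d\<iota> p x, n p]" by (simp add: e_0)
  qed
  moreover have "?plus \<and> ?minus" if ?R
  proof -
    have R: "3 * t x + R x 0 = d\<theta> [x]" for x using that by (simp add: e_0)
    have "?\<phi> x ys - d\<theta> [x] * pull_n_star_phi M N \<phi> \<iota> n p ys = 0"
      and "?\<sigma> x ys + d\<theta> [x] * pull_phi M N \<phi> \<iota> p ys = 0" if len: "length ys = 3" for x ys
    proof -
      have \<phi>: "multilinear 3 (?\<phi> x)" and \<sigma>: "multilinear 3 (?\<sigma> x)"
        by (rule M.cov_tensor_multilinear[where \<Gamma> = \<Gamma>', OF pull_phi_multilinear nabla_pull_phi(1) \<Gamma>'],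
            assumption, rule M.cov_tensor_multilinear[where \<Gamma> = \<Gamma>', OF pull_n_star_phi_multilinear nabla_pull_n_star_phi(1) \<Gamma>'])
      have ml: "multilinear 3 (\<lambda>ys. ?\<phi> x ys - d\<theta> [x] * pull_n_star_phi M N \<phi> \<iota> n p ys)"
        "multilinear 3 (\<lambda>ys. ?\<sigma> x ys + d\<theta> [x] * pull_phi M N \<phi> \<iota> p ys)"
        using \<phi> \<sigma> pull_phi_multilinear[of p] pull_n_star_phi_multilinear[of p]
        unfolding multilinear_def by (intro allI impI linear_compose_sub linear_compose_add linear_times; blast)+
      note ext = multilinear_extensionality[OF f_orthonormal M.metric_multilinear _ _ len]
      show "?\<phi> x ys - d\<theta> [x] * pull_n_star_phi M N \<phi> \<iota> n p ys = 0"
        by (rule ext[OF ml(1)]) (auto simp: numeral_3_eq_3 length_Suc_conv \<phi>_f R pull_n_star_phi_f)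
      show "?\<sigma> x ys + d\<theta> [x] * pull_phi M N \<phi> \<iota> p ys = 0"
        by (rule ext[OF ml(2)]) (auto simp: numeral_3_eq_3 length_Suc_conv \<sigma>_f R pull_phi_f)
    qed
    then have "?\<phi> x ys = d\<theta> [x] * pull_n_star_phi M N \<phi> \<iota> n p ys" "?\<sigma> x ys = - d\<theta> [x] * pull_phi M N \<phi> \<iota> p ys"
      if "length ys = 3" for x ys using that by (auto simp: eq_neg_iff_add_eq_0)
    then show ?thesis
      unfolding parallel_at_def by (auto simp: plus minus algebra_simps)
  qed
  ultimately show ?thesis by blast
qed

text \<open>\<open>parallel_iff\<close> turns the description in \<open>eta_form\<close> into a
  linear equation for I\<eta>; it has exactly one solution because I squares to -1.\<close>

lemma eta_eq:
  fixes \<theta> :: "'m \<Rightarrow> real"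
  defines "\<eta> \<equiv> eta_form M I \<omega> (su3_psi_plus M N \<phi> \<iota> n \<theta>) (su3_psi_minus M N \<phi> \<iota> n \<theta>) p"
    and "d\<theta> \<equiv> ext_deriv A (\<lambda>p _. \<theta> p) p"
  assumes \<theta>: "smooth_tensor_field A 0 (\<lambda>p _. \<theta> p)"
  shows "3 * act_all (I p) \<eta> [x] = d\<theta> [x] - rbar [d\<iota> p x, n p]"
proof -
  have "u0 \<in> coord_at A p ` dom_at A p" using M.mem_dom by blast
  from has_derivative_linear[OF M.smooth_tensor_field_derivative[OF \<theta> _ this, of "[]"]]
  have d\<theta>: "linear (\<lambda>x. d\<theta> [x])" by (simp add: d\<theta>_def ext_deriv_def)
  \<comment> \<open>The equation is evaluated at I y: there (I\<eta>)(I y) = -\<eta>(I (I y)) =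
    \<eta>(y).\<close>
  define \<eta>0 where "\<eta>0 y = 1 / 3 * (d\<theta> [I p y] - rbar [d\<iota> p (I p y), n p])" for y
  note I = linear_compose[OF I_linear, unfolded comp_def]
  have lin: "linear (\<lambda>x. rbar [d\<iota> p x, n p])"
    by (rule linear_compose[OF d\<iota>_linear r_phi_linear_1, unfolded comp_def])
  have \<eta>0: "linear \<eta>0"
    unfolding \<eta>0_def[abs_def] by (intro linear_times linear_compose_sub I[OF d\<theta>] I[OF lin])
  have iff: "(\<forall>x. 3 * act_all (I p) (\<lambda>zs. \<eta>' (zs ! 0)) [x] = d\<theta> [x] - rbar [d\<iota> p x, n p]) \<longleftrightarrow> \<eta>' = \<eta>0"
    if "linear \<eta>'" for \<eta>'
  proof
    assume \<eta>': "\<forall>x. 3 * act_all (I p) (\<lambda>zs. \<eta>' (zs ! 0)) [x] = d\<theta> [x] - rbar [d\<iota> p x, n p]"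
    show "\<eta>' = \<eta>0"
    proof
      fix y
      show "\<eta>' y = \<eta>0 y"
        using \<eta>'[rule_format, of "I p y"] linear_neg[OF that] by (simp add: act_all_def I_square \<eta>0_def)
    qed
  qed (simp add: act_all_def \<eta>0_def I_square linear_neg[OF d\<theta>] linear_neg[OF lin])
  have conn: "su3_connection M I \<eta>'' p = (\<lambda>x y. levi_civita M p x y + conn (act_all (I p) \<eta>'' [x]) x y)" for \<eta>''
    by (intro ext) (simp add: su3_connection_def conn_def)
  have "\<eta> xs = \<eta>0 (xs ! 0)" for xs
  proof -
    have "(THE \<eta>'. linear \<eta>' \<and> (\<forall>x. 3 * act_all (I p) (\<lambda>zs. \<eta>' (zs ! 0)) [x] = d\<theta> [x] - rbar [d\<iota> p x, n p])) = \<eta>0"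
      using \<eta>0 iff by (intro the_equality) auto
    then show ?thesis
      unfolding \<eta>_def eta_form_def Let_def conn parallel_iff[OF \<theta>] d\<theta>_def by simp
  qed
  then have "act_all (I p) \<eta> [x] = act_all (I p) (\<lambda>zs. \<eta>0 (zs ! 0)) [x]" by (simp add: act_all_def)
  then show ?thesis using iff[OF \<eta>0] by simp
qed

end

theorem proposition4p2:
  fixes N :: "('l::{t2_space,second_countable_topology}, 7) riem"
    and M :: "('m::{t2_space,second_countable_topology}, 6) riem"
    and \<phi> :: "'l \<Rightarrow> 7 tensor"
    and \<iota> :: "'m \<Rightarrow> 'l"
    and n :: "'m \<Rightarrow> real^7"
    and \<theta> :: "'m \<Rightarrow> real"
  defines "d\<iota> \<equiv> differential (mfd_atlas M) (mfd_atlas N) \<iota>"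
    and "pull \<equiv> pullback (mfd_atlas M) (mfd_atlas N) \<iota>"
    and "g \<equiv> mfd_metric M"
    and "I \<equiv> su3_I M N \<phi> \<iota> n"
    and "\<omega> \<equiv> su3_omega M N \<phi> \<iota> n"
    and "\<psi>p \<equiv> su3_psi_plus M N \<phi> \<iota> n \<theta>"
    and "\<psi>m \<equiv> su3_psi_minus M N \<phi> \<iota> n \<theta>"
    and "B \<equiv> scalar_second_ff M N \<iota> n"
    and "h \<equiv> (\<lambda>p. mfd_metric N (\<iota> p) [mean_curvature M N \<iota> n p, n p])"
    and "rbar \<equiv> r_phi N \<phi>"
    and "pd \<equiv> pd_star N \<phi>"
  defines "r \<equiv> r_omega M \<omega> \<psi>p"
    and "\<eta> \<equiv> eta_form M I \<omega> \<psi>p \<psi>m"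
    and "d\<theta> \<equiv> ext_deriv (mfd_atlas M) (\<lambda>p _. \<theta> p)"
  assumes "riemannian_manifold N" and "g2_structure N \<phi>"
    and "riemannian_manifold M" and "smooth_immersion (mfd_atlas M) (mfd_atlas N) \<iota>"
    and "induced_metric M N \<iota>" and "unit_normal_field M N \<iota> n"
    and "smooth_tensor_field (mfd_atlas M) 0 (\<lambda>p _. \<theta> p)"
  shows "(\<forall>p x y. r p [x, y] =
       cos (\<theta> p) * (- act_slot (I p) 2 (pull rbar p) [x, y] + B p [x, y])
       - sin (\<theta> p) * (pull rbar p [x, y] + act_slot (I p) 2 (B p) [x, y])) \<and>
    (\<forall>p x. 2 * act_all (I p) (codiff M \<omega> p) [x] =
       pull pd p [x] - 2 * rbar (\<iota> p) [n p, d\<iota> p (I p x)] + 2 * rbar (\<iota> p) [d\<iota> p (I p x), n p]) \<and>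
    (\<forall>p. pd (\<iota> p) [n p] = - 2 * cos (\<theta> p) * metric_trace (g p) (r p)
       - 2 * sin (\<theta> p) * contraction (g p) (\<omega> p) (r p) + 12 * h p) \<and>
    (\<forall>p. metric_trace (g p) (pull rbar p) = - sin (\<theta> p) * metric_trace (g p) (r p)
       + cos (\<theta> p) * contraction (g p) (\<omega> p) (r p)) \<and>
    (\<forall>p x. 3 * act_all (I p) (\<eta> p) [x] = d\<theta> p [x] - rbar (\<iota> p) [d\<iota> p x, n p])"
proof -
  interpret hypersurface N \<phi> M \<iota> n
    by (intro hypersurface.intro g2_manifold.intro riemannian.intro g2_manifold_axioms.intro hypersurface_axioms.intro)
      (rule assms)+
  note defs = assms(1-14)
  have "\<exists>e f. adapted_point N \<phi> M \<iota> n p e f" for p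
  proof -
    interpret hypersurface_point N \<phi> M \<iota> n p ..
    show ?thesis by (rule exists_adapted_point)
  qed
  then obtain e f where ef: "\<And>p. adapted_point N \<phi> M \<iota> n p (e p) (f p)" by metis
  show ?thesis
  proof (intro conjI allI)
    fix p x y
    interpret adapted_point N \<phi> M \<iota> n p "e p" "f p" by (rule ef)
    \<comment> \<open>Undoes the rotation by \<theta> in \<open>traces\<close>. In the third
      identity the mean curvature then contributes -12 h, which the added 12 h cancels.\<close>
    have c: "cos (\<theta> p) * (cos (\<theta> p) * u) + sin (\<theta> p) * (sin (\<theta> p) * u) = u" for u :: real
      using sin_cos_squared_add[of "\<theta> p"]
      by (simp add: power2_eq_square mult.assoc[symmetric] distrib_right[symmetric] add.commute)
    show "r p [x, y] = cos (\<theta> p) * (- act_slot (I p) 2 (pull rbar p) [x, y] + B p [x, y])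
       - sin (\<theta> p) * (pull rbar p [x, y] + act_slot (I p) 2 (B p) [x, y])"
      unfolding defs r_omega_eq by (simp add: act_slot_def pullback_def II_def)
    show "2 * act_all (I p) (codiff M \<omega> p) [x] =
       pull pd p [x] - 2 * rbar (\<iota> p) [n p, d\<iota> p (I p x)] + 2 * rbar (\<iota> p) [d\<iota> p (I p x), n p]"
      unfolding defs codiff_I by (simp add: pullback_def)
    show "pd (\<iota> p) [n p] = - 2 * cos (\<theta> p) * metric_trace (g p) (r p)
       - 2 * sin (\<theta> p) * contraction (g p) (\<omega> p) (r p) + 12 * h p"
      unfolding defs traces
      using c[of "\<Sum>i\<in>UNIV. \<Sum>l\<in>UNIV. RR i l * phi0 i l 0"] c[of "mfd_metric N (\<iota> p) [mean_curvature M N \<iota> n p, n p]"]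
      by (simp add: algebra_simps)
    show "metric_trace (g p) (pull rbar p) = - sin (\<theta> p) * metric_trace (g p) (r p)
       + cos (\<theta> p) * contraction (g p) (\<omega> p) (r p)"
      unfolding defs traces
      using c[of "\<Sum>i\<in>UNIV. RR (shift i) (shift i)"] by (simp add: algebra_simps)
    show "3 * act_all (I p) (\<eta> p) [x] = d\<theta> p [x] - rbar (\<iota> p) [d\<iota> p x, n p]"
      unfolding defs by (rule eta_eq) (rule assms)
  qed
qed

end
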